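(* For every fixed dimension $d$, $p$-Connected Vertex Cover and $p$-Vertex Cover admit parameterized subexponential time algorithms on unit ball graphs in $\mathbb{R}^d$; that is, given such a graph $G$ on $n$ vertices and an integer $k$, one can decide whether $G$ has a (connected) vertex cover of size at most $k$ in time $2^{o(k)}\cdot n^{O(1)}$.
   Context: A unit ball graph in $\mathbb{R}^d$ is the intersection graph of a finite family of closed unit balls in $\mathbb{R}^d$. A vertex cover is a set of vertices meeting every edge; a connected vertex cover is a vertex cover $S$ with $G[S]$ connected. *)

theory Defs
  imports
    "HOL-Analysis.Analysis"
    "HOL-Library.Landau_Symbols"
    "Graph_Theory.Digraph_Component"
begin

section \<open>Graphs\<close>

text \<open>Simple undirected graphs are the symmetric loop-free digraphs of the locale
  \<open>pair_graph\<close>; an edge \<open>{u, v}\<close> is present as the two arcs \<open>(u, v)\<close> and \<open>(v, u)\<close>.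
  Distinct vertices of a unit ball graph may be represented by the same ball.\<close>

definition unit_ball_graph :: "'d::finite itself \<Rightarrow> 'a pair_pre_digraph \<Rightarrow> bool" where
  "unit_ball_graph _ G \<longleftrightarrow> pair_graph G \<and>
     (\<exists>c :: 'a \<Rightarrow> real ^ 'd. \<forall>u \<in> pverts G. \<forall>v \<in> pverts G.
        (u, v) \<in> parcs G \<longleftrightarrow> u \<noteq> v \<and> cball (c u) 1 \<inter> cball (c v) 1 \<noteq> {})"

definition vertex_cover :: "'a pair_pre_digraph \<Rightarrow> 'a set \<Rightarrow> bool" where
  "vertex_cover G S \<longleftrightarrow> S \<subseteq> pverts G \<and> (\<forall>(u, v) \<in> parcs G. u \<in> S \<or> v \<in> S)"

text \<open>As in the library notion of connectedness used here, the graph without vertices is not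
  connected.\<close>

definition connected_vertex_cover :: "'a pair_pre_digraph \<Rightarrow> 'a set \<Rightarrow> bool" where
  "connected_vertex_cover G S \<longleftrightarrow>
     vertex_cover G S \<and> Digraph_Component.connected (induce_subgraph (with_proj G) S)"

definition has_vertex_cover :: "'a pair_pre_digraph \<Rightarrow> nat \<Rightarrow> bool" where
  "has_vertex_cover G k \<longleftrightarrow> (\<exists>S. vertex_cover G S \<and> card S \<le> k)"

definition has_connected_vertex_cover :: "'a pair_pre_digraph \<Rightarrow> nat \<Rightarrow> bool" where
  "has_connected_vertex_cover G k \<longleftrightarrow> (\<exists>S. connected_vertex_cover G S \<and> card S \<le> k)"


section \<open>Model of computation\<close>

text \<open>
  Algorithms are programs of a first-order, call-by-value functional language over unlabelled
  binary trees (pure LISP without atoms other than nil; cf. Jones, \<^emph>\<open>Computability and Complexity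
  from a Programming Perspective\<close>). A program is a finite list of function bodies. Every function
  has one argument, variables are de Bruijn indices into the environment, and function 0 is the
  main function. The running time is the number of evaluation rules applied.

  For a fixed program the environments have bounded length, and every rule performs a bounded
  number of operations on pointers (building a node, testing for nil and following the two
  pointers of a node, pushing or popping an environment entry). There is no comparison or copying
  of whole trees. Hence the running time agrees up to a constant factor with that of a pointer
  machine, and up to a polynomial with that of a Turing machine.
\<close>

datatype val = Nil_val | Cons_val val val

datatype expr =
    Var nat
  | Nil_expr
  | Cons_expr expr expr
  | Case_expr expr expr expr  \<comment> \<open>the third expression sees head and tail as variables 0 and 1\<close>
  | Let_expr expr expr
  | Call nat expr

type_synonym prog = "expr list"

inductive eval :: "prog \<Rightarrow> val list \<Rightarrow> expr \<Rightarrow> val \<Rightarrow> nat \<Rightarrow> bool" for P :: prog where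
  eval_Var: "i < length env \<Longrightarrow> eval P env (Var i) (env ! i) 1"
| eval_Nil: "eval P env Nil_expr Nil_val 1"
| eval_Cons: "eval P env e1 v1 t1 \<Longrightarrow> eval P env e2 v2 t2 \<Longrightarrow>
    eval P env (Cons_expr e1 e2) (Cons_val v1 v2) (t1 + t2 + 1)"
| eval_Case_Nil: "eval P env e Nil_val t \<Longrightarrow> eval P env e1 v t1 \<Longrightarrow>
    eval P env (Case_expr e e1 e2) v (t + t1 + 1)"
| eval_Case_Cons: "eval P env e (Cons_val x y) t \<Longrightarrow> eval P (x # y # env) e2 v t2 \<Longrightarrow>
    eval P env (Case_expr e e1 e2) v (t + t2 + 1)"
| eval_Let: "eval P env e1 w t1 \<Longrightarrow> eval P (w # env) e2 v t2 \<Longrightarrow>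
    eval P env (Let_expr e1 e2) v (t1 + t2 + 1)"
| eval_Call: "eval P env e w t1 \<Longrightarrow> f < length P \<Longrightarrow> eval P [w] (P ! f) v t2 \<Longrightarrow>
    eval P env (Call f e) v (t1 + t2 + 1)"

inductive_cases eval_VarE: "eval P env (Var i) v t"
inductive_cases eval_NilE: "eval P env Nil_expr v t"
inductive_cases eval_ConsE: "eval P env (Cons_expr e1 e2) v t"
inductive_cases eval_CaseE: "eval P env (Case_expr e e1 e2) v t"
inductive_cases eval_LetE: "eval P env (Let_expr e1 e2) v t"
inductive_cases eval_CallE: "eval P env (Call f e) v t"

lemma eval_deterministic:
  "eval P env e v t \<Longrightarrow> eval P env e v' t' \<Longrightarrow> v' = v \<and> t' = t"
proof (induction arbitrary: v' t' rule: eval.induct)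
  case (eval_Var i env)
  then show ?case by (auto elim: eval_VarE)
next
  case (eval_Nil env)
  then show ?case by (auto elim: eval_NilE)
next
  case (eval_Cons env e1 v1 t1 e2 v2 t2)
  from eval_Cons.prems show ?case
    by (rule eval_ConsE) (auto dest!: eval_Cons.IH)
next
  case (eval_Case_Nil env e t e1 v t1 e2)
  from eval_Case_Nil.prems show ?case
    by (rule eval_CaseE) (auto dest!: eval_Case_Nil.IH)
next
  case (eval_Case_Cons env e x y t e2 v t2 e1)
  from eval_Case_Cons.prems show ?case
    by (rule eval_CaseE) (auto dest!: eval_Case_Cons.IH)
next
  case (eval_Let env e1 w t1 e2 v t2)
  from eval_Let.prems show ?case
    by (rule eval_LetE) (auto dest!: eval_Let.IH)
next
  case (eval_Call env e w t1 f v t2)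
  from eval_Call.prems show ?case
    by (rule eval_CallE) (auto dest!: eval_Call.IH)
qed

definition computes_in :: "prog \<Rightarrow> val \<Rightarrow> val \<Rightarrow> nat \<Rightarrow> bool" where
  "computes_in P x y t \<longleftrightarrow> eval P [x] (Call 0 (Var 0)) y t"


section \<open>Encoding of instances\<close>

primrec enc_list :: "val list \<Rightarrow> val" where
  "enc_list [] = Nil_val"
| "enc_list (x # xs) = Cons_val x (enc_list xs)"

definition enc_bool :: "bool \<Rightarrow> val" where
  "enc_bool b = (if b then Cons_val Nil_val Nil_val else Nil_val)"

text \<open>Unary encoding; a bound \<open>2 ^ o(k)\<close> does not distinguish it from the binary one.\<close>

definition enc_nat :: "nat \<Rightarrow> val" where
  "enc_nat k = enc_list (replicate k Nil_val)"

text \<open>The adjacency matrix of a graph with vertex set \<open>{0..<n}\<close>. No geometric representation is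
  part of the input.\<close>

definition enc_graph :: "nat \<Rightarrow> nat pair_pre_digraph \<Rightarrow> val" where
  "enc_graph n G =
     enc_list (map (\<lambda>u. enc_list (map (\<lambda>v. enc_bool ((u, v) \<in> parcs G)) [0..<n])) [0..<n])"

definition enc_instance :: "nat \<Rightarrow> nat pair_pre_digraph \<Rightarrow> nat \<Rightarrow> val" where
  "enc_instance n G k = Cons_val (enc_graph n G) (enc_nat k)"


section \<open>Parameterized subexponential time\<close>

text \<open>One program must be correct and fast on all instances from the given graph class; nothing is
  required of it on other inputs. Constant factors are absorbed by \<open>f\<close>, and \<open>n + 1\<close> instead of
  \<open>n\<close> only matters for the graph without vertices.\<close>

definition param_subexp_algorithm_on ::
  "(nat pair_pre_digraph \<Rightarrow> bool) \<Rightarrow> (nat pair_pre_digraph \<Rightarrow> nat \<Rightarrow> bool) \<Rightarrow> bool" where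
  "param_subexp_algorithm_on C Q \<longleftrightarrow>
     (\<exists>(P :: prog) (f :: nat \<Rightarrow> real) (c :: nat). f \<in> o(\<lambda>k. real k) \<and>
        (\<forall>n G k. C G \<and> pverts G = {0..<n} \<longrightarrow>
           (\<exists>t. computes_in P (enc_instance n G k) (enc_bool (Q G k)) t \<and>
                real t \<le> 2 powr f k * (real n + 1) ^ c)))"

end

theory Submission
  imports Defs "HOL-Real_Asymp.Real_Asymp"
begin

text \<open>
  In a unit ball graph the neighbours of a vertex contain only boundedly many pairwise non-adjacent
  ones. Hence the vertices outside a vertex cover of size \<open>k\<close> that are not isolated number \<open>O(k)\<close>,
  and all others can be ignored.

  Cutting space into cubes of side length about \<open>2 L\<close>, with the best of \<open>L\<close> shifts in each
  coordinate, yields a set \<open>X\<close> of \<open>O(k / L)\<close> vertices such that every independent set inside a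
  component of the graph without \<open>X\<close> has \<open>O(L ^ d)\<close> elements. No geometric representation is
  available, so \<open>X\<close> is guessed together with its intersection with the solution, and in each
  component the complement of the solution, an independent set, is found by trying all small
  vertex sets. The components do not interact, apart from connectivity: for a spanning tree of
  the chosen part of \<open>X\<close> one guesses for each edge which component realizes it, and then the
  components are independent again. With \<open>L\<close> about \<open>k powr (1 / (2 * d))\<close> all guesses together
  consist of \<open>O(k powr (1 - 1 / (2 * d)))\<close> vertices. The resulting set is checked in the end, so
  that wrong guesses do no harm.
\<close>

section \<open>A first-order loop language and its compilation\<close>

text \<open>The exponent comes from a balance: if \<open>L ^ (2 * d) \<ge> k\<close>, then the size
  of \<open>X\<close>, a constant times \<open>k / L\<close>, and the bound \<open>O(L ^ d)\<close>
  on independent sets are both \<open>O(L ^ (2 * d - 1))\<close>. A guess is a word of that length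
  over an alphabet of size polynomial in \<open>k\<close>, so the logarithm of the number of guesses
  exceeds its length only by a factor \<open>O(ln k)\<close>. Connectivity is the obstacle to
  treating components separately, since a path of the solution may pass through many of them. Cut at
  its vertices in \<open>X\<close>, however, such a path falls into pieces each of which uses a
  single component, and the links record enough pieces to connect the chosen part of
  \<open>X\<close>. Each component then has only to keep its own promises, and an exchange argument
  replaces the solution's part there by any valid part that is no larger. Running times are not
  counted step by step: the only loops of the term language are folds over lists, and it is enough
  to bound the lengths of these lists.\<close>

primrec vlist :: "val \<Rightarrow> val list" where
  "vlist Nil_val = []"
| "vlist (Cons_val x y) = x # vlist y"

abbreviation len :: "val \<Rightarrow> nat" where "len v \<equiv> length (vlist v)"

abbreviation truthy :: "val \<Rightarrow> bool" where "truthy v \<equiv> v \<noteq> Nil_val"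

primrec vhd :: "val \<Rightarrow> val" where
  "vhd Nil_val = Nil_val"
| "vhd (Cons_val x y) = x"

primrec vtl :: "val \<Rightarrow> val" where
  "vtl Nil_val = Nil_val"
| "vtl (Cons_val x y) = y"

text \<open>A tree is read as the list of left subtrees along its right spine. This is a bijection,
  so every value is a list and none is malformed.\<close>

lemma enc_list_vlist [simp]: "enc_list (vlist v) = v"
  by (induction v) auto

lemma vlist_enc_list [simp]: "vlist (enc_list xs) = xs"
  by (induction xs) auto

lemma vlist_eq_Nil [simp]: "vlist v = [] \<longleftrightarrow> v = Nil_val"
  by (cases v) auto

lemma vlist_inject: "vlist v = vlist w \<longleftrightarrow> v = w"
  by (metis enc_list_vlist)

lemma vlist_vtl [simp]: "vlist (vtl v) = tl (vlist v)"
  by (cases v) auto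

datatype tm =
    TV nat
  | TN
  | TC tm tm
  | THd tm
  | TTl tm
  | TIf tm tm tm
  | TFold tm tm tm  \<comment> \<open>the body sees the list element and the accumulator as variables 0 and 1\<close>
  | TSkip tm  \<comment> \<open>hides variable 1\<close>
  | TApp tm tm  \<comment> \<open>evaluates the first term in the environment listed by the second\<close>

text \<open>Total by default values: unbound variables, the head and tail of nil, and
  \<open>TSkip\<close> in a too short environment all give nil, so evaluation never gets
  stuck.\<close>

primrec sem :: "tm \<Rightarrow> val list \<Rightarrow> val" where
  "sem (TV i) env = (if i < length env then env ! i else Nil_val)"
| "sem TN env = Nil_val"
| "sem (TC a b) env = Cons_val (sem a env) (sem b env)"
| "sem (THd a) env = vhd (sem a env)"
| "sem (TTl a) env = vtl (sem a env)"
| "sem (TIf c a b) env = (if truthy (sem c env) then sem a env else sem b env)"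
| "sem (TFold l i b) env = foldl (\<lambda>acc x. sem b (x # acc # env)) (sem i env) (vlist (sem l env))"
| "sem (TSkip a) env = (case env of x # y # env' \<Rightarrow> sem a (x # env') | _ \<Rightarrow> Nil_val)"
| "sem (TApp f a) env = sem f (vlist (sem a env))"

text \<open>All folds executed during an evaluation run over at most \<open>Z\<close> elements. This qualitative
  condition replaces any counting of steps: it bounds the running time by a polynomial in \<open>Z\<close>
  whose degree and coefficient depend on the term only.\<close>

primrec bnd :: "nat \<Rightarrow> tm \<Rightarrow> val list \<Rightarrow> bool" where
  "bnd Z (TV i) env = True"
| "bnd Z TN env = True"
| "bnd Z (TC a b) env = (bnd Z a env \<and> bnd Z b env)"
| "bnd Z (THd a) env = bnd Z a env"
| "bnd Z (TTl a) env = bnd Z a env"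
| "bnd Z (TIf c a b) env = (bnd Z c env \<and> (if truthy (sem c env) then bnd Z a env else bnd Z b env))"
| "bnd Z (TFold l i b) env = (bnd Z l env \<and> bnd Z i env \<and> len (sem l env) \<le> Z \<and>
     (\<forall>ys x zs. vlist (sem l env) = ys @ x # zs \<longrightarrow>
        bnd Z b (x # foldl (\<lambda>acc x. sem b (x # acc # env)) (sem i env) ys # env)))"
| "bnd Z (TSkip a) env = (case env of x # y # env' \<Rightarrow> bnd Z a (x # env') | _ \<Rightarrow> True)"
| "bnd Z (TApp f a) env = (bnd Z a env \<and> bnd Z f (vlist (sem a env)))"

text \<open>The environment of the term is one list held in variable 0. What lies below it is
  arbitrary, since \<open>Case_expr\<close> and \<open>Let_expr\<close> push further entries.
  \<open>K\<close> and \<open>D\<close> are fixed before \<open>Z\<close> and the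
  environment.\<close>

definition realizes ::
  "prog \<Rightarrow> tm \<Rightarrow> expr \<Rightarrow> nat \<Rightarrow> nat \<Rightarrow> bool" where
  "realizes P t e K D \<longleftrightarrow> (\<forall>Z env rest. Z \<ge> 1 \<longrightarrow> bnd Z t env \<longrightarrow>
     (\<exists>s \<le> K * Z ^ D. eval P (enc_list env # rest) e (sem t env) s))"

text \<open>Loops call functions by absolute index, so a block of functions has a fixed position,
  while the rest of the program stays open until all blocks are assembled.\<close>

definition code_at :: "prog \<Rightarrow> nat \<Rightarrow> expr list \<Rightarrow> bool" where
  "code_at P j fs \<longleftrightarrow> (\<exists>Q R. P = Q @ fs @ R \<and> length Q = j)"

lemma code_at_append:
  "code_at P j (fs @ gs) \<longleftrightarrow> code_at P j fs \<and> code_at P (j + length fs) gs"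
proof
  assume "code_at P j (fs @ gs)"
  then obtain Q R where "P = Q @ (fs @ gs) @ R" "length Q = j" unfolding code_at_def by blast
  then have "P = Q @ fs @ (gs @ R)" "P = (Q @ fs) @ gs @ R" "length (Q @ fs) = j + length fs"
    by auto
  with \<open>length Q = j\<close> show "code_at P j fs \<and> code_at P (j + length fs) gs"
    unfolding code_at_def by blast
next
  assume "code_at P j fs \<and> code_at P (j + length fs) gs"
  then obtain Q R Q' R' where *: "P = Q @ fs @ R" "length Q = j"
    "P = Q' @ gs @ R'" "length Q' = j + length fs" unfolding code_at_def by blast
  then have "Q @ fs @ R = Q' @ gs @ R'" by simp
  then have "(Q @ fs) @ R = Q' @ (gs @ R')" by simp
  moreover have "length (Q @ fs) = length Q'" using * by simp
  ultimately have "Q @ fs = Q' \<and> R = gs @ R'"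
    using append_eq_append_conv[of "Q @ fs" Q' R "gs @ R'"] by blast
  with * have "P = Q @ (fs @ gs) @ R'" by simp
  with \<open>length Q = j\<close> show "code_at P j (fs @ gs)" unfolding code_at_def by blast
qed

lemma code_at_single: "code_at P j [f] \<Longrightarrow> j < length P \<and> P ! j = f"
  unfolding code_at_def by (auto simp: nth_append)

primrec get_expr :: "nat \<Rightarrow> expr" where
  "get_expr 0 = Case_expr (Var 0) Nil_expr (Var 0)"
| "get_expr (Suc i) = Case_expr (Var 0) Nil_expr (Let_expr (Var 1) (get_expr i))"

lemma eval_VarI: "i < length env \<Longrightarrow> v = env ! i \<Longrightarrow> t = 1 \<Longrightarrow> eval P env (Var i) v t"
  using eval_Var by blast

lemma eval_iffs:
  "eval P env (Var i) v t \<longleftrightarrow> i < length env \<and> v = env ! i \<and> t = 1"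
  "eval P env Nil_expr v t \<longleftrightarrow> v = Nil_val \<and> t = 1"
  "eval P env (Cons_expr e1 e2) v t \<longleftrightarrow>
     (\<exists>v1 v2 t1 t2. eval P env e1 v1 t1 \<and> eval P env e2 v2 t2 \<and> v = Cons_val v1 v2 \<and> t = t1 + t2 + 1)"
  "eval P env (Case_expr e e1 e2) v t \<longleftrightarrow>
     (\<exists>w t1 t2. eval P env e w t1 \<and> t = t1 + t2 + 1 \<and>
        (case w of Nil_val \<Rightarrow> eval P env e1 v t2 | Cons_val x y \<Rightarrow> eval P (x # y # env) e2 v t2))"
  "eval P env (Let_expr e1 e2) v t \<longleftrightarrow>
     (\<exists>w t1 t2. eval P env e1 w t1 \<and> eval P (w # env) e2 v t2 \<and> t = t1 + t2 + 1)"
proof -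
  show "eval P env (Var i) v t \<longleftrightarrow> i < length env \<and> v = env ! i \<and> t = 1"
    by (auto elim!: eval_VarE intro: eval_VarI)
  show "eval P env Nil_expr v t \<longleftrightarrow> v = Nil_val \<and> t = 1"
    by (auto elim!: eval_NilE intro: eval_Nil[simplified])
  show "eval P env (Cons_expr e1 e2) v t \<longleftrightarrow>
     (\<exists>v1 v2 t1 t2. eval P env e1 v1 t1 \<and> eval P env e2 v2 t2 \<and> v = Cons_val v1 v2 \<and> t = t1 + t2 + 1)"
    by (rule iffI, erule eval_ConsE, simp, blast) (auto intro: eval_Cons[simplified])
  show "eval P env (Case_expr e e1 e2) v t \<longleftrightarrow>
     (\<exists>w t1 t2. eval P env e w t1 \<and> t = t1 + t2 + 1 \<and>
        (case w of Nil_val \<Rightarrow> eval P env e1 v t2 | Cons_val x y \<Rightarrow> eval P (x # y # env) e2 v t2))"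
    (is "?l \<longleftrightarrow> (\<exists>w t1 t2. ?r w t1 t2)")
  proof
    assume ?l
    then show "\<exists>w t1 t2. ?r w t1 t2" by (rule eval_CaseE) (force+)
  next
    assume "\<exists>w t1 t2. ?r w t1 t2"
    then obtain w t1 t2 where "?r w t1 t2" by blast
    then show ?l by (cases w) (auto intro: eval_Case_Nil[simplified] eval_Case_Cons[simplified])
  qed
  show "eval P env (Let_expr e1 e2) v t \<longleftrightarrow>
     (\<exists>w t1 t2. eval P env e1 w t1 \<and> eval P (w # env) e2 v t2 \<and> t = t1 + t2 + 1)"
    by (rule iffI, erule eval_LetE, simp, blast) (auto intro: eval_Let[simplified])
qed

lemma eval_get_expr:
  "\<exists>s \<le> 4 * i + 3. eval P (enc_list env # rest) (get_expr i) (sem (TV i) env) s"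
proof (induction i arbitrary: env rest)
  case 0
  show ?case
  proof (cases env)
    case Nil
    then have "eval P (enc_list env # rest) (get_expr 0) (sem (TV 0) env) (1 + 1 + 1)"
      by (auto simp: eval_iffs)
    then show ?thesis by (intro exI conjI) auto
  next
    case (Cons a list)
    then have "eval P (enc_list env # rest) (get_expr 0) (sem (TV 0) env) (1 + 1 + 1)"
      by (auto simp: eval_iffs)
    then show ?thesis by (intro exI conjI) auto
  qed
next
  case (Suc i)
  show ?case
  proof (cases env)
    case Nil
    then have "eval P (enc_list env # rest) (get_expr (Suc i)) (sem (TV (Suc i)) env) (1 + 1 + 1)"
      by (auto simp: eval_iffs)
    then show ?thesis by (intro exI conjI) auto
  next
    case (Cons a env')
    obtain s where "s \<le> 4 * i + 3"
      "eval P (enc_list env' # a # enc_list env' # enc_list env # rest) (get_expr i) (sem (TV i) env') s"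
      using Suc by blast
    then have "eval P (enc_list env # rest) (get_expr (Suc i)) (sem (TV i) env') (1 + (1 + s + 1) + 1)"
      using Cons by (auto intro!: eval_Case_Cons eval_Let eval_VarI simp del: add_Suc_right One_nat_def)
    with \<open>s \<le> 4 * i + 3\<close> show ?thesis
      using Cons by (intro exI[of _ "1 + (1 + s + 1) + 1"] conjI) auto
  qed
qed

lemma realizesE:
  assumes "realizes P t e K D" "Z \<ge> 1" "bnd Z t env"
  obtains s where "s \<le> K * Z ^ D" "eval P (enc_list env # rest) e (sem t env) s"
  using assms unfolding realizes_def by blast

lemma pow_bound_mono:
  fixes Z :: nat
  assumes "s \<le> K * Z ^ D" "Z \<ge> 1" "D \<le> D'"
  shows "s \<le> K * Z ^ D'"
  using assms by (meson le_trans mult_le_mono2 power_increasing)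

lemma one_le_pow: "(Z::nat) \<ge> 1 \<Longrightarrow> c \<le> c * Z ^ D"
  by simp

lemma realizes_TC:
  assumes "realizes P a ea Ka Da" "realizes P b eb Kb Db"
  shows "realizes P (TC a b) (Cons_expr ea eb) (Ka + Kb + 1) (Da + Db)"
  unfolding realizes_def
proof (intro allI impI)
  fix Z env rest assume Z: "(Z::nat) \<ge> 1" and b: "bnd Z (TC a b) env"
  obtain s1 where s1: "s1 \<le> Ka * Z ^ Da" "eval P (enc_list env # rest) ea (sem a env) s1"
    using realizesE[OF assms(1) Z] b by auto
  obtain s2 where s2: "s2 \<le> Kb * Z ^ Db" "eval P (enc_list env # rest) eb (sem b env) s2"
    using realizesE[OF assms(2) Z] b by auto
  have "s1 + s2 + 1 \<le> (Ka + Kb + 1) * Z ^ (Da + Db)"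
    using pow_bound_mono[OF s1(1) Z, of "Da + Db"] pow_bound_mono[OF s2(1) Z, of "Da + Db"]
      one_le_pow[OF Z, of 1 "Da + Db"] unfolding add_mult_distrib by linarith
  moreover have "eval P (enc_list env # rest) (Cons_expr ea eb) (sem (TC a b) env) (s1 + s2 + 1)"
    using eval_Cons[OF s1(2) s2(2)] by simp
  ultimately show "\<exists>s\<le>(Ka + Kb + 1) * Z ^ (Da + Db).
      eval P (enc_list env # rest) (Cons_expr ea eb) (sem (TC a b) env) s" by blast
qed

lemma realizes_unary:
  assumes "realizes P a ea K D"
  shows "realizes P (THd a) (Case_expr ea Nil_expr (Var 0)) (K + 2) D"
    and "realizes P (TTl a) (Case_expr ea Nil_expr (Var 1)) (K + 2) D"
proof -
  { fix Z env rest assume Z: "(Z::nat) \<ge> 1" and b: "bnd Z a env"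
    obtain s where s: "s \<le> K * Z ^ D" "eval P (enc_list env # rest) ea (sem a env) s"
      using realizesE[OF assms Z b] by auto
    have "s + 1 + 1 \<le> (K + 2) * Z ^ D"
      using s(1) one_le_pow[OF Z, of 2 D] unfolding add_mult_distrib by linarith
    moreover have "eval P (enc_list env # rest) (Case_expr ea Nil_expr (Var 0)) (vhd (sem a env)) (s + 1 + 1)
       \<and> eval P (enc_list env # rest) (Case_expr ea Nil_expr (Var 1)) (vtl (sem a env)) (s + 1 + 1)"
    proof (cases "sem a env")
      case Nil_val
      then show ?thesis using s(2) eval_Nil by (auto intro!: eval_Case_Nil simp del: add_Suc_right One_nat_def)
    next
      case (Cons_val x y)
      then show ?thesis using s(2) by (auto intro!: eval_Case_Cons eval_VarI simp del: add_Suc_right One_nat_def)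
    qed
    ultimately have "\<exists>s\<le>(K + 2) * Z ^ D. eval P (enc_list env # rest) (Case_expr ea Nil_expr (Var 0)) (vhd (sem a env)) s"
      "\<exists>s\<le>(K + 2) * Z ^ D. eval P (enc_list env # rest) (Case_expr ea Nil_expr (Var 1)) (vtl (sem a env)) s"
      by blast+ }
  then show "realizes P (THd a) (Case_expr ea Nil_expr (Var 0)) (K + 2) D"
    "realizes P (TTl a) (Case_expr ea Nil_expr (Var 1)) (K + 2) D"
    unfolding realizes_def by auto
qed

text \<open>A case distinction on a non-nil condition pushes two entries, so the environment is
  fetched back from variable 2.\<close>

lemma realizes_TIf:
  assumes "realizes P c ec Kc Dc" "realizes P a ea Ka Da" "realizes P b eb Kb Db"
  shows "realizes P (TIf c a b) (Case_expr ec eb (Let_expr (Var 2) ea)) (Kc + Ka + Kb + 3) (Dc + Da + Db)"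
  unfolding realizes_def
proof (intro allI impI)
  fix Z env rest assume Z: "(Z::nat) \<ge> 1" and b: "bnd Z (TIf c a b) env"
  let ?D = "Dc + Da + Db"
  have mono: "s \<le> K * Z ^ ?D" if "s \<le> K * Z ^ D" "D \<le> ?D" for s K D
    using pow_bound_mono[OF that(1) Z that(2)] .
  obtain s1 where s1: "s1 \<le> Kc * Z ^ Dc" "eval P (enc_list env # rest) ec (sem c env) s1"
    using realizesE[OF assms(1) Z] b by auto
  have s1': "s1 \<le> Kc * Z ^ ?D" using mono[OF s1(1)] by simp
  have three: "3 \<le> 3 * Z ^ ?D" using Z by simp
  show "\<exists>s\<le>(Kc + Ka + Kb + 3) * Z ^ ?D. eval P (enc_list env # rest)
     (Case_expr ec eb (Let_expr (Var 2) ea)) (sem (TIf c a b) env) s"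
  proof (cases "sem c env")
    case Nil_val
    then obtain s2 where s2: "s2 \<le> Kb * Z ^ Db" "eval P (enc_list env # rest) eb (sem b env) s2"
      using realizesE[OF assms(3) Z] b by auto
    have "s2 \<le> Kb * Z ^ ?D" using mono[OF s2(1)] by simp
    then have "s1 + s2 + 1 \<le> (Kc + Ka + Kb + 3) * Z ^ ?D"
      using s1' three unfolding add_mult_distrib by linarith
    moreover have "eval P (enc_list env # rest) (Case_expr ec eb (Let_expr (Var 2) ea))
        (sem (TIf c a b) env) (s1 + s2 + 1)"
      using eval_Case_Nil[OF s1(2)[unfolded Nil_val] s2(2)] Nil_val by simp
    ultimately show ?thesis by blast
  next
    case (Cons_val x y)
    then obtain s2 where s2: "s2 \<le> Ka * Z ^ Da"
      "eval P (enc_list env # x # y # enc_list env # rest) ea (sem a env) s2"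
      using realizesE[OF assms(2) Z] b by auto
    have "s2 \<le> Ka * Z ^ ?D" using mono[OF s2(1)] by simp
    then have "s1 + (1 + s2 + 1) + 1 \<le> (Kc + Ka + Kb + 3) * Z ^ ?D"
      using s1' three unfolding add_mult_distrib by linarith
    moreover have "eval P (enc_list env # rest) (Case_expr ec eb (Let_expr (Var 2) ea))
        (sem (TIf c a b) env) (s1 + (1 + s2 + 1) + 1)"
      using s1(2) s2(2) Cons_val by (auto intro!: eval_Case_Cons eval_Let eval_VarI simp del: add_Suc_right One_nat_def)
    ultimately show ?thesis by blast
  qed
qed

lemma realizes_TSkip:
  assumes "realizes P a ea K D"
  shows "realizes P (TSkip a) (Case_expr (Var 0) Nil_expr (Case_expr (Var 1) Nil_expr
      (Let_expr (Cons_expr (Var 2) (Var 1)) ea))) (K + 9) D"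
  unfolding realizes_def
proof (intro allI impI)
  fix Z env rest assume Z: "(Z::nat) \<ge> 1" and b: "bnd Z (TSkip a) env"
  let ?e = "Case_expr (Var 0) Nil_expr (Case_expr (Var 1) Nil_expr
      (Let_expr (Cons_expr (Var 2) (Var 1)) ea))"
  have nine: "9 \<le> 9 * Z ^ D" using Z by simp
  consider "env = []" | x where "env = [x]" | x y env' where "env = x # y # env'"
    by (metis neq_Nil_conv)
  then show "\<exists>s\<le>(K + 9) * Z ^ D. eval P (enc_list env # rest) ?e (sem (TSkip a) env) s"
  proof cases
    case 1
    then have "eval P (enc_list env # rest) ?e (sem (TSkip a) env) (1 + 1 + 1)"
      by (auto simp: eval_iffs)
    then show ?thesis using nine unfolding add_mult_distrib by (intro exI conjI) auto
  next
    case 2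
    then have "eval P (enc_list env # rest) ?e (sem (TSkip a) env) (1 + (1 + 1 + 1) + 1)"
      by (auto simp: eval_iffs)
    then show ?thesis using nine unfolding add_mult_distrib by (intro exI conjI) auto
  next
    case 3
    then obtain s where s: "s \<le> K * Z ^ D"
      "eval P (enc_list (x # env') # y # enc_list env' # x # enc_list (y # env') # enc_list env # rest)
         ea (sem a (x # env')) s"
      using realizesE[OF assms Z, of "x # env'"] b by (metis (no_types, lifting) bnd.simps(8) list.simps(5))
    let ?env = "y # enc_list env' # x # enc_list (y # env') # enc_list env # rest"
    have "eval P ?env (Cons_expr (Var 2) (Var 1)) (enc_list (x # env')) 3"
      by (auto simp: eval_iffs)
    note e1 = eval_Let[OF this s(2)]
    have "eval P (enc_list env # rest) ?e (sem (TSkip a) env) (s + 8)"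
      using e1 3 by (auto simp: eval_iffs(1,4))
    then show ?thesis using nine s(1) unfolding add_mult_distrib by (intro exI conjI) auto
  qed
qed

lemma realizes_TApp:
  assumes "realizes P f ef Kf Df" "realizes P a ea Ka Da"
  shows "realizes P (TApp f a) (Let_expr ea ef) (Kf + Ka + 1) (Df + Da)"
  unfolding realizes_def
proof (intro allI impI)
  fix Z env rest assume Z: "(Z::nat) \<ge> 1" and b: "bnd Z (TApp f a) env"
  obtain s1 where s1: "s1 \<le> Ka * Z ^ Da" "eval P (enc_list env # rest) ea (sem a env) s1"
    using realizesE[OF assms(2) Z] b by auto
  obtain s2 where s2: "s2 \<le> Kf * Z ^ Df" "eval P (sem a env # enc_list env # rest) ef (sem (TApp f a) env) s2"
    using realizesE[OF assms(1) Z, of "vlist (sem a env)"] b by auto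
  have "s1 + s2 + 1 \<le> (Kf + Ka + 1) * Z ^ (Df + Da)"
    using pow_bound_mono[OF s1(1) Z, of "Df + Da"] pow_bound_mono[OF s2(1) Z, of "Df + Da"]
      one_le_pow[OF Z, of 1 "Df + Da"] unfolding add_mult_distrib by linarith
  then show "\<exists>s\<le>(Kf + Ka + 1) * Z ^ (Df + Da).
      eval P (enc_list env # rest) (Let_expr ea ef) (sem (TApp f a) env) s"
    using eval_Let[OF s1(2) s2(2)] by blast
qed

text \<open>A fold becomes a tail-recursive function whose single argument packs the remaining list,
  the accumulator and the environment. After the three case distinctions, variables 0 to 3 are the
  element, the rest of the list, the accumulator and the environment.\<close>

definition loop_expr :: "nat \<Rightarrow> expr \<Rightarrow> expr" where
  "loop_expr j e = Case_expr (Var 0) Nil_expr (Case_expr (Var 1) Nil_expr (Case_expr (Var 2) (Var 0)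
     (Let_expr (Let_expr (Cons_expr (Var 0) (Cons_expr (Var 2) (Var 3))) e)
       (Call j (Cons_expr (Var 2) (Cons_expr (Var 0) (Var 4)))))))"

text \<open>There are \<open>length xs + 1\<close> calls, each costing at most one run of the body
  plus a constant overhead, for which 30 is ample.\<close>

lemma eval_loop_expr:
  assumes "realizes P b e K D" "j < length P" "P ! j = loop_expr j e" "Z \<ge> 1"
    and "\<And>ys x zs. xs = ys @ x # zs \<Longrightarrow>
      bnd Z b (x # foldl (\<lambda>acc x. sem b (x # acc # env)) a ys # env)"
  shows "\<exists>s \<le> (length xs + 1) * ((K + 30) * Z ^ D).
    eval P [Cons_val (enc_list xs) (Cons_val a (enc_list env))] (P ! j)
      (foldl (\<lambda>acc x. sem b (x # acc # env)) a xs) s"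
  using assms(5)
proof (induction xs arbitrary: a)
  case Nil
  have "30 \<le> (K + 30) * Z ^ D" using \<open>Z \<ge> 1\<close> by (simp add: add_mult_distrib trans_le_add2)
  moreover have "eval P [Cons_val (enc_list []) (Cons_val a (enc_list env))] (P ! j)
      (foldl (\<lambda>acc x. sem b (x # acc # env)) a []) (1 + (1 + (1 + 1 + 1) + 1) + 1)"
    unfolding assms(3) loop_expr_def
    by (auto simp: eval_iffs)
  ultimately show ?case by (intro exI conjI) auto
next
  case (Cons x xs)
  let ?f = "\<lambda>acc x. sem b (x # acc # env)"
  let ?a = "?f a x"
  have "bnd Z b (x # a # env)" using Cons.prems[of "[]" x xs] by simp
  then obtain s1 where s1: "s1 \<le> K * Z ^ D"
    "eval P (enc_list (x # a # env) # x # enc_list xs # a # enc_list env # enc_list (x # xs) # Cons_val a (enc_list env)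
        # [Cons_val (enc_list (x # xs)) (Cons_val a (enc_list env))]) e ?a s1"
    using realizesE[OF assms(1,4)] by metis
  obtain s2 where s2: "s2 \<le> (length xs + 1) * ((K + 30) * Z ^ D)"
    "eval P [Cons_val (enc_list xs) (Cons_val ?a (enc_list env))] (P ! j) (foldl ?f ?a xs) s2"
    using Cons.IH[of ?a] Cons.prems[of "x # _"] by auto
  let ?env = "[x, enc_list xs, a, enc_list env, enc_list (x # xs), Cons_val a (enc_list env),
    Cons_val (enc_list (x # xs)) (Cons_val a (enc_list env))]"
  have "eval P ?env (Cons_expr (Var 0) (Cons_expr (Var 2) (Var 3))) (enc_list (x # a # env)) 5"
    by (auto simp: eval_iffs)
  note e1 = eval_Let[OF this s1(2)]
  have "eval P (?a # ?env) (Cons_expr (Var 2) (Cons_expr (Var 0) (Var 4)))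
     (Cons_val (enc_list xs) (Cons_val ?a (enc_list env))) 5"
    by (auto simp: eval_iffs)
  note e2 = eval_Let[OF e1 eval_Call[OF this assms(2) s2(2)]]
  have "eval P [Cons_val (enc_list (x # xs)) (Cons_val a (enc_list env))] (loop_expr j e)
      (foldl ?f ?a xs) (s1 + s2 + 19)"
    unfolding loop_expr_def using e2 by (auto simp: eval_iffs(1,4))
  moreover have "s1 + s2 + 19 \<le> (length (x # xs) + 1) * ((K + 30) * Z ^ D)"
  proof -
    have "30 \<le> 30 * Z ^ D" using \<open>Z \<ge> 1\<close> by simp
    then have "s1 + 30 \<le> (K + 30) * Z ^ D" using s1(1) unfolding add_mult_distrib by linarith
    moreover have "(length (x # xs) + 1) * ((K + 30) * Z ^ D) =
      (length xs + 1) * ((K + 30) * Z ^ D) + (K + 30) * Z ^ D" by simp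
    ultimately show ?thesis using s2(1) by linarith
  qed
  ultimately show ?case unfolding assms(3) foldl_Cons by blast
qed

text \<open>A fold raises the exponent by one: there are at most \<open>Z + 1\<close>, hence at most
  \<open>2 * Z\<close>, calls with a body of degree \<open>Db\<close>.\<close>

lemma realizes_TFold:
  assumes "realizes P l el Kl Dl" "realizes P i ei Ki Di" "realizes P b eb Kb Db"
    and "j < length P" "P ! j = loop_expr j eb"
  shows "realizes P (TFold l i b) (Call j (Cons_expr el (Cons_expr ei (Var 0))))
    (Kl + Ki + 2 * (Kb + 30) + 4) (Dl + Di + Suc Db)"
  unfolding realizes_def
proof (intro allI impI)
  fix Z env rest assume Z: "(Z::nat) \<ge> 1" and b: "bnd Z (TFold l i b) env"
  let ?D = "Dl + Di + Suc Db"
  have mono: "s \<le> K * Z ^ ?D" if "s \<le> K * Z ^ D" "D \<le> ?D" for s K D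
    using pow_bound_mono[OF that(1) Z that(2)] .
  obtain s1 where s1: "s1 \<le> Kl * Z ^ Dl" "eval P (enc_list env # rest) el (sem l env) s1"
    using realizesE[OF assms(1) Z] b by auto
  obtain s2 where s2: "s2 \<le> Ki * Z ^ Di" "eval P (enc_list env # rest) ei (sem i env) s2"
    using realizesE[OF assms(2) Z] b by auto
  obtain s3 where s3: "s3 \<le> (len (sem l env) + 1) * ((Kb + 30) * Z ^ Db)"
    "eval P [Cons_val (sem l env) (Cons_val (sem i env) (enc_list env))] (P ! j) (sem (TFold l i b) env) s3"
    using eval_loop_expr[OF assms(3,4,5) Z, of "vlist (sem l env)" env "sem i env"] b by auto
  have "(len (sem l env) + 1) * ((Kb + 30) * Z ^ Db) \<le> (2 * Z) * ((Kb + 30) * Z ^ Db)"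
    using b Z by (intro mult_le_mono1) auto
  also have "\<dots> = (2 * (Kb + 30)) * Z ^ Suc Db" by (simp add: algebra_simps)
  finally have "s3 \<le> (2 * (Kb + 30)) * Z ^ Suc Db" using s3(1) by simp
  then have s3': "s3 \<le> (2 * (Kb + 30)) * Z ^ ?D" by (rule mono) simp
  have four: "4 \<le> 4 * Z ^ ?D" using Z by simp
  have "(s1 + (s2 + 1 + 1) + 1) + s3 + 1 \<le> (Kl + Ki + 2 * (Kb + 30) + 4) * Z ^ ?D"
    using mono[OF s1(1)] mono[OF s2(1)] s3' four unfolding add_mult_distrib by linarith
  moreover have "eval P (enc_list env # rest) (Call j (Cons_expr el (Cons_expr ei (Var 0))))
     (sem (TFold l i b) env) ((s1 + (s2 + 1 + 1) + 1) + s3 + 1)"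
    using s1(2) s2(2) s3(2) assms(4)
    by (auto intro!: eval_Call eval_Cons eval_VarI simp del: add_Suc_right One_nat_def sem.simps)
  ultimately show "\<exists>s\<le>(Kl + Ki + 2 * (Kb + 30) + 4) * Z ^ ?D.
      eval P (enc_list env # rest) (Call j (Cons_expr el (Cons_expr ei (Var 0))))
        (sem (TFold l i b) env) s" by blast
qed

text \<open>The blocks of the subterms follow one another from index \<open>j\<close> on, and a fold
  appends its loop function last, at an index given by the lengths of the earlier blocks. The
  program is quantified last because it is complete only at the end.\<close>

lemma tm_realizable:
  "\<exists>e fs K D. \<forall>P. code_at P j fs \<longrightarrow> realizes P t e K D"
proof (induction t arbitrary: j)
  case (TV i)
  have "realizes P (TV i) (get_expr i) (4 * i + 3) 0" for P
    unfolding realizes_def using eval_get_expr by simp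
  then show ?case by blast
next
  case TN
  have "realizes P TN Nil_expr 1 0" for P
    unfolding realizes_def using eval_Nil by auto
  then show ?case by blast
next
  case (TC a b)
  obtain ea fa Ka Da where a: "\<And>P. code_at P j fa \<Longrightarrow> realizes P a ea Ka Da" using TC(1) by meson
  obtain eb fb Kb Db where b: "\<And>P. code_at P (j + length fa) fb \<Longrightarrow> realizes P b eb Kb Db"
    using TC(2) by meson
  show ?case
    using realizes_TC[OF a b] by (intro exI[of _ "fa @ fb"] exI) (auto simp: code_at_append)
next
  case (THd a)
  then show ?case using realizes_unary(1) by meson
next
  case (TTl a)
  then show ?case using realizes_unary(2) by meson
next
  case (TIf c a b)
  obtain ec fc Kc Dc where c: "\<And>P. code_at P j fc \<Longrightarrow> realizes P c ec Kc Dc" using TIf(1) by meson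
  obtain ea fa Ka Da where a: "\<And>P. code_at P (j + length fc) fa \<Longrightarrow> realizes P a ea Ka Da"
    using TIf(2) by meson
  obtain eb fb Kb Db where b: "\<And>P. code_at P (j + length fc + length fa) fb \<Longrightarrow> realizes P b eb Kb Db"
    using TIf(3) by meson
  show ?case
    using realizes_TIf[OF c a b] by (intro exI[of _ "fc @ fa @ fb"] exI) (auto simp: code_at_append)
next
  case (TFold l i b)
  obtain el fl Kl Dl where l: "\<And>P. code_at P j fl \<Longrightarrow> realizes P l el Kl Dl" using TFold(1) by meson
  obtain ei fi Ki Di where i: "\<And>P. code_at P (j + length fl) fi \<Longrightarrow> realizes P i ei Ki Di"
    using TFold(2) by meson
  obtain eb fb Kb Db where b: "\<And>P. code_at P (j + length fl + length fi) fb \<Longrightarrow> realizes P b eb Kb Db"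
    using TFold(3) by meson
  let ?j = "j + length fl + length fi + length fb"
  show ?case
    using realizes_TFold[OF l i b, of _ ?j] code_at_single[of _ ?j]
    by (intro exI[of _ "fl @ fi @ fb @ [loop_expr ?j eb]"] exI) (auto simp: code_at_append)
next
  case (TSkip a)
  then show ?case using realizes_TSkip by meson
next
  case (TApp f a)
  obtain ea fa Ka Da where a: "\<And>P. code_at P j fa \<Longrightarrow> realizes P a ea Ka Da" using TApp(2) by meson
  obtain ef ff Kf Df where f: "\<And>P. code_at P (j + length fa) ff \<Longrightarrow> realizes P f ef Kf Df"
    using TApp(1) by meson
  show ?case
    using realizes_TApp[OF f a] by (intro exI[of _ "fa @ ff"] exI) (auto simp: code_at_append)
qed

theorem tm_program:
  "\<exists>P K D. \<forall>Z x. Z \<ge> 1 \<longrightarrow> bnd Z t [x] \<longrightarrow> (\<exists>s \<le> K * Z ^ D. computes_in P x (sem t [x]) s)"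
proof -
  obtain e fs K D where e: "\<And>P. code_at P 1 fs \<Longrightarrow> realizes P t e K D"
    using tm_realizable by meson
  \<comment> \<open>Function 0 wraps the input into a one-entry environment, which is why the
    compiled functions start at index 1.\<close>
  define f0 where "f0 = Let_expr (Cons_expr (Var 0) Nil_expr) e"
  let ?P = "f0 # fs"
  have "code_at ?P 1 fs" unfolding code_at_def
    by (rule exI[of _ "[f0]"], rule exI[of _ "[]"]) simp
  then have r: "realizes ?P t e K D" by (rule e)
  have "\<exists>s \<le> (K + 7) * Z ^ D. computes_in ?P x (sem t [x]) s" if Z: "Z \<ge> 1" and b: "bnd Z t [x]" for Z x
  proof -
    obtain s where s: "s \<le> K * Z ^ D" "eval ?P (enc_list [x] # [x]) e (sem t [x]) s"
      using realizesE[OF r Z b] .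
    have "computes_in ?P x (sem t [x]) (1 + ((1 + 1 + 1) + s + 1) + 1)"
      unfolding computes_in_def
      by (rule eval_Call) (use s(2) in \<open>auto simp: f0_def eval_iffs\<close>)
    moreover have "7 \<le> 7 * Z ^ D" using Z by simp
    ultimately show ?thesis using s(1) unfolding add_mult_distrib by (intro exI conjI) auto
  qed
  then show ?thesis by blast
qed

section \<open>Loop programs for lists and reachability\<close>

text \<open>A procedure call: \<open>f\<close> sees just the listed arguments, so it can be analysed
  once for all contexts.\<close>

definition app :: "tm \<Rightarrow> tm list \<Rightarrow> tm" where
  "app f as = TApp f (foldr TC as TN)"

lemma vlist_sem_foldr_TC: "vlist (sem (foldr TC as TN) env) = map (\<lambda>a. sem a env) as"
  by (induction as) auto

lemma bnd_foldr_TC: "bnd Z (foldr TC as TN) env \<longleftrightarrow> (\<forall>a \<in> set as. bnd Z a env)"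
  by (induction as) auto

lemma sem_app [simp]: "sem (app f as) env = sem f (map (\<lambda>a. sem a env) as)"
  unfolding app_def by (simp add: vlist_sem_foldr_TC)

lemma bnd_app [simp]:
  "bnd Z (app f as) env \<longleftrightarrow> (\<forall>a \<in> set as. bnd Z a env) \<and> bnd Z f (map (\<lambda>a. sem a env) as)"
  unfolding app_def by (simp add: vlist_sem_foldr_TC bnd_foldr_TC)

definition tt :: tm where "tt = TC TN TN"
definition tnot :: "tm \<Rightarrow> tm" where "tnot c = TIf c TN tt"
definition tand :: "tm \<Rightarrow> tm \<Rightarrow> tm" where "tand a b = TIf a b TN"
definition tor :: "tm \<Rightarrow> tm \<Rightarrow> tm" where "tor a b = TIf a tt b"
text \<open>\<open>TSkip\<close> hides the accumulator, so a condition sees only the element on top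
  of the surrounding environment. The same holds for \<open>tall\<close> and
  \<open>tfilter\<close>.\<close>

definition tex :: "tm \<Rightarrow> tm \<Rightarrow> tm" where "tex l c = TFold l TN (TIf (TV 1) tt (TSkip c))"
definition tall :: "tm \<Rightarrow> tm \<Rightarrow> tm" where "tall l c = tnot (tex l (tnot c))"
definition tfilter :: "tm \<Rightarrow> tm \<Rightarrow> tm" where
  "tfilter l c = TFold l TN (TIf (TSkip c) (TC (TV 0) (TV 1)) (TV 1))"

lemma sem_tt [simp]: "sem tt env = Cons_val Nil_val Nil_val"
  by (simp add: tt_def)

lemma bnd_tt [simp]: "bnd Z tt env"
  by (simp add: tt_def)

text \<open>Truth has many representatives, so only truth values are specified; equations with
  \<open>Nil_val\<close> are the form to which \<open>truthy\<close> unfolds.\<close>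

lemma sem_connectives [simp]:
  "sem (tnot a) env = Nil_val \<longleftrightarrow> truthy (sem a env)"
  "sem (tand a b) env = Nil_val \<longleftrightarrow> \<not> (truthy (sem a env) \<and> truthy (sem b env))"
  "sem (tor a b) env = Nil_val \<longleftrightarrow> \<not> (truthy (sem a env) \<or> truthy (sem b env))"
  by (simp_all add: tnot_def tand_def tor_def)

lemma bnd_connectives [simp]:
  "bnd Z (tnot a) env \<longleftrightarrow> bnd Z a env"
  "bnd Z (tand a b) env \<longleftrightarrow> bnd Z a env \<and> (truthy (sem a env) \<longrightarrow> bnd Z b env)"
  "bnd Z (tor a b) env \<longleftrightarrow> bnd Z a env \<and> (\<not> truthy (sem a env) \<longrightarrow> bnd Z b env)"
  by (auto simp add: tnot_def tand_def tor_def)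

lemma foldl_exists:
  "foldl (\<lambda>acc x. if truthy acc then Cons_val Nil_val Nil_val else f x) a xs = Nil_val \<longleftrightarrow>
     a = Nil_val \<and> (\<forall>x \<in> set xs. f x = Nil_val)"
  by (induction xs arbitrary: a) auto

lemma sem_tex [simp]:
  "sem (tex l c) env = Nil_val \<longleftrightarrow> \<not> (\<exists>x \<in> set (vlist (sem l env)). truthy (sem c (x # env)))"
  by (simp add: tex_def foldl_exists cong: if_cong)

lemma bnd_tex:
  assumes "bnd Z l env" "len (sem l env) \<le> Z" "\<And>x. x \<in> set (vlist (sem l env)) \<Longrightarrow> bnd Z c (x # env)"
  shows "bnd Z (tex l c) env"
  using assms by (auto simp: tex_def)

lemma sem_tall [simp]:
  "sem (tall l c) env = Nil_val \<longleftrightarrow> \<not> (\<forall>x \<in> set (vlist (sem l env)). truthy (sem c (x # env)))"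
  by (simp add: tall_def)

lemma bnd_tall:
  assumes "bnd Z l env" "len (sem l env) \<le> Z" "\<And>x. x \<in> set (vlist (sem l env)) \<Longrightarrow> bnd Z c (x # env)"
  shows "bnd Z (tall l c) env"
  using assms by (simp add: tall_def bnd_tex)

lemma foldl_filter:
  "vlist (foldl (\<lambda>acc x. if P x then Cons_val x acc else acc) a xs) = rev (filter P xs) @ vlist a"
  by (induction xs arbitrary: a) auto

lemma sem_tfilter [simp]:
  "vlist (sem (tfilter l c) env) = rev (filter (\<lambda>x. truthy (sem c (x # env))) (vlist (sem l env)))"
  using foldl_filter[of "\<lambda>x. truthy (sem c (x # env))" Nil_val] by (simp add: tfilter_def cong: if_cong)

lemma bnd_tfilter:
  assumes "bnd Z l env" "len (sem l env) \<le> Z" "\<And>x. x \<in> set (vlist (sem l env)) \<Longrightarrow> bnd Z c (x # env)"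
  shows "bnd Z (tfilter l c) env"
  using assms by (auto simp: tfilter_def)

lemmas bnd_intros = bnd_tex bnd_tall bnd_tfilter

text \<open>A value stands for the number \<^term>\<open>len v\<close>, so that a number has many representations;
  \<^term>\<open>lens l\<close> is the set of numbers represented by the elements of the list \<^term>\<open>l\<close>.\<close>

definition lens :: "val \<Rightarrow> nat set" where
  "lens l = len ` set (vlist l)"

section \<open>Arithmetic on list lengths, adjacency, and enumeration of words\<close>

lemma foldl_vtl: "vlist (foldl (\<lambda>acc x. vtl acc) a xs) = drop (length xs) (vlist a)"
  by (induction xs arbitrary: a) (auto simp: drop_Suc)

text \<open>Tests whether the truncated difference is zero. The loop runs over the second number,
  which alone determines the cost.\<close>

definition le_t :: tm where "le_t = tnot (TFold (TV 1) (TV 0) (TTl (TV 1)))"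

lemma sem_le_t [simp]: "sem le_t [a, b] = Nil_val \<longleftrightarrow> \<not> len a \<le> len b"
proof -
  have "foldl (\<lambda>acc x. vtl acc) a (vlist b) = Nil_val \<longleftrightarrow> len a \<le> len b"
    using foldl_vtl[of a "vlist b"] by (metis drop_eq_Nil vlist_eq_Nil)
  then show ?thesis by (simp add: le_t_def)
qed

lemma bnd_le_t [simp]: "len b \<le> Z \<Longrightarrow> bnd Z le_t [a, b]"
  by (auto simp: le_t_def)

definition eq_t :: tm where "eq_t = tand (app le_t [TV 0, TV 1]) (app le_t [TV 1, TV 0])"

lemma sem_eq_t [simp]: "sem eq_t [a, b] = Nil_val \<longleftrightarrow> len a \<noteq> len b"
  by (auto simp: eq_t_def)

lemma bnd_eq_t [simp]: "len a \<le> Z \<Longrightarrow> len b \<le> Z \<Longrightarrow> bnd Z eq_t [a, b]"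
  by (auto simp: eq_t_def)

definition bounded_list :: "nat \<Rightarrow> val \<Rightarrow> bool" where
  "bounded_list Z l \<longleftrightarrow> len l \<le> Z \<and> (\<forall>y \<in> set (vlist l). len y \<le> Z)"

definition mem_t :: tm where "mem_t = tex (TV 1) (app eq_t [TV 0, TV 1])"

lemma sem_mem_t [simp]: "sem mem_t [x, l] = Nil_val \<longleftrightarrow> len x \<notin> lens l"
  by (auto simp: mem_t_def lens_def image_iff)

lemma bnd_mem_t [simp]: "len x \<le> Z \<Longrightarrow> bounded_list Z l \<Longrightarrow> bnd Z mem_t [x, l]"
  by (auto simp: mem_t_def bounded_list_def intro!: bnd_intros)

definition vnth :: "val \<Rightarrow> nat \<Rightarrow> val" where
  "vnth l i = (if i < len l then vlist l ! i else Nil_val)"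

definition nth_t :: tm where "nth_t = THd (TFold (TV 1) (TV 0) (TTl (TV 1)))"

lemma vhd_conv: "vhd v = (if vlist v = [] then Nil_val else hd (vlist v))"
  by (cases v) auto

lemma sem_nth_t [simp]: "sem nth_t [l, i] = vnth l (len i)"
  by (auto simp: nth_t_def vhd_conv foldl_vtl vnth_def hd_drop_conv_nth simp del: vlist_eq_Nil)

lemma bnd_nth_t [simp]: "len i \<le> Z \<Longrightarrow> bnd Z nth_t [l, i]"
  by (auto simp: nth_t_def)

text \<open>Reading outside the matrix gives nil, so such pairs are not arcs.\<close>

definition arel :: "val \<Rightarrow> nat rel" where
  "arel A = {(i, j). truthy (vnth (vnth A i) j)}"

definition adj_t :: tm where "adj_t = app nth_t [app nth_t [TV 0, TV 1], TV 2]"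

lemma sem_adj_t [simp]: "sem adj_t [A, u, v] = Nil_val \<longleftrightarrow> (len u, len v) \<notin> arel A"
  by (auto simp: adj_t_def arel_def)

lemma bnd_adj_t [simp]: "len u \<le> Z \<Longrightarrow> len v \<le> Z \<Longrightarrow> bnd Z adj_t [A, u, v]"
  by (auto simp: adj_t_def)

definition append_t :: tm where "append_t = TFold (TV 0) (TV 1) (TC (TV 0) (TV 1))"

lemma sem_append_t [simp]: "vlist (sem append_t [l1, l2]) = rev (vlist l1) @ vlist l2"
  using foldl_filter[of "\<lambda>_. True" l2 "vlist l1"] by (simp add: append_t_def)

lemma bnd_append_t [simp]: "len l1 \<le> Z \<Longrightarrow> bnd Z append_t [l1, l2]"
  by (auto simp: append_t_def)

text \<open>Pairs up two lists. As the lengths multiply, the same term serves as multiplication of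
  numbers.\<close>

definition consall_t :: tm where
  "consall_t = TFold (TV 0) TN (TFold (TV 3) (TV 1) (TC (TC (TV 2) (TV 0)) (TV 1)))"

lemma foldl_Cons_val:
  "vlist (foldl (\<lambda>acc w. Cons_val (f w) acc) a ws) = rev (map f ws) @ vlist a"
  by (induction ws arbitrary: a) auto

lemma foldl_consall:
  "vlist (foldl (\<lambda>acc x. foldl (\<lambda>acc w. Cons_val (Cons_val x w) acc) acc ws) a xs) =
     concat (map (\<lambda>x. rev (map (Cons_val x) ws)) (rev xs)) @ vlist a"
  by (induction xs arbitrary: a) (auto simp: foldl_Cons_val)

lemma vlist_sem_consall_t:
  "vlist (sem consall_t [l, ws]) = concat (map (\<lambda>x. rev (map (Cons_val x) (vlist ws))) (rev (vlist l)))"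
  using foldl_consall[of "vlist ws" Nil_val "vlist l"] by (simp add: consall_t_def)

lemma set_sem_consall_t [simp]:
  "set (vlist (sem consall_t [l, ws])) = {Cons_val x w | x w. x \<in> set (vlist l) \<and> w \<in> set (vlist ws)}"
  by (auto simp: vlist_sem_consall_t)

lemma len_sem_consall_t [simp]: "len (sem consall_t [l, ws]) = len l * len ws"
  by (simp add: vlist_sem_consall_t length_concat comp_def sum_list_triv)

lemma bnd_consall_t [simp]: "len l \<le> Z \<Longrightarrow> len ws \<le> Z \<Longrightarrow> bnd Z consall_t [l, ws]"
  by (auto simp: consall_t_def)

text \<open>\<open>tt\<close> is the list whose only entry is the empty word. Each round puts one
  more letter in front of all words and adds the empty word again, so that the shorter words are
  kept.\<close>

definition words_t :: tm where
  "words_t = TFold (TV 1) tt (TC TN (app consall_t [TV 2, TV 1]))"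

lemma foldl_words:
  "set (vlist (foldl (\<lambda>acc x. Cons_val Nil_val (sem consall_t [l, acc])) (Cons_val Nil_val Nil_val) fs)) =
     {w. set (vlist w) \<subseteq> set (vlist l) \<and> len w \<le> length fs}"
proof (induction fs rule: rev_induct)
  case Nil
  then show ?case by auto
next
  case (snoc f fs)
  show ?case
  proof (rule set_eqI)
    fix w
    show "w \<in> set (vlist (foldl (\<lambda>acc x. Cons_val Nil_val (sem consall_t [l, acc]))
           (Cons_val Nil_val Nil_val) (fs @ [f]))) \<longleftrightarrow>
       w \<in> {w. set (vlist w) \<subseteq> set (vlist l) \<and> len w \<le> length (fs @ [f])}"
      by (cases w) (auto simp: snoc)
  qed
qed

lemma len_foldl_words:
  "len (foldl (\<lambda>acc x. Cons_val Nil_val (sem consall_t [l, acc])) (Cons_val Nil_val Nil_val) fs)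
     \<le> (len l + 1) ^ length fs"
proof (induction fs rule: rev_induct)
  case (snoc f fs)
  let ?w = "foldl (\<lambda>acc x. Cons_val Nil_val (sem consall_t [l, acc])) (Cons_val Nil_val Nil_val) fs"
  have "1 + len l * len ?w \<le> 1 * (len l + 1) ^ length fs + len l * (len l + 1) ^ length fs"
    using snoc by (intro add_mono mult_le_mono2) auto
  then show ?case by simp
qed simp

lemma set_sem_words_t [simp]:
  "set (vlist (sem words_t [l, m])) = {w. set (vlist w) \<subseteq> set (vlist l) \<and> len w \<le> len m}"
  using foldl_words[of l "vlist m"] by (simp add: words_t_def)

lemma len_sem_words_t: "len (sem words_t [l, m]) \<le> (len l + 1) ^ len m"
  using len_foldl_words[of l "vlist m"] by (simp add: words_t_def)

lemma bnd_words_t: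
  assumes "len l \<le> Z" "len m \<le> Z" "(len l + 1) ^ len m \<le> Z"
  shows "bnd Z words_t [l, m]"
proof -
  have "len (foldl (\<lambda>acc x. Cons_val Nil_val (sem consall_t [l, acc])) (Cons_val Nil_val Nil_val) ys) \<le> Z"
    if "vlist m = ys @ x # zs" for ys x zs
  proof -
    have "(len l + 1) ^ length ys \<le> (len l + 1) ^ len m"
      using that by (intro power_increasing) auto
    with len_foldl_words[of l ys] assms(3) show ?thesis by linarith
  qed
  then show ?thesis using assms by (auto simp: words_t_def)
qed

section \<open>Reachability inside a vertex list\<close>

definition restr :: "val \<Rightarrow> val \<Rightarrow> nat rel" where
  "restr A W = arel A \<inter> lens W \<times> lens W"

text \<open>Breadth-first search: every round replaces the accumulator by the sublist of
  \<open>W\<close> formed by the vertices reached so far and their neighbours. The list of pairs is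
  only a counter; its length is at least the number of arcs of \<open>restr A W\<close>, and so many
  steps reach everything reachable.\<close>

definition reach_t :: tm where
  "reach_t = TFold (app consall_t [TV 1, TV 1]) (TC (TV 2) TN)
     (tfilter (TV 3) (tor (app mem_t [TV 0, TV 2]) (tex (TV 2) (app adj_t [TV 4, TV 0, TV 1]))))"

context
  fixes A W x :: val
begin

definition reach_step :: "val \<Rightarrow> val \<Rightarrow> val" where
  "reach_step acc p = sem (tfilter (TV 3) (tor (app mem_t [TV 0, TV 2])
      (tex (TV 2) (app adj_t [TV 4, TV 0, TV 1])))) [p, acc, A, W, x]"

lemma vlist_reach_step:
  "vlist (reach_step acc p) =
     rev (filter (\<lambda>y. len y \<in> lens acc \<or> (\<exists>u \<in> lens acc. (u, len y) \<in> arel A)) (vlist W))"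
  by (simp add: lens_def reach_step_def)

lemma lens_reach_step:
  assumes "lens acc \<subseteq> lens W"
  shows "lens (reach_step acc p) = lens acc \<union> restr A W `` lens acc"
proof -
  have "lens (reach_step acc p) =
      {i \<in> lens W. i \<in> lens acc \<or> (\<exists>u \<in> lens acc. (u, i) \<in> arel A)}"
    unfolding lens_def[of "reach_step acc p"] lens_def[of W] vlist_reach_step set_rev set_filter by blast
  also have "\<dots> = lens acc \<union> restr A W `` lens acc"
    using assms unfolding restr_def by blast
  finally show ?thesis .
qed

lemma lens_reach_iter:
  assumes "len x \<in> lens W"
  shows "lens (foldl reach_step (Cons_val x Nil_val) ps) =
    {y. \<exists>i \<le> length ps. (len x, y) \<in> restr A W ^^ i}"
proof (induction ps rule: rev_induct)
  case Nil
  then show ?case by (auto simp: lens_def)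
next
  case (snoc p ps)
  let ?w = "foldl reach_step (Cons_val x Nil_val) ps"
  have sub: "lens ?w \<subseteq> lens W"
  proof
    fix y assume "y \<in> lens ?w"
    then obtain i where "(len x, y) \<in> restr A W ^^ i" using snoc by blast
    then show "y \<in> lens W" using assms by (cases i) (auto simp: restr_def)
  qed
  have "lens (foldl reach_step (Cons_val x Nil_val) (ps @ [p])) = lens ?w \<union> restr A W `` lens ?w"
    using lens_reach_step[OF sub, of p] by simp
  also have "\<dots> = {y. \<exists>i \<le> Suc (length ps). (len x, y) \<in> restr A W ^^ i}"
  proof (intro set_eqI iffI)
    fix y assume "y \<in> lens ?w \<union> restr A W `` lens ?w"
    then show "y \<in> {y. \<exists>i \<le> Suc (length ps). (len x, y) \<in> restr A W ^^ i}"
    proof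
      assume "y \<in> lens ?w"
      then show ?thesis unfolding snoc using le_SucI by blast
    next
      assume "y \<in> restr A W `` lens ?w"
      then obtain z i where "i \<le> length ps" "(len x, z) \<in> restr A W ^^ i" "(z, y) \<in> restr A W"
        unfolding snoc by blast
      then have "(len x, y) \<in> restr A W ^^ Suc i" by auto
      with \<open>i \<le> length ps\<close> show ?thesis by blast
    qed
  next
    fix y assume "y \<in> {y. \<exists>i \<le> Suc (length ps). (len x, y) \<in> restr A W ^^ i}"
    then obtain i where i: "i \<le> Suc (length ps)" "(len x, y) \<in> restr A W ^^ i" by blast
    show "y \<in> lens ?w \<union> restr A W `` lens ?w"
    proof (cases i)
      case 0
      then show ?thesis using i unfolding snoc by (auto intro!: exI[of _ 0])
    next
      case (Suc j)
      then obtain z where "(len x, z) \<in> restr A W ^^ j" "(z, y) \<in> restr A W" using i by auto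
      then show ?thesis using i Suc unfolding snoc by blast
    qed
  qed
  finally show ?case by simp
qed

text \<open>The list itself is determined, not just its set of numbers. Hence all vertices of a
  component produce the same list and later the same choice in it.\<close>

lemma vlist_sem_reach_t:
  assumes "len x \<in> lens W"
  shows "vlist (sem reach_t [A, W, x]) =
    rev (filter (\<lambda>y. (len x, len y) \<in> (restr A W)\<^sup>*) (vlist W))"
proof -
  let ?ps = "vlist (sem consall_t [W, W])"
  let ?r = "foldl reach_step (Cons_val x Nil_val) ?ps"
  have r: "sem reach_t [A, W, x] = ?r"
    unfolding reach_t_def by (simp add: reach_step_def[abs_def])
  have fin: "finite (lens W)" by (simp add: lens_def)
  have "card (restr A W) \<le> card (lens W \<times> lens W)"
    unfolding restr_def using fin by (intro card_mono) auto
  also have "\<dots> \<le> len W * len W"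
  proof -
    have "card (lens W) \<le> len W"
      unfolding lens_def by (meson card_image_le card_length finite_set le_trans)
    then show ?thesis by (simp add: card_cartesian_product mult_le_mono)
  qed
  finally have card: "card (restr A W) \<le> length ?ps" by simp
  have finr: "finite (restr A W)" using fin unfolding restr_def by blast
  have lens_r: "lens ?r = {y. (len x, y) \<in> (restr A W)\<^sup>*}"
  proof -
    have "(\<exists>i \<le> length ?ps. (len x, y) \<in> restr A W ^^ i) \<longleftrightarrow> (len x, y) \<in> (restr A W)\<^sup>*" for y
    proof
      assume "(len x, y) \<in> (restr A W)\<^sup>*"
      then obtain i where "(len x, y) \<in> restr A W ^^ i" using rtrancl_imp_relpow by blast
      then have "\<exists>i \<le> card (restr A W). (len x, y) \<in> restr A W ^^ i"
        using relpow_finite_bounded[OF finr, of i] by blast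
      then show "\<exists>i \<le> length ?ps. (len x, y) \<in> restr A W ^^ i" using card le_trans by blast
    qed (blast intro: relpow_imp_rtrancl)
    then show ?thesis unfolding lens_reach_iter[OF assms] by blast
  qed
  \<comment> \<open>At least one round takes place, so the result is literally a filtered copy of
    \<open>W\<close>.\<close>
  have "W \<noteq> Nil_val" using assms by (auto simp: lens_def)
  then have "?ps \<noteq> []" by (metis len_sem_consall_t length_0_conv mult_eq_0_iff vlist_eq_Nil)
  then obtain ps p where ps: "?ps = ps @ [p]" by (metis append_butlast_last_id)
  then obtain acc where acc: "?r = reach_step acc p" by simp
  define Q where "Q = (\<lambda>i. i \<in> lens acc \<or> (\<exists>u \<in> lens acc. (u, i) \<in> arel A))"
  have r2: "vlist ?r = rev (filter (\<lambda>y. Q (len y)) (vlist W))"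
    unfolding acc vlist_reach_step Q_def ..
  have "Q (len y) \<longleftrightarrow> (len x, len y) \<in> (restr A W)\<^sup>*" if "y \<in> set (vlist W)" for y
  proof -
    have "Q (len y) \<longleftrightarrow> len y \<in> lens ?r"
      using that unfolding lens_def r2 by auto
    then show ?thesis unfolding lens_r by simp
  qed
  then show ?thesis unfolding r r2 by (auto intro!: filter_cong)
qed

lemma bnd_reach_t:
  assumes "len W * len W \<le> Z" "bounded_list Z W" "len x \<le> Z" "1 \<le> Z"
  shows "bnd Z reach_t [A, W, x]"
proof -
  have acc: "bounded_list Z (foldl reach_step (Cons_val x Nil_val) ps)" for ps
  proof (cases ps rule: rev_cases)
    case Nil
    then show ?thesis using assms by (simp add: bounded_list_def)
  next
    case (snoc qs q)
    then have "\<exists>P. vlist (foldl reach_step (Cons_val x Nil_val) ps) = rev (filter P (vlist W))"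
      by (simp only: foldl_append foldl_Cons foldl_Nil vlist_reach_step) blast
    then show ?thesis using assms(2) by (auto simp: bounded_list_def intro: le_trans[OF length_filter_le])
  qed
  have "bnd Z (tfilter (TV 3) (tor (app mem_t [TV 0, TV 2])
      (tex (TV 2) (app adj_t [TV 4, TV 0, TV 1])))) [p, acc, A, W, x]" if "bounded_list Z acc" for p acc
    using assms(2) that by (auto simp: bounded_list_def intro!: bnd_intros)
  then show ?thesis
    using assms acc[unfolded reach_step_def[abs_def]]
    unfolding reach_t_def by (auto simp: bounded_list_def)
qed

end

section \<open>Splitting and gluing solutions\<close>

lemma sym_rtrancl_Restr: "sym R \<Longrightarrow> (x, y) \<in> (Restr R A)\<^sup>* \<Longrightarrow> (y, x) \<in> (Restr R A)\<^sup>*"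
  by (rule symD[OF sym_rtrancl]) (auto simp: sym_def)

lemma rtrancl_Restr_mono: "A \<subseteq> B \<Longrightarrow> (x, y) \<in> (Restr R A)\<^sup>* \<Longrightarrow> (x, y) \<in> (Restr R B)\<^sup>*"
  by (rule subsetD[OF rtrancl_mono]) auto

text \<open>A spanning tree directed towards \<open>r\<close>: every other \<open>t\<close> is sent
  to a successor at smaller distance from \<open>r\<close>. One arc per vertex makes the list of
  links no longer than \<open>T\<close>.\<close>

lemma parent_function_exists:
  assumes "\<And>t. t \<in> T \<Longrightarrow> (t, r) \<in> Q\<^sup>*" and "Q \<subseteq> T \<times> T"
  shows "\<exists>p. (\<forall>t \<in> T - {r}. (t, p t) \<in> Q) \<and> (\<forall>t \<in> T. (t, r) \<in> {(t, p t) | t. t \<in> T - {r}}\<^sup>*)"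
proof -
  define h where "h t = (LEAST n. (t, r) \<in> Q ^^ n)" for t
  have "\<exists>s. (t, s) \<in> Q \<and> h s < h t" if t: "t \<in> T - {r}" for t
  proof -
    have "\<exists>n. (t, r) \<in> Q ^^ n" using assms(1) t rtrancl_imp_relpow by blast
    then have ht: "(t, r) \<in> Q ^^ h t" unfolding h_def by (rule LeastI_ex)
    with t obtain m where m: "h t = Suc m" by (cases "h t") auto
    then obtain s where s: "(t, s) \<in> Q" "(s, r) \<in> Q ^^ m" using ht relpow_Suc_D2 by metis
    then have "h s \<le> m" unfolding h_def by (intro Least_le)
    with s m show ?thesis by auto
  qed
  then obtain p where p: "\<forall>t \<in> T - {r}. (t, p t) \<in> Q \<and> h (p t) < h t" by metis
  have "(t, r) \<in> {(t, p t) | t. t \<in> T - {r}}\<^sup>*" if "t \<in> T" for t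
    using that
  proof (induction "h t" arbitrary: t rule: less_induct)
    case less
    show ?case
    proof (cases "t = r")
      case False
      then have "h (p t) < h t" "p t \<in> T" "(t, p t) \<in> {(t, p t) | t. t \<in> T - {r}}"
        using p less.prems assms(2) by auto
      then show ?thesis using less.hyps by (meson converse_rtrancl_into_rtrancl)
    qed simp
  qed
  with p show ?thesis by blast
qed

definition covers :: "nat rel \<Rightarrow> nat set \<Rightarrow> nat set \<Rightarrow> bool" where
  "covers R V S \<longleftrightarrow> S \<subseteq> V \<and> (\<forall>u \<in> V. \<forall>v \<in> V. (u, v) \<in> R \<longrightarrow> u \<in> S \<or> v \<in> S)"

text \<open>The empty set counts as connected here, unlike in
  \<open>Digraph_Component.connected\<close>.\<close>

definition conn_in :: "nat rel \<Rightarrow> nat set \<Rightarrow> bool" where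
  "conn_in R S \<longleftrightarrow> (\<forall>x \<in> S. \<forall>y \<in> S. (x, y) \<in> (Restr R S)\<^sup>*)"

text \<open>The local conditions on the part \<open>B\<close> of a solution inside a component \<open>C\<close> of the graph that
  remains after removing \<open>T\<close> (chosen) and \<open>U\<close> (not chosen). A triple \<open>(x, y, c)\<close> in \<open>E\<close>
  is a promise that the component of \<open>c\<close> connects \<open>x\<close> to \<open>y\<close>.\<close>

definition locally_valid ::
  "bool \<Rightarrow> nat rel \<Rightarrow> (nat \<times> nat \<times> nat) set \<Rightarrow> nat set \<Rightarrow> nat set \<Rightarrow> nat set \<Rightarrow> nat set \<Rightarrow> bool" where
  "locally_valid conn R E T U C B \<longleftrightarrow>
     (\<forall>a \<in> C - B. (\<forall>b \<in> C - B. (a, b) \<notin> R) \<and> (\<forall>b \<in> U. (a, b) \<notin> R)) \<and>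
     (conn \<longrightarrow> (\<forall>a \<in> B. \<exists>t \<in> T. (t, a) \<in> (Restr R (B \<union> T))\<^sup>*) \<and>
       (\<forall>(x, y, c) \<in> E. c \<in> C \<longrightarrow> (x, y) \<in> (Restr R (B \<union> T))\<^sup>*))"

lemma locally_validI:
  assumes "\<And>a b. a \<in> C - B \<Longrightarrow> b \<in> (C - B) \<union> U \<Longrightarrow> (a, b) \<notin> R"
    and "\<And>a. conn \<Longrightarrow> a \<in> B \<Longrightarrow> \<exists>t \<in> T. (t, a) \<in> (Restr R (B \<union> T))\<^sup>*"
    and "\<And>x y c. conn \<Longrightarrow> (x, y, c) \<in> E \<Longrightarrow> c \<in> C \<Longrightarrow> (x, y) \<in> (Restr R (B \<union> T))\<^sup>*"
  shows "locally_valid conn R E T U C B"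
  unfolding locally_valid_def using assms by (intro conjI ballI impI) auto

lemma locally_validD:
  assumes "locally_valid conn R E T U C B"
  shows "a \<in> C - B \<Longrightarrow> b \<in> (C - B) \<union> U \<Longrightarrow> (a, b) \<notin> R"
    and "conn \<Longrightarrow> a \<in> B \<Longrightarrow> \<exists>t \<in> T. (t, a) \<in> (Restr R (B \<union> T))\<^sup>*"
    and "conn \<Longrightarrow> (x, y, c) \<in> E \<Longrightarrow> c \<in> C \<Longrightarrow> (x, y) \<in> (Restr R (B \<union> T))\<^sup>*"
  using assms[unfolded locally_valid_def] by (blast, metis, fast)

text \<open>\<open>S\<close> is an unknown solution and \<open>X\<close> the removed set.
  \<open>meets\<close> provides the anchor for connectivity: the parts inside components have to be
  attached to \<open>S \<inter> X\<close>.\<close>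

locale split_solution =
  fixes conn :: bool and R :: "nat rel" and V S X :: "nat set"
  assumes sym_R: "sym R" and finite_V: "finite V" and S_covers: "covers R V S"
    and S_conn: "conn \<Longrightarrow> conn_in R S" and X_V: "X \<subseteq> V" and meets: "conn \<Longrightarrow> S \<inter> X \<noteq> {}"
begin

abbreviation "T \<equiv> S \<inter> X"
abbreviation "U \<equiv> X - S"
abbreviation "W \<equiv> V - X"

definition C :: "nat \<Rightarrow> nat set" where
  "C x = {y. (x, y) \<in> (Restr R W)\<^sup>*}"

lemma S_V: "S \<subseteq> V"
  using S_covers by (simp add: covers_def)

lemma C_self: "x \<in> C x"
  by (simp add: C_def)

lemma C_W: "x \<in> W \<Longrightarrow> C x \<subseteq> W"
proof
  fix y assume "x \<in> W" "y \<in> C x"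
  then have "(x, y) \<in> (Restr R W)\<^sup>*" by (simp add: C_def)
  then show "y \<in> W" using \<open>x \<in> W\<close> by (induction rule: rtrancl_induct) auto
qed

lemma C_eq: "y \<in> C x \<Longrightarrow> C y = C x"
  unfolding C_def using sym_rtrancl_Restr[OF sym_R] by (auto intro: rtrancl_trans)

lemma C_step: "x \<in> W \<Longrightarrow> y \<in> W \<Longrightarrow> (x, y) \<in> R \<Longrightarrow> y \<in> C x"
  unfolding C_def by blast

lemma finite_C: "x \<in> W \<Longrightarrow> finite (C x)"
  using C_W finite_V by (meson finite_Diff finite_subset)

text \<open>One step between vertices of \<open>T\<close>, realized by \<open>S\<close>: trivial, by
  an edge, or through the component of \<open>c\<close>. In the first two cases \<open>c\<close> is
  a dummy, still taken from \<open>V\<close> so that every link is a triple of vertices.\<close>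

definition linked :: "nat \<Rightarrow> nat \<Rightarrow> nat \<Rightarrow> bool" where
  "linked x y c \<longleftrightarrow> x \<in> T \<and> y \<in> T \<and> c \<in> V \<and> (x = y \<or> (x, y) \<in> R \<or>
     c \<in> W \<and> (x, y) \<in> (Restr R ((S \<inter> C c) \<union> T))\<^sup>*)"

text \<open>Walking along a path inside \<open>S\<close> from \<open>x\<close>, the last vertex of \<open>T\<close> that was passed is linked
  to \<open>x\<close>, and everything after it stays in one component.\<close>

lemma linked_along_path:
  assumes "x \<in> T" "(x, z) \<in> (Restr R S)\<^sup>*"
  shows "\<exists>y \<in> T. (x, y) \<in> {(x, y). \<exists>c. linked x y c}\<^sup>* \<and>
    (z = y \<or> z \<in> W \<and> (y, z) \<in> (Restr R ((S \<inter> C z) \<union> T))\<^sup>*)"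
  using assms(2)
proof (induction rule: rtrancl_induct)
  case base
  then show ?case using assms(1) by blast
next
  case (step z w)
  let ?Q = "{(x, y). \<exists>c. linked x y c}"
  from step.IH obtain y where y: "y \<in> T" "(x, y) \<in> ?Q\<^sup>*"
    "z = y \<or> z \<in> W \<and> (y, z) \<in> (Restr R ((S \<inter> C z) \<union> T))\<^sup>*" by blast
  have zw: "(z, w) \<in> R" "z \<in> S" "w \<in> S" using step.hyps by auto
  from y(3) show ?case
  proof
    assume [simp]: "z = y"
    show ?case
    proof (cases "w \<in> X")
      case True
      then have "(y, w) \<in> ?Q" using y(1) zw S_V by (auto simp: linked_def)
      with y(2) have "(x, w) \<in> ?Q\<^sup>*" by (rule rtrancl_into_rtrancl)
      with True zw show ?thesis by blast
    next
      case False
      then have "w \<in> W" "(y, w) \<in> Restr R ((S \<inter> C w) \<union> T)" using zw y(1) S_V C_self by auto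
      with y show ?thesis by blast
    qed
  next
    assume z: "z \<in> W \<and> (y, z) \<in> (Restr R ((S \<inter> C z) \<union> T))\<^sup>*"
    show ?case
    proof (cases "w \<in> X")
      case True
      then have "(z, w) \<in> Restr R ((S \<inter> C z) \<union> T)" using zw C_self by auto
      with z have "(y, w) \<in> (Restr R ((S \<inter> C z) \<union> T))\<^sup>*" by (meson rtrancl_into_rtrancl)
      then have "(y, w) \<in> ?Q" using True y(1) zw z by (auto simp: linked_def)
      with y(2) have "(x, w) \<in> ?Q\<^sup>*" by (rule rtrancl_into_rtrancl)
      with True zw show ?thesis by blast
    next
      case False
      then have w: "w \<in> W" using zw S_V by auto
      then have "w \<in> C z" using C_step z zw by blast
      then have "(z, w) \<in> Restr R ((S \<inter> C z) \<union> T)" using zw C_self by auto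
      with z have "(y, w) \<in> (Restr R ((S \<inter> C z) \<union> T))\<^sup>*" by (meson rtrancl_into_rtrancl)
      with C_eq[OF \<open>w \<in> C z\<close>] w y show ?thesis by auto
    qed
  qed
qed

definition good_links :: "(nat \<times> nat \<times> nat) set \<Rightarrow> bool" where
  "good_links E \<longleftrightarrow> (\<forall>(x, y, c) \<in> E. linked x y c) \<and>
     (\<exists>r \<in> T. \<forall>t \<in> T. (t, r) \<in> {(x, y). \<exists>c. (x, y, c) \<in> E}\<^sup>*)"

lemma good_links_exist:
  assumes conn
  shows "\<exists>g. good_links ((\<lambda>t. (t, g t)) ` T)"
proof -
  let ?Q = "{(x, y). \<exists>c. linked x y c}"
  obtain r where r: "r \<in> T" using meets assms by blast
  have rt: "(t, r) \<in> ?Q\<^sup>*" if t: "t \<in> T" for t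
  proof -
    have "(t, r) \<in> (Restr R S)\<^sup>*" using S_conn[OF assms] t r by (auto simp: conn_in_def)
    then obtain y where "y \<in> T" "(t, y) \<in> ?Q\<^sup>*" "r = y \<or> r \<in> W"
      using linked_along_path[OF t] by blast
    with r show ?thesis by blast
  qed
  have "?Q \<subseteq> T \<times> T" by (auto simp: linked_def)
  from parent_function_exists[OF rt this]
  obtain p where p: "\<forall>t \<in> T - {r}. (t, p t) \<in> ?Q"
    "\<forall>t \<in> T. (t, r) \<in> {(t, p t) | t. t \<in> T - {r}}\<^sup>*" by blast
  then have "\<forall>t \<in> T - {r}. \<exists>c. linked t (p t) c" by blast
  then obtain c where c: "\<forall>t \<in> T - {r}. linked t (p t) (c t)" by metis
  \<comment> \<open>The root gets a trivial link to itself, so that the first entries of the links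
    are exactly \<open>T\<close> and guessing the links also guesses \<open>T\<close>.\<close>
  define g where "g t = (if t = r then (r, r) else (p t, c t))" for t
  have "linked t (fst (g t)) (snd (g t))" if "t \<in> T" for t
    using c that r S_V by (auto simp: g_def linked_def)
  moreover have "{(t, p t) | t. t \<in> T - {r}} \<subseteq> {(x, y). \<exists>c. (x, y, c) \<in> (\<lambda>t. (t, g t)) ` T}"
    by (auto simp: g_def image_iff)
  then have "\<forall>t \<in> T. (t, r) \<in> {(x, y). \<exists>c. (x, y, c) \<in> (\<lambda>t. (t, g t)) ` T}\<^sup>*"
    using p(2) rtrancl_mono by blast
  ultimately show ?thesis unfolding good_links_def using r by fastforce
qed

text \<open>A path of \<open>S\<close> from \<open>T\<close> to \<open>a\<close> has a last vertex
  in \<open>T\<close>, after which it stays in the component of \<open>a\<close>; this attaches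
  \<open>a\<close>. The promises hold because each link is realized by \<open>S\<close>
  itself.\<close>

lemma solution_locally_valid:
  assumes x: "x \<in> W" and E: "conn \<Longrightarrow> good_links E"
  shows "locally_valid conn R E T U (C x) (S \<inter> C x)"
proof (rule locally_validI)
  fix a b assume "a \<in> C x - S \<inter> C x" "b \<in> (C x - S \<inter> C x) \<union> U"
  then have "a \<in> V - S" "b \<in> V - S" using C_W[OF x] X_V by auto
  then show "(a, b) \<notin> R" using S_covers unfolding covers_def by auto
next
  fix a assume cn: conn and a: "a \<in> S \<inter> C x"
  obtain t where t: "t \<in> T" using meets[OF cn] by auto
  have "(t, a) \<in> (Restr R S)\<^sup>*" using S_conn[OF cn] a t by (auto simp: conn_in_def)
  from linked_along_path[OF t this] obtain y where
    y: "y \<in> T" "a = y \<or> a \<in> W \<and> (y, a) \<in> (Restr R ((S \<inter> C a) \<union> T))\<^sup>*" by auto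
  have "a \<notin> T" using a C_W[OF x] by auto
  with y have "(y, a) \<in> (Restr R ((S \<inter> C a) \<union> T))\<^sup>*" by auto
  moreover have "C a = C x" using C_eq a by auto
  ultimately show "\<exists>t \<in> T. (t, a) \<in> (Restr R ((S \<inter> C x) \<union> T))\<^sup>*" using y(1) by metis
next
  fix y z c assume "conn" "(y, z, c) \<in> E" "c \<in> C x"
  then have l: "linked y z c" using E unfolding good_links_def by auto
  moreover have "C c = C x" using C_eq \<open>c \<in> C x\<close> by auto
  ultimately consider "y = z" | "y \<in> T" "z \<in> T" "(y, z) \<in> R" | "(y, z) \<in> (Restr R ((S \<inter> C x) \<union> T))\<^sup>*"
    unfolding linked_def by auto
  then show "(y, z) \<in> (Restr R ((S \<inter> C x) \<union> T))\<^sup>*" by cases (auto intro: r_into_rtrancl)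
qed

text \<open>The exchange argument. The links connect \<open>T\<close>, all other chosen vertices are
  attached to \<open>T\<close>, and edges leaving \<open>W\<close> stay covered because
  \<open>T\<close> and \<open>U\<close> are unchanged. \<open>b_eq\<close> says that
  \<open>b\<close> depends on the component only, which makes \<open>S'\<close> the union of
  \<open>T\<close> and all parts.\<close>

theorem glue:
  assumes E: "conn \<Longrightarrow> good_links E"
    and b: "\<And>x. x \<in> W \<Longrightarrow> b x \<subseteq> C x \<and> locally_valid conn R E T U (C x) (b x) \<and> card (b x) \<le> card (S \<inter> C x)"
    and b_eq: "\<And>x y. x \<in> W \<Longrightarrow> y \<in> C x \<Longrightarrow> b y = b x"
  defines "S' \<equiv> T \<union> {x \<in> W. x \<in> b x}"
  shows "covers R V S'" "conn \<Longrightarrow> conn_in R S'" "card S' \<le> card S"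
proof -
  have valid: "locally_valid conn R E T U (C x) (b x)" if "x \<in> W" for x using b[OF that] by blast
  have b_S': "b x \<subseteq> S'" if "x \<in> W" for x
  proof
    fix y assume "y \<in> b x"
    then have "y \<in> C x" using b that by blast
    with b_eq that \<open>y \<in> b x\<close> C_W[OF that] show "y \<in> S'" unfolding S'_def by auto
  qed
  show "covers R V S'" unfolding covers_def
  proof (intro conjI ballI impI)
    show "S' \<subseteq> V" unfolding S'_def using S_V by auto
    \<comment> \<open>By symmetry, edges meeting \<open>W\<close> may be taken to start there; the
      edges inside \<open>X\<close> are covered by \<open>T\<close>.\<close>
    have wlog: "u \<in> S' \<or> v \<in> S'" if "u \<in> V" "v \<in> V" "(u, v) \<in> R" "u \<in> W" for u v
    proof (rule ccontr)
      assume neg: "\<not> (u \<in> S' \<or> v \<in> S')"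
      then have u: "u \<in> C u - b u" using that C_self unfolding S'_def by auto
      show False
      proof (cases "v \<in> X")
        case True
        then have "v \<in> U" using neg unfolding S'_def by auto
        with locally_validD(1)[OF valid[OF \<open>u \<in> W\<close>] u, of v] that show False by simp
      next
        case False
        then have "v \<in> C u" using C_step that by blast
        moreover have "v \<notin> b u" using b_S'[OF \<open>u \<in> W\<close>] neg by blast
        ultimately show False using locally_validD(1)[OF valid[OF \<open>u \<in> W\<close>] u, of v] that by simp
      qed
    qed
    fix u v assume uv: "u \<in> V" "v \<in> V" "(u, v) \<in> R"
    show "u \<in> S' \<or> v \<in> S'"
    proof (cases "u \<in> W \<or> v \<in> W")
      case True
      then show ?thesis using wlog uv symD[OF sym_R] by blast
    next
      case False
      then have "u \<in> T \<or> v \<in> T" using S_covers uv unfolding covers_def by blast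
      then show ?thesis unfolding S'_def by blast
    qed
  qed
  show "conn_in R S'" if cn: conn
  proof -
    obtain r where r: "r \<in> T" "\<forall>t \<in> T. (t, r) \<in> {(x, y). \<exists>c. (x, y, c) \<in> E}\<^sup>*"
      using E[OF cn] unfolding good_links_def by blast
    have sub: "b x \<union> T \<subseteq> S'" if "x \<in> W" for x using b_S'[OF that] unfolding S'_def by blast
    have link: "(x, y) \<in> (Restr R S')\<^sup>*" if xyc: "(x, y, c) \<in> E" for x y c
    proof -
      have l: "linked x y c" using E[OF cn] xyc unfolding good_links_def by blast
      then consider "x = y" | "x \<in> T" "y \<in> T" "(x, y) \<in> R" | "c \<in> W" unfolding linked_def by blast
      then show ?thesis
      proof cases
        case 2
        then show ?thesis unfolding S'_def by blast
      next
        case 3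
        have "(x, y) \<in> (Restr R (b c \<union> T))\<^sup>*"
          by (rule locally_validD(3)[OF valid[OF 3] cn xyc C_self])
        then show ?thesis using sub[OF 3] by (rule rtrancl_Restr_mono[rotated])
      qed simp
    qed
    have T_r: "(t, r) \<in> (Restr R S')\<^sup>*" if "t \<in> T" for t
    proof -
      have "{(x, y). \<exists>c. (x, y, c) \<in> E} \<subseteq> (Restr R S')\<^sup>*" using link by blast
      then have "{(x, y). \<exists>c. (x, y, c) \<in> E}\<^sup>* \<subseteq> (Restr R S')\<^sup>*" by (rule rtrancl_subset_rtrancl)
      then show ?thesis using r(2) that by blast
    qed
    have S'_r: "(s, r) \<in> (Restr R S')\<^sup>*" if "s \<in> S'" for s
    proof (cases "s \<in> T")
      case False
      then have s: "s \<in> W" "s \<in> b s" using that unfolding S'_def by auto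
      then obtain t where t: "t \<in> T" "(t, s) \<in> (Restr R (b s \<union> T))\<^sup>*"
        using locally_validD(2)[OF valid[OF s(1)] cn s(2)] by blast
      then have "(t, s) \<in> (Restr R S')\<^sup>*" using sub[OF s(1)] by (metis rtrancl_Restr_mono)
      then have "(s, t) \<in> (Restr R S')\<^sup>*" by (rule sym_rtrancl_Restr[OF sym_R])
      then show ?thesis using T_r[OF t(1)] by (rule rtrancl_trans)
    qed (rule T_r)
    show ?thesis unfolding conn_in_def
      by (intro ballI rtrancl_trans[OF S'_r sym_rtrancl_Restr[OF sym_R S'_r]])
  qed
  show "card S' \<le> card S"
  proof -
    have fin: "finite T" "finite W" using finite_V S_V finite_subset[of X V] X_V by auto
    have disj: "disjoint (C ` W)" unfolding disjoint_def
    proof (intro ballI impI)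
      fix A B assume "A \<in> C ` W" "B \<in> C ` W" "A \<noteq> B"
      then show "A \<inter> B = {}" using C_eq by (metis disjoint_iff imageE)
    qed
    \<comment> \<open>The components partition \<open>W\<close>, so sizes add up and can be compared
      in each component separately.\<close>
    have split: "card (T \<union> {x \<in> W. x \<in> D}) = card T + (\<Sum>A \<in> C ` W. card (D \<inter> A))" for D
    proof -
      have "{x \<in> W. x \<in> D} = (\<Union>A \<in> C ` W. D \<inter> A)" using C_self C_W by blast
      moreover have "card (\<Union>A \<in> C ` W. D \<inter> A) = (\<Sum>A \<in> C ` W. card (D \<inter> A))"
        using fin finite_C disj unfolding disjoint_def by (intro card_UN_disjoint) blast+
      moreover have "card (T \<union> {x \<in> W. x \<in> D}) = card T + card {x \<in> W. x \<in> D}"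
        using fin finite_V by (intro card_Un_disjoint) auto
      ultimately show ?thesis by simp
    qed
    define D where "D = {x \<in> W. x \<in> b x}"
    have "S' = T \<union> {x \<in> W. x \<in> D}" unfolding S'_def D_def by blast
    then have "card S' = card T + (\<Sum>A \<in> C ` W. card (D \<inter> A))" using split by simp
    also have "\<dots> \<le> card T + (\<Sum>A \<in> C ` W. card (S \<inter> A))"
    proof (intro add_left_mono sum_mono)
      fix A assume "A \<in> C ` W"
      then obtain x where x: "x \<in> W" "A = C x" by blast
      have "D \<inter> A \<subseteq> b x" unfolding D_def x(2) using b_eq[OF x(1)] by blast
      moreover have "finite (b x)" using b[OF x(1)] finite_C[OF x(1)] finite_subset by blast
      ultimately have "card (D \<inter> A) \<le> card (b x)" by (simp add: card_mono)
      then show "card (D \<inter> A) \<le> card (S \<inter> A)" using b[OF x(1)] x(2) by auto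
    qed
    also have "\<dots> = card (T \<union> {x \<in> W. x \<in> S})" using split[of S] by simp
    also have "T \<union> {x \<in> W. x \<in> S} = S" using S_V by blast
    finally show ?thesis .
  qed
qed

end

section \<open>The guessing algorithm\<close>

lemma lens_append_t [simp]: "lens (sem append_t [a, b]) = lens a \<union> lens b"
  by (auto simp: lens_def)

lemma len_in_lens_reach_t:
  assumes "len x \<in> lens W"
  shows "y \<in> lens (sem reach_t [A, W, x]) \<longleftrightarrow> (len x, y) \<in> (Restr (arel A) (lens W))\<^sup>*"
proof -
  have "y \<in> lens W" if "(len x, y) \<in> (Restr (arel A) (lens W))\<^sup>*"
    using that assms by (induction rule: rtrancl_induct) auto
  then show ?thesis
    using vlist_sem_reach_t[OF assms, of A] unfolding lens_def restr_def by auto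
qed

text \<open>The inclusion of sets leaves room for repetitions, hence the separate bound on the
  length.\<close>

definition vsub :: "val \<Rightarrow> val \<Rightarrow> bool" where
  "vsub V l \<longleftrightarrow> set (vlist l) \<subseteq> set (vlist V) \<and> len l \<le> len V"

text \<open>The local test runs \<open>reach_t\<close> on two lists appended to each other, of
  length up to \<open>2 * len V\<close>, and \<open>reach_t\<close> loops over all pairs; hence the
  factors 2.\<close>

definition fits :: "nat \<Rightarrow> val \<Rightarrow> bool" where
  "fits Z V \<longleftrightarrow> (2 * len V) * (2 * len V) \<le> Z \<and> (\<forall>y \<in> set (vlist V). len y \<le> Z) \<and> 1 \<le> Z"

lemma fits_len: "fits Z V \<Longrightarrow> 2 * len V \<le> Z"
  unfolding fits_def by (metis le_square le_trans)

lemma vsub_bounded: "fits Z V \<Longrightarrow> vsub V l \<Longrightarrow> bounded_list Z l"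
  using fits_len[of Z V] unfolding vsub_def bounded_list_def fits_def by auto

lemma vsub_mem: "fits Z V \<Longrightarrow> vsub V l \<Longrightarrow> x \<in> set (vlist l) \<Longrightarrow> len x \<le> Z"
  using vsub_bounded bounded_list_def by blast

lemma vsub_len: "fits Z V \<Longrightarrow> vsub V l \<Longrightarrow> len l \<le> Z"
  using vsub_bounded bounded_list_def by blast

lemma vsub_filter: "vsub V l \<Longrightarrow> vlist l' = rev (filter P (vlist l)) \<Longrightarrow> vsub V l'"
  unfolding vsub_def by (auto intro: le_trans[OF length_filter_le])

lemma vsub_refl [simp]: "vsub V V"
  by (simp add: vsub_def)

lemma bnd_reach_vsub:
  assumes "fits Z V" "vsub V W" "len x \<le> Z"
  shows "bnd Z reach_t [A, W, x]"
proof (rule bnd_reach_t)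
  have "len W * len W \<le> (2 * len V) * (2 * len V)"
    using assms(2) by (intro mult_le_mono) (auto simp: vsub_def)
  then show "len W * len W \<le> Z" using assms(1) unfolding fits_def by linarith
qed (use assms vsub_bounded in \<open>auto simp: fits_def\<close>)

lemma bnd_reach_append:
  assumes "fits Z V" "vsub V B" "vsub V T" "len x \<le> Z"
  shows "bnd Z reach_t [A, sem append_t [B, T], x]"
proof (rule bnd_reach_t)
  let ?W = "sem append_t [B, T]"
  have l: "len ?W \<le> 2 * len V" using assms(2,3) by (auto simp: vsub_def)
  then have "len ?W * len ?W \<le> (2 * len V) * (2 * len V)" by (intro mult_le_mono)
  then show "len ?W * len ?W \<le> Z" using assms(1) unfolding fits_def by linarith
  show "bounded_list Z ?W" using fits_len[OF assms(1)] l vsub_mem[OF assms(1)] assms(2,3)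
    by (auto simp: bounded_list_def)
qed (use assms in \<open>auto simp: fits_def\<close>)

lemma bounded_reach_append:
  assumes "fits Z V" "vsub V B" "vsub V T" "len x \<in> lens (sem append_t [B, T])"
  shows "bounded_list Z (sem reach_t [A, sem append_t [B, T], x])"
proof -
  let ?W = "sem append_t [B, T]"
  have l: "len ?W \<le> 2 * len V" using assms(2,3) by (auto simp: vsub_def)
  have "len (sem reach_t [A, ?W, x]) \<le> len ?W"
    unfolding vlist_sem_reach_t[OF assms(4)] length_rev by (rule length_filter_le)
  with l fits_len[OF assms(1)] have "len (sem reach_t [A, ?W, x]) \<le> Z" by linarith
  moreover have "\<forall>y \<in> set (vlist (sem reach_t [A, ?W, x])). len y \<le> Z"
    unfolding vlist_sem_reach_t[OF assms(4)] using vsub_mem[OF assms(1)] assms(2,3) by auto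
  ultimately show ?thesis by (simp add: bounded_list_def)
qed

lemma vsub_reach:
  "vsub V W \<Longrightarrow> len x \<in> lens W \<Longrightarrow> vsub V (sem reach_t [A, W, x])"
  using vsub_filter vlist_sem_reach_t by blast

section \<open>Testing the local conditions\<close>

definition triple :: "val \<Rightarrow> nat \<times> nat \<times> nat" where
  "triple e = (len (vhd e), len (vhd (vtl e)), len (vhd (vtl (vtl e))))"

text \<open>The environment is \<open>[A, E, T, U, C, B]\<close>, shifted by one under each
  quantifier. This term and the next two are the three conditions of
  \<open>locally_valid\<close>.\<close>

definition valid_cover_t :: tm where
  "valid_cover_t = tall (TV 4) (tor (app mem_t [TV 0, TV 6])
     (tand (tall (TV 5) (tor (app mem_t [TV 0, TV 7]) (tnot (app adj_t [TV 2, TV 1, TV 0]))))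
       (tall (TV 4) (tnot (app adj_t [TV 2, TV 1, TV 0])))))"

definition valid_attached_t :: tm where
  "valid_attached_t = tall (TV 5) (tex (TV 3)
     (app mem_t [TV 1, app reach_t [TV 2, app append_t [TV 7, TV 4], TV 0]]))"

definition valid_links_t :: tm where
  "valid_links_t = tall (TV 1) (tor (tnot (app mem_t [THd (TTl (TTl (TV 0))), TV 5]))
     (app mem_t [THd (TTl (TV 0)), app reach_t [TV 1, app append_t [TV 6, TV 3], THd (TV 0)]]))"

definition valid_t :: "bool \<Rightarrow> tm" where
  "valid_t conn = (if conn then tand valid_cover_t (tand valid_attached_t valid_links_t) else valid_cover_t)"

lemma ball_lens: "(\<forall>x \<in> lens l. P x) \<longleftrightarrow> (\<forall>x \<in> set (vlist l). P (len x))"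
  by (simp add: lens_def)

lemma bex_lens: "(\<exists>x \<in> lens l. P x) \<longleftrightarrow> (\<exists>x \<in> set (vlist l). P (len x))"
  by (simp add: lens_def)

lemma len_in_lens: "x \<in> set (vlist l) \<Longrightarrow> len x \<in> lens l"
  by (simp add: lens_def)

text \<open>\<open>reach_t\<close> is specified for start vertices in its vertex list; the
  assumption puts the first ends of all links there.\<close>

lemma sem_valid_t:
  assumes "fst ` triple ` set (vlist E) \<subseteq> lens T"
  shows "truthy (sem (valid_t conn) [A, E, T, U, C, B]) \<longleftrightarrow>
    locally_valid conn (arel A) (triple ` set (vlist E)) (lens T) (lens U) (lens C) (lens B)"
proof -
  have 1: "truthy (sem valid_cover_t [A, E, T, U, C, B]) \<longleftrightarrow>
     (\<forall>a \<in> lens C - lens B. (\<forall>b \<in> lens C - lens B. (a, b) \<notin> arel A) \<and> (\<forall>b \<in> lens U. (a, b) \<notin> arel A))"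
    unfolding valid_cover_t_def by (auto simp: ball_lens Diff_iff) (auto simp: lens_def)
  have 2: "truthy (sem valid_attached_t [A, E, T, U, C, B]) \<longleftrightarrow>
     (\<forall>a \<in> lens B. \<exists>t \<in> lens T. (t, a) \<in> (Restr (arel A) (lens B \<union> lens T))\<^sup>*)"
    unfolding valid_attached_t_def
    by (simp add: ball_lens bex_lens len_in_lens_reach_t len_in_lens cong: bex_cong)
  have 3: "truthy (sem valid_links_t [A, E, T, U, C, B]) \<longleftrightarrow>
     (\<forall>(x, y, c) \<in> triple ` set (vlist E). c \<in> lens C \<longrightarrow> (x, y) \<in> (Restr (arel A) (lens B \<union> lens T))\<^sup>*)"
  proof -
    have "len (vhd e) \<in> lens T" if "e \<in> set (vlist E)" for e
      using assms that by (auto simp: triple_def image_subset_iff)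
    then show ?thesis
      unfolding valid_links_t_def
      by (simp add: len_in_lens_reach_t triple_def cong: ball_cong)
  qed
  show ?thesis
  proof (cases conn)
    case True
    then show ?thesis
      using 1 2 3 unfolding valid_t_def locally_valid_def by simp
  next
    case False
    then show ?thesis using 1 unfolding valid_t_def locally_valid_def by simp
  qed
qed

lemma bnd_valid_t:
  assumes Z: "fits Z V" and sub: "vsub V T" "vsub V C" "vsub V B" and U: "bounded_list Z U"
    and E: "len E \<le> Z" "fst ` triple ` set (vlist E) \<subseteq> lens T"
      "\<And>e. e \<in> set (vlist E) \<Longrightarrow> triple e \<in> {..Z} \<times> {..Z} \<times> {..Z}"
  shows "bnd Z (valid_t conn) [A, E, T, U, C, B]"
proof -
  note mem = vsub_mem[OF Z sub(1)] vsub_mem[OF Z sub(2)] vsub_mem[OF Z sub(3)]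
  note ln = vsub_len[OF Z sub(1)] vsub_len[OF Z sub(2)] vsub_len[OF Z sub(3)]
  note bl = vsub_bounded[OF Z sub(1)] vsub_bounded[OF Z sub(2)] vsub_bounded[OF Z sub(3)]
  have U': "len U \<le> Z" "x \<in> set (vlist U) \<Longrightarrow> len x \<le> Z" for x
    using U by (auto simp: bounded_list_def)
  have 1: "bnd Z valid_cover_t [A, E, T, U, C, B]"
    unfolding valid_cover_t_def using mem ln bl U' by (auto intro!: bnd_intros)
  have 2: "bnd Z valid_attached_t [A, E, T, U, C, B]"
    unfolding valid_attached_t_def
    using mem ln bl bnd_reach_append[OF Z sub(3,1)] bounded_reach_append[OF Z sub(3,1)]
    by (auto intro!: bnd_intros simp: len_in_lens)
  have 3: "bnd Z valid_links_t [A, E, T, U, C, B]"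
  proof -
    have "len (vhd e) \<in> lens T" "len (vhd e) \<le> Z" "len (vhd (vtl e)) \<le> Z" "len (vhd (vtl (vtl e))) \<le> Z"
      if "e \<in> set (vlist E)" for e
      using E(2) E(3)[OF that] that by (auto simp: triple_def image_subset_iff)
    then show ?thesis
      unfolding valid_links_t_def
      using mem ln bl E(1) bnd_reach_append[OF Z sub(3,1)] bounded_reach_append[OF Z sub(3,1)]
      by (auto intro!: bnd_intros)
  qed
  show ?thesis using 1 2 3 by (simp add: valid_t_def)
qed

section \<open>Exhaustive search inside one component\<close>

definition diff_t :: tm where
  "diff_t = tfilter (TV 0) (tnot (app mem_t [TV 0, TV 2]))"

lemma vlist_sem_diff_t: "vlist (sem diff_t [C, u]) = rev (filter (\<lambda>x. len x \<notin> lens u) (vlist C))"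
  by (simp add: diff_t_def)

lemma lens_sem_diff_t: "lens (sem diff_t [C, u]) = lens C - lens u"
  unfolding lens_def[of "sem diff_t [C, u]"] vlist_sem_diff_t by (auto simp: lens_def)

definition step_t :: "bool \<Rightarrow> tm" where
  "step_t conn = TIf (tand (app le_t [TV 6, TV 5])
     (app (valid_t conn) [TV 0, TV 1, TV 2, TV 3, TV 4, TV 6])) (TV 6) (TV 5)"

text \<open>The words range over complements: what the solution omits from a component is
  independent and therefore short, while its part of the component may be large. \<open>C\<close> is
  the default if no word is valid.\<close>

definition best_t :: "bool \<Rightarrow> tm" where
  "best_t conn = TFold (app words_t [TV 4, TV 5]) (TV 4)
     (app (step_t conn) [TV 2, TV 3, TV 4, TV 5, TV 6, TV 1, app diff_t [TV 6, TV 0]])"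

text \<open>The comparison is non-strict so that a valid candidate as long as the possibly invalid
  start value \<open>c\<close> displaces it.\<close>

lemma foldl_best:
  fixes f :: "'a \<Rightarrow> val" and Q :: "val \<Rightarrow> bool" and c :: val
  defines "r us \<equiv> foldl (\<lambda>acc u. if len (f u) \<le> len acc \<and> Q (f u) then f u else acc) c us"
  shows "(r us = c \<or> (\<exists>u \<in> set us. r us = f u \<and> Q (f u))) \<and> len (r us) \<le> len c \<and>
    (\<forall>u \<in> set us. Q (f u) \<longrightarrow> len (r us) \<le> len (f u)) \<and>
    ((\<exists>u \<in> set us. Q (f u) \<and> len (f u) \<le> len c) \<longrightarrow> Q (r us))"
proof (induction us rule: rev_induct)
  case Nil
  then show ?case by (simp add: r_def)
next
  case (snoc u us)
  have "r (us @ [u]) = (if len (f u) \<le> len (r us) \<and> Q (f u) then f u else r us)"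
    by (simp add: r_def)
  then show ?case using snoc by auto
qed

context
  fixes conn :: bool and A E T U C M :: val
begin

lemma sem_best_t:
  "sem (best_t conn) [A, E, T, U, C, M] = foldl (\<lambda>acc u.
     if len (sem diff_t [C, u]) \<le> len acc \<and> truthy (sem (valid_t conn) [A, E, T, U, C, sem diff_t [C, u]])
     then sem diff_t [C, u] else acc) C (vlist (sem words_t [C, M]))"
  unfolding best_t_def step_t_def by (simp cong: if_cong)

lemma best_t_cases:
  "sem (best_t conn) [A, E, T, U, C, M] = C \<or> (\<exists>u. sem (best_t conn) [A, E, T, U, C, M] = sem diff_t [C, u])"
  using foldl_best[of "\<lambda>u. sem diff_t [C, u]" "\<lambda>B. truthy (sem (valid_t conn) [A, E, T, U, C, B])" C
      "vlist (sem words_t [C, M])"]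
  unfolding sem_best_t by auto

lemma best_t_optimal:
  assumes "set (vlist u) \<subseteq> set (vlist C)" "len u \<le> len M"
    and "truthy (sem (valid_t conn) [A, E, T, U, C, sem diff_t [C, u]])"
  shows "truthy (sem (valid_t conn) [A, E, T, U, C, sem (best_t conn) [A, E, T, U, C, M]])"
    and "len (sem (best_t conn) [A, E, T, U, C, M]) \<le> len (sem diff_t [C, u])"
proof -
  have "len (sem diff_t [C, u]) \<le> len C" by (simp add: vlist_sem_diff_t)
  then show "truthy (sem (valid_t conn) [A, E, T, U, C, sem (best_t conn) [A, E, T, U, C, M]])"
    "len (sem (best_t conn) [A, E, T, U, C, M]) \<le> len (sem diff_t [C, u])"
    using foldl_best[of "\<lambda>u. sem diff_t [C, u]" "\<lambda>B. truthy (sem (valid_t conn) [A, E, T, U, C, B])" C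
      "vlist (sem words_t [C, M])"] assms
    unfolding sem_best_t by auto
qed

lemma vsub_best_t: "vsub V C \<Longrightarrow> vsub V (sem (best_t conn) [A, E, T, U, C, M])"
  using best_t_cases vsub_filter[OF _ vlist_sem_diff_t] by metis

lemma bnd_best_t:
  assumes Z: "fits Z V" and sub: "vsub V T" "vsub V C" and U: "bounded_list Z U"
    and E: "len E \<le> Z" "fst ` triple ` set (vlist E) \<subseteq> lens T"
      "\<And>e. e \<in> set (vlist E) \<Longrightarrow> triple e \<in> {..Z} \<times> {..Z} \<times> {..Z}"
    and M: "len M \<le> Z" "(len V + 1) ^ len M \<le> Z"
  shows "bnd Z (best_t conn) [A, E, T, U, C, M]"
proof -
  have "(len C + 1) ^ len M \<le> (len V + 1) ^ len M"
    using sub(2) by (intro power_mono) (auto simp: vsub_def)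
  then have words: "(len C + 1) ^ len M \<le> Z" using M(2) by linarith
  let ?step = "\<lambda>acc u. if len (sem diff_t [C, u]) \<le> len acc \<and>
       truthy (sem (valid_t conn) [A, E, T, U, C, sem diff_t [C, u]]) then sem diff_t [C, u] else acc"
  have acc: "len (foldl ?step C us) \<le> len C" for us
    using foldl_best[of "\<lambda>u. sem diff_t [C, u]" "\<lambda>B. truthy (sem (valid_t conn) [A, E, T, U, C, B])" C us]
    by auto
  have C: "len C \<le> Z" "\<And>x. x \<in> set (vlist C) \<Longrightarrow> len x \<le> Z"
    using vsub_len[OF Z sub(2)] vsub_mem[OF Z sub(2)] by auto
  have diff: "bnd Z diff_t [C, u]" if "u \<in> set (vlist (sem words_t [C, M]))" for u
  proof -
    have "bounded_list Z u" using C M(1) that by (auto simp: bounded_list_def)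
    then show ?thesis unfolding diff_t_def using C by (auto intro!: bnd_intros)
  qed
  have valid: "bnd Z (valid_t conn) [A, E, T, U, C, sem diff_t [C, u]]" for u
    by (rule bnd_valid_t[OF Z sub(1,2) vsub_filter[OF sub(2) vlist_sem_diff_t] U E])
  have step: "bnd Z (app (step_t conn) [TV 2, TV 3, TV 4, TV 5, TV 6, TV 1, app diff_t [TV 6, TV 0]])
      [u, acc, A, E, T, U, C, M]" if "u \<in> set (vlist (sem words_t [C, M]))" "len acc \<le> Z" for u acc
    unfolding step_t_def using diff[OF that(1)] valid that(2) by simp
  have sem_step: "sem (app (step_t conn) [TV 2, TV 3, TV 4, TV 5, TV 6, TV 1, app diff_t [TV 6, TV 0]])
      [u, acc, A, E, T, U, C, M] = ?step acc u" for u acc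
    unfolding step_t_def by (simp cong: if_cong)
  have words_bnd: "bnd Z words_t [C, M]" by (rule bnd_words_t[OF C(1) M(1) words])
  have words_len: "len (sem words_t [C, M]) \<le> Z" using len_sem_words_t[of C M] words by linarith
  show ?thesis
    unfolding best_t_def bnd.simps(7) sem_step
  proof (intro conjI allI impI)
    fix ys x zs
    assume "vlist (sem (app words_t [TV 4, TV 5]) [A, E, T, U, C, M]) = ys @ x # zs"
    then have "x \<in> set (vlist (sem words_t [C, M]))" by simp
    moreover have "len (foldl ?step C ys) \<le> Z" using acc[of ys] C(1) by linarith
    ultimately show "bnd Z (app (step_t conn) [TV 2, TV 3, TV 4, TV 5, TV 6, TV 1, app diff_t [TV 6, TV 0]])
      (x # foldl ?step (sem (TV 4) [A, E, T, U, C, M]) ys # [A, E, T, U, C, M])"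
      using step by simp
  qed (use words_bnd words_len in simp_all)
qed

end

text \<open>The outcome of \<open>reach_t\<close> as a function of the number of the start vertex
  instead of the tree that represents it.\<close>

definition reach_val :: "val \<Rightarrow> val \<Rightarrow> nat \<Rightarrow> val" where
  "reach_val A W i = enc_list (rev (filter (\<lambda>y. (i, len y) \<in> (Restr (arel A) (lens W))\<^sup>*) (vlist W)))"

lemma sem_reach_t_eq: "len x \<in> lens W \<Longrightarrow> sem reach_t [A, W, x] = reach_val A W (len x)"
  using vlist_sem_reach_t[of x W A] unfolding reach_val_def restr_def by (metis enc_list_vlist)

lemma vlist_reach_val:
  "vlist (reach_val A W i) = rev (filter (\<lambda>y. (i, len y) \<in> (Restr (arel A) (lens W))\<^sup>*) (vlist W))"
  by (simp add: reach_val_def)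

text \<open>Each vertex outside \<open>T\<close> recomputes its own component and the best part
  there. The choices agree within a component because they are functions of the same list.\<close>

definition cand_t :: "bool \<Rightarrow> tm" where
  "cand_t conn = tfilter (TV 4) (tor (app mem_t [TV 0, TV 3]) (tand (app mem_t [TV 0, TV 6])
     (app mem_t [TV 0, app (best_t conn)
        [TV 1, TV 2, TV 3, TV 4, app reach_t [TV 1, TV 6, TV 0], TV 7]])))"

lemma vlist_sem_cand_t:
  "vlist (sem (cand_t conn) [A, E, T, U, V, W, M]) = rev (filter (\<lambda>x. len x \<in> lens T \<or>
     len x \<in> lens W \<and> len x \<in> lens (sem (best_t conn) [A, E, T, U, reach_val A W (len x), M])) (vlist V))"
  unfolding cand_t_def by (simp add: sem_reach_t_eq cong: conj_cong)

definition check_t :: "bool \<Rightarrow> tm" where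
  "check_t conn = tand (app le_t [TV 3, TV 2])
     (tand (tall (TV 1) (tall (TV 2) (tor (tnot (app adj_t [TV 2, TV 1, TV 0]))
              (tor (app mem_t [TV 1, TV 5]) (app mem_t [TV 0, TV 5])))))
       (if conn then tall (TV 3) (tall (TV 4) (app mem_t [TV 0, app reach_t [TV 2, TV 5, TV 1]])) else tt))"

lemma sem_check_t:
  assumes "lens S \<subseteq> lens V"
  shows "truthy (sem (check_t conn) [A, V, k, S]) \<longleftrightarrow>
    len S \<le> len k \<and> covers (arel A) (lens V) (lens S) \<and> (conn \<longrightarrow> conn_in (arel A) (lens S))"
  using assms unfolding check_t_def covers_def conn_in_def
  by (auto simp: ball_lens len_in_lens_reach_t len_in_lens)

text \<open>The nested calls act as let bindings: each one extends the environment by a computed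
  list, namely \<open>T\<close> and then the remaining vertices \<open>W\<close>.\<close>

definition guess_t :: "bool \<Rightarrow> tm" where
  "guess_t conn =
     app (app (app (check_t conn) [TV 0, TV 1, TV 2,
                     app (cand_t conn) [TV 0, TV 4, TV 6, TV 5, TV 1, TV 7, TV 3]])
           [TV 0, TV 1, TV 2, TV 3, TV 4, TV 5, TV 6,
            tfilter (TV 1) (tnot (tor (app mem_t [TV 0, TV 7]) (app mem_t [TV 0, TV 6])))])
       [TV 0, TV 1, TV 2, TV 3, TV 4, TV 5,
        tfilter (TV 1) (tex (TV 5) (app eq_t [TV 1, THd (TV 0)]))]"

text \<open>\<open>T\<close> is read off the links, whose first entries run through all of
  it.\<close>

definition chosen :: "val \<Rightarrow> val \<Rightarrow> val" where
  "chosen V E = enc_list (rev (filter (\<lambda>x. len x \<in> fst ` triple ` set (vlist E)) (vlist V)))"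

definition rest :: "val \<Rightarrow> val \<Rightarrow> val \<Rightarrow> val" where
  "rest V T U = enc_list (rev (filter (\<lambda>x. len x \<notin> lens T \<and> len x \<notin> lens U) (vlist V)))"

lemma chosen_eq:
  "sem (tfilter (TV 1) (tex (TV 5) (app eq_t [TV 1, THd (TV 0)]))) [A, V, k, M, E, U] = chosen V E"
proof -
  have "(\<exists>e \<in> set (vlist E). len x = len (vhd e)) \<longleftrightarrow> len x \<in> fst ` triple ` set (vlist E)" for x
    by (auto simp: triple_def image_iff)
  then show ?thesis by (intro vlist_inject[THEN iffD1]) (simp add: chosen_def)
qed

lemma rest_eq:
  "sem (tfilter (TV 1) (tnot (tor (app mem_t [TV 0, TV 7]) (app mem_t [TV 0, TV 6]))))
     [A, V, k, M, E, U, T] = rest V T U"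
  by (intro vlist_inject[THEN iffD1]) (simp add: rest_def)

abbreviation guess_cand :: "bool \<Rightarrow> val \<Rightarrow> val \<Rightarrow> val \<Rightarrow> val \<Rightarrow> val \<Rightarrow> val" where
  "guess_cand conn A V M E U \<equiv>
     sem (cand_t conn) [A, E, chosen V E, U, V, rest V (chosen V E) U, M]"

lemma sem_guess_t:
  "sem (guess_t conn) [A, V, k, M, E, U] = sem (check_t conn) [A, V, k, guess_cand conn A V M E U]"
  unfolding guess_t_def by (simp add: chosen_eq rest_eq del: One_nat_def)

lemma vsub_chosen: "vsub V (chosen V E)" and vsub_rest: "vsub V (rest V T U)"
  by (rule vsub_filter[OF vsub_refl], simp add: chosen_def rest_def)+

definition search_t :: "bool \<Rightarrow> tm" where
  "search_t conn = tex (app words_t [app consall_t [TV 1, app consall_t [TV 1, app consall_t [TV 1, tt]]], TV 3])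
     (tex (app words_t [TV 2, TV 4]) (app (guess_t conn) [TV 2, TV 3, TV 4, TV 5, TV 1, TV 0]))"

definition triples :: "val \<Rightarrow> val set" where
  "triples V = {Cons_val x (Cons_val y (Cons_val c Nil_val)) | x y c.
     x \<in> set (vlist V) \<and> y \<in> set (vlist V) \<and> c \<in> set (vlist V)}"

lemma sem_search_t:
  "truthy (sem (search_t conn) [A, V, k, M]) \<longleftrightarrow>
     (\<exists>E U. set (vlist E) \<subseteq> triples V \<and> len E \<le> len M \<and> set (vlist U) \<subseteq> set (vlist V) \<and> len U \<le> len M \<and>
       truthy (sem (guess_t conn) [A, V, k, M, E, U]))"
proof -
  have "{Cons_val x w |x w. x \<in> set (vlist V) \<and>
      (\<exists>xa wa. w = Cons_val xa wa \<and> xa \<in> set (vlist V) \<and>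
         (\<exists>x. wa = Cons_val x Nil_val \<and> x \<in> set (vlist V)))} = triples V"
    unfolding triples_def by blast
  then show ?thesis unfolding search_t_def by simp blast
qed

lemma search_t_sound:
  assumes "truthy (sem (search_t conn) [A, V, k, M])"
  shows "\<exists>S. covers (arel A) (lens V) S \<and> (conn \<longrightarrow> conn_in (arel A) S) \<and> card S \<le> len k"
proof -
  obtain E U where t: "truthy (sem (check_t conn) [A, V, k, guess_cand conn A V M E U])"
    using assms unfolding sem_search_t sem_guess_t by blast
  let ?S = "guess_cand conn A V M E U"
  have "lens ?S \<subseteq> lens V" unfolding lens_def vlist_sem_cand_t by auto
  moreover have "card (lens ?S) \<le> len ?S"
    unfolding lens_def by (meson card_image_le card_length finite_set le_trans)
  ultimately show ?thesis using t unfolding sem_check_t[OF \<open>lens ?S \<subseteq> lens V\<close>]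
    by (intro exI[of _ "lens ?S"]) auto
qed

text \<open>Makes list lengths agree with cardinalities, so that minimizing the length minimizes the
  size.\<close>

definition distinct_lens :: "val \<Rightarrow> bool" where
  "distinct_lens l \<longleftrightarrow> distinct (map len (vlist l))"

lemma distinct_lens_filter: "distinct_lens l \<Longrightarrow> vlist l' = rev (filter P (vlist l)) \<Longrightarrow> distinct_lens l'"
  unfolding distinct_lens_def by (simp add: distinct_map_filter rev_map[symmetric])

lemma distinct_lens_card: "distinct_lens l \<Longrightarrow> len l = card (lens l)"
  unfolding distinct_lens_def lens_def using distinct_card by fastforce

lemma lens_enc_list: "lens (enc_list xs) = len ` set xs"
  by (simp add: lens_def)

lemma lens_reach_val:
  "i \<in> lens W \<Longrightarrow> lens (reach_val A W i) = {j. (i, j) \<in> (Restr (arel A) (lens W))\<^sup>*}"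
proof -
  assume i: "i \<in> lens W"
  have "j \<in> lens W" if "(i, j) \<in> (Restr (arel A) (lens W))\<^sup>*" for j
    using that i by (induction rule: rtrancl_induct) auto
  then show ?thesis unfolding lens_def[of "reach_val A W i"] vlist_reach_val by (auto simp: lens_def)
qed

text \<open>The geometry enters only through \<open>X\<close> and \<open>indep\<close>. From a
  solution \<open>S\<close> the right guess is built: links for \<open>S \<inter> X\<close> and the
  list of \<open>X - S\<close>. In each component the omitted part of \<open>S\<close> is among the
  words tried, so the best part is no larger than that of \<open>S\<close>, and \<open>glue\<close>
  applies.\<close>

theorem search_t_complete:
  assumes sym: "sym (arel A)" and dist: "distinct_lens V"
    and S: "covers (arel A) (lens V) S" "conn \<Longrightarrow> conn_in (arel A) S" "card S \<le> len k"
    and X: "X \<subseteq> lens V" "conn \<Longrightarrow> S \<inter> X \<noteq> {}" "card X \<le> len M"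
    and indep: "\<And>x I. x \<in> lens V - X \<Longrightarrow> I \<subseteq> {y. (x, y) \<in> (Restr (arel A) (lens V - X))\<^sup>*} \<Longrightarrow>
      (\<forall>u \<in> I. \<forall>v \<in> I. (u, v) \<notin> arel A) \<Longrightarrow> card I \<le> len M"
  shows "truthy (sem (search_t conn) [A, V, k, M])"
proof -
  interpret split_solution conn "arel A" "lens V" S X
    by unfold_locales (use assms in \<open>auto simp: lens_def\<close>)
  \<comment> \<open>Words are lists of entries of \<open>V\<close>, so every vertex number needs a
    representing entry.\<close>
  have "\<forall>i \<in> lens V. \<exists>x \<in> set (vlist V). len x = i" by (auto simp: lens_def)
  then obtain rep where rep: "\<And>i. i \<in> lens V \<Longrightarrow> rep i \<in> set (vlist V) \<and> len (rep i) = i" by metis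
  have fin: "finite T" "finite U" using finite_V X(1) finite_subset by blast+
  have T_V: "T \<subseteq> lens V" using X(1) by blast
  obtain g where g: "conn \<Longrightarrow> good_links ((\<lambda>t. (t, g t)) ` T)"
    "\<And>t. t \<in> T \<Longrightarrow> fst (g t) \<in> lens V \<and> snd (g t) \<in> lens V"
  proof (cases conn)
    case True
    then obtain g where gg: "good_links ((\<lambda>t. (t, g t)) ` T)" using good_links_exist by blast
    have "fst (g t) \<in> lens V \<and> snd (g t) \<in> lens V" if "t \<in> T" for t
    proof -
      have "linked t (fst (g t)) (snd (g t))"
        using gg that unfolding good_links_def by (auto simp: case_prod_beta)
      then show ?thesis unfolding linked_def using T_V by blast
    qed
    with gg that show ?thesis by blast
  next
    case False
    \<comment> \<open>Without connectivity the links only name the vertices of \<open>T\<close>, and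
      trivial ones suffice.\<close>
    with that[of "\<lambda>t. (t, t)"] T_V show ?thesis by auto
  qed
  define Es where "Es = (\<lambda>t. (t, g t)) ` T"
  define mk where "mk t = Cons_val (rep t) (Cons_val (rep (fst (g t))) (Cons_val (rep (snd (g t))) Nil_val))" for t
  define E where "E = enc_list (map mk (sorted_list_of_set T))"
  define Uv where "Uv = enc_list (map rep (sorted_list_of_set U))"
  have mk: "mk t \<in> triples V" "triple (mk t) = (t, g t)" if "t \<in> T" for t
    using rep[of t] rep[of "fst (g t)"] rep[of "snd (g t)"] g(2)[OF that] T_V that
    by (auto simp: mk_def triples_def triple_def)
  have E: "set (vlist E) \<subseteq> triples V" "len E \<le> len M" "triple ` set (vlist E) = Es"
  proof -
    show "set (vlist E) \<subseteq> triples V" using mk fin by (auto simp: E_def)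
    have "card T \<le> card X" using finite_V X(1) by (intro card_mono) (auto intro: finite_subset)
    then show "len E \<le> len M" using X(3) by (simp add: E_def)
    show "triple ` set (vlist E) = Es"
      unfolding E_def Es_def using mk(2) fin by (simp add: image_image)
  qed
  have Uv: "set (vlist Uv) \<subseteq> set (vlist V)" "len Uv \<le> len M" "lens Uv = U"
  proof -
    show "set (vlist Uv) \<subseteq> set (vlist V)" using rep fin X(1) by (auto simp: Uv_def)
    have "card U \<le> card X" using finite_V X(1) by (intro card_mono) (auto intro: finite_subset)
    then show "len Uv \<le> len M" using X(3) by (simp add: Uv_def)
    have "len (rep i) = i" if "i \<in> U" for i using rep X(1) that by blast
    then show "lens Uv = U" unfolding Uv_def lens_enc_list using fin by (simp add: image_image)
  qed
  define Tv where "Tv = chosen V E"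
  define Wv where "Wv = rest V Tv Uv"
  have fst_Es: "fst ` Es = T" unfolding Es_def by (simp add: image_image)
  have Tv: "lens Tv = T"
    unfolding Tv_def chosen_def lens_enc_list E(3) fst_Es using T_V by (auto simp: lens_def)
  have vWv: "vlist Wv = rev (filter (\<lambda>x. len x \<notin> T \<and> len x \<notin> U) (vlist V))"
    unfolding Wv_def rest_def Tv Uv(3) by simp
  have Wv: "lens Wv = W"
    unfolding lens_def[of Wv] vWv by (auto simp: lens_def)
  have fst_E: "fst ` triple ` set (vlist E) \<subseteq> lens Tv" unfolding E(3) fst_Es Tv by simp
  have good: "conn \<Longrightarrow> good_links Es" using g(1) unfolding Es_def .
  define b where "b x = lens (sem (best_t conn) [A, E, Tv, Uv, reach_val A Wv x, M])" for x
  have C_lens: "lens (reach_val A Wv x) = C x" if "x \<in> W" for x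
    using lens_reach_val[of x Wv A] that unfolding Wv C_def by simp
  have valid_iff: "truthy (sem (valid_t conn) [A, E, Tv, Uv, c, B]) \<longleftrightarrow>
      locally_valid conn (arel A) Es T U (lens c) (lens B)" for c B
    using sem_valid_t[OF fst_E, of conn A Uv c B] unfolding E(3) Tv Uv(3) .
  have b: "b x \<subseteq> C x \<and> locally_valid conn (arel A) Es T U (C x) (b x) \<and> card (b x) \<le> card (S \<inter> C x)"
    if x: "x \<in> W" for x
  proof -
    let ?c = "reach_val A Wv x"
    let ?I = "C x - S"
    have finC: "finite (C x)" by (rule finite_C[OF x])
    \<comment> \<open>The word omitted by \<open>S\<close>: it is independent, hence of length at
      most \<open>len M\<close>, and removing it from the component leaves exactly the part of
      \<open>S\<close>.\<close>
    define u where "u = enc_list (map rep (sorted_list_of_set ?I))"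
    have rep_c: "rep i \<in> set (vlist ?c) \<and> len (rep i) = i" if i: "i \<in> C x" for i
    proof -
      have iW: "i \<in> W" using C_W[OF x] i by blast
      then have r: "rep i \<in> set (vlist V)" "len (rep i) = i" using rep by auto
      then have "rep i \<in> set (vlist Wv)" using iW unfolding vWv by auto
      then show ?thesis using r i unfolding vlist_reach_val Wv C_def by auto
    qed
    have u1: "set (vlist u) \<subseteq> set (vlist ?c)" using rep_c finC by (auto simp: u_def)
    have "card ?I \<le> len M"
    proof (rule indep[OF x])
      show "?I \<subseteq> {y. (x, y) \<in> (Restr (arel A) (lens V - X))\<^sup>*}" unfolding C_def by blast
      show "\<forall>u \<in> ?I. \<forall>v \<in> ?I. (u, v) \<notin> arel A"
        using S(1) C_W[OF x] unfolding covers_def by blast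
    qed
    then have u2: "len u \<le> len M" by (simp add: u_def)
    have "lens u = ?I"
      unfolding u_def lens_enc_list using rep_c finC by (auto simp: image_image)
    then have d: "lens (sem diff_t [?c, u]) = S \<inter> C x"
      unfolding lens_sem_diff_t C_lens[OF x] by blast
    have v: "truthy (sem (valid_t conn) [A, E, Tv, Uv, ?c, sem diff_t [?c, u]])"
      unfolding valid_iff d C_lens[OF x] by (rule solution_locally_valid[OF x good])
    have "distinct_lens (sem diff_t [?c, u])"
      by (rule distinct_lens_filter[OF distinct_lens_filter[OF
            distinct_lens_filter[OF dist vWv] vlist_reach_val] vlist_sem_diff_t])
    then have l: "len (sem diff_t [?c, u]) = card (S \<inter> C x)" using distinct_lens_card d by metis
    note opt = best_t_optimal[OF u1 u2 v]
    have "card (b x) \<le> len (sem (best_t conn) [A, E, Tv, Uv, ?c, M])"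
      unfolding b_def lens_def by (meson card_image_le card_length finite_set le_trans)
    moreover have "locally_valid conn (arel A) Es T U (C x) (b x)"
      using opt(1) unfolding valid_iff C_lens[OF x] b_def .
    moreover have "b x \<subseteq> C x"
      using best_t_cases[of conn A E Tv Uv ?c M] lens_sem_diff_t[of ?c] C_lens[OF x]
      unfolding b_def by (metis Diff_subset order_refl)
    ultimately show ?thesis using opt(2) l by linarith
  qed
  have b_eq: "b y = b x" if "x \<in> W" "y \<in> C x" for x y
  proof -
    have "reach_val A Wv y = reach_val A Wv x"
      unfolding reach_val_def Wv using C_eq[OF that(2)] unfolding C_def by (simp add: set_eq_iff)
    then show ?thesis unfolding b_def by simp
  qed
  let ?S = "guess_cand conn A V M E Uv"
  have vS: "vlist ?S = rev (filter (\<lambda>x. len x \<in> T \<or> len x \<in> W \<and> len x \<in> b (len x)) (vlist V))"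
    unfolding vlist_sem_cand_t Tv_def[symmetric] Wv_def[symmetric] Tv Wv b_def ..
  have lS: "lens ?S = T \<union> {x \<in> W. x \<in> b x}"
    unfolding lens_def[of ?S] vS using T_V by (auto simp: lens_def)
  note glued = glue[OF good b b_eq, folded lS]
  have "len ?S = card (lens ?S)"
    by (rule distinct_lens_card[OF distinct_lens_filter[OF dist vS]])
  then have "truthy (sem (check_t conn) [A, V, k, ?S])"
    using sem_check_t[of ?S V] glued S(3) unfolding covers_def[of _ _ "lens ?S"] by auto
  then have "truthy (sem (guess_t conn) [A, V, k, M, E, Uv])" unfolding sem_guess_t .
  then show ?thesis unfolding sem_search_t using E Uv by blast
qed

lemma bnd_cand_t:
  assumes Z: "fits Z V" and sub: "vsub V T" "vsub V W" and U: "bounded_list Z U"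
    and E: "len E \<le> Z" "fst ` triple ` set (vlist E) \<subseteq> lens T"
      "\<And>e. e \<in> set (vlist E) \<Longrightarrow> triple e \<in> {..Z} \<times> {..Z} \<times> {..Z}"
    and M: "len M \<le> Z" "(len V + 1) ^ len M \<le> Z"
  shows "bnd Z (cand_t conn) [A, E, T, U, V, W, M]"
proof -
  have best: "bnd Z (best_t conn) [A, E, T, U, sem reach_t [A, W, x], M]"
    "bounded_list Z (sem (best_t conn) [A, E, T, U, sem reach_t [A, W, x], M])"
    if "len x \<in> lens W" for x
  proof -
    have c: "vsub V (sem reach_t [A, W, x])" by (rule vsub_reach[OF sub(2) that])
    show "bnd Z (best_t conn) [A, E, T, U, sem reach_t [A, W, x], M]"
      by (rule bnd_best_t[OF Z sub(1) c U E M])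
    show "bounded_list Z (sem (best_t conn) [A, E, T, U, sem reach_t [A, W, x], M])"
      by (rule vsub_bounded[OF Z vsub_best_t[OF c]])
  qed
  show ?thesis
    unfolding cand_t_def
    using best vsub_mem[OF Z vsub_refl] vsub_len[OF Z vsub_refl] vsub_bounded[OF Z sub(1)]
      vsub_bounded[OF Z sub(2)] bnd_reach_vsub[OF Z sub(2)]
    by (auto intro!: bnd_tfilter)
qed

lemma bnd_check_t:
  assumes Z: "fits Z V" and sub: "vsub V S" and k: "len k \<le> Z"
  shows "bnd Z (check_t conn) [A, V, k, S]"
proof -
  have "bounded_list Z (sem reach_t [A, S, x])" if "x \<in> set (vlist S)" for x
    by (rule vsub_bounded[OF Z vsub_reach[OF sub len_in_lens[OF that]]])
  then show ?thesis
    unfolding check_t_def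
    using k vsub_mem[OF Z vsub_refl] vsub_len[OF Z vsub_refl] vsub_mem[OF Z sub] vsub_len[OF Z sub]
      vsub_bounded[OF Z sub] bnd_reach_vsub[OF Z sub]
    by (auto intro!: bnd_intros)
qed

lemma bnd_guess_t:
  assumes Z: "fits Z V" and k: "len k \<le> Z" and M: "len M \<le> Z" "(len V + 1) ^ len M \<le> Z"
    and E: "set (vlist E) \<subseteq> triples V" "len E \<le> len M"
    and U: "set (vlist U) \<subseteq> set (vlist V)" "len U \<le> len M"
  shows "bnd Z (guess_t conn) [A, V, k, M, E, U]"
proof -
  have V: "\<And>x. x \<in> set (vlist V) \<Longrightarrow> len x \<le> Z" "len V \<le> Z"
    using vsub_mem[OF Z vsub_refl] vsub_len[OF Z vsub_refl] by auto
  have E1: "len E \<le> Z" using E(2) M(1) by linarith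
  have E2: "fst ` triple ` set (vlist E) \<subseteq> lens (chosen V E)"
  proof -
    have "fst ` triple ` set (vlist E) \<subseteq> lens V"
      using E(1) by (auto simp: triples_def triple_def lens_def)
    moreover have "F \<subseteq> len ` {x \<in> set (vlist V). len x \<in> F}" if "F \<subseteq> lens V" for F
      using that unfolding lens_def by blast
    ultimately show ?thesis unfolding chosen_def lens_enc_list by simp
  qed
  have E3: "triple e \<in> {..Z} \<times> {..Z} \<times> {..Z}" if "e \<in> set (vlist E)" for e
    using E(1) V(1) that by (auto simp: triples_def triple_def)
  have E4: "len (vhd e) \<le> Z" if "e \<in> set (vlist E)" for e
    using E3[OF that] by (simp add: triple_def)
  have U': "bounded_list Z U" using U M(1) V(1) by (auto simp: bounded_list_def)
  note cand = bnd_cand_t[OF Z vsub_chosen vsub_rest U' E1 E2 E3 M]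
  have "vsub V (guess_cand conn A V M E U)"
    by (rule vsub_filter[OF vsub_refl vlist_sem_cand_t])
  note check = bnd_check_t[OF Z this k]
  have 1: "bnd Z (tfilter (TV 1) (tex (TV 5) (app eq_t [TV 1, THd (TV 0)]))) [A, V, k, M, E, U]"
    using V E1 E4 by (auto intro!: bnd_intros)
  have 2: "bnd Z (tfilter (TV 1) (tnot (tor (app mem_t [TV 0, TV 7]) (app mem_t [TV 0, TV 6]))))
     [A, V, k, M, E, U, chosen V E]"
    using V U' vsub_bounded[OF Z vsub_chosen] by (auto intro!: bnd_intros)
  show ?thesis
    unfolding guess_t_def using 1 2 cand check by (simp add: chosen_eq rest_eq del: One_nat_def)
qed

theorem bnd_search_t:
  assumes Z: "fits Z V" and k: "len k \<le> Z" and M: "len M \<le> Z"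
    and words: "(len V * (len V * len V) + 1) ^ len M \<le> Z" and V3: "len V * (len V * len V) \<le> Z"
  shows "bnd Z (search_t conn) [A, V, k, M]"
proof -
  have "len V \<le> len V * (len V * len V)" by (cases "len V") auto
  then have "(len V + 1) ^ len M \<le> (len V * (len V * len V) + 1) ^ len M" by (intro power_mono) auto
  then have M2: "(len V + 1) ^ len M \<le> Z" using words by linarith
  have V: "len V \<le> Z" "len V * len V \<le> Z" "1 \<le> Z"
    using Z vsub_len[OF Z vsub_refl] by (auto simp: fits_def)
  let ?t = "sem consall_t [V, sem consall_t [V, sem consall_t [V, Cons_val Nil_val Nil_val]]]"
  have t: "len ?t = len V * (len V * len V)" by simp
  have ts: "set (vlist ?t) = triples V" unfolding triples_def by auto
  have wt: "len (sem words_t [?t, M]) \<le> Z" using len_sem_words_t[of ?t M] words unfolding t by linarith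
  have wV: "len (sem words_t [V, M]) \<le> Z" using len_sem_words_t[of V M] M2 by linarith
  have "bnd Z words_t [?t, M]" by (rule bnd_words_t) (use words V3 M in simp_all)
  moreover have bV: "bnd Z words_t [V, M]" by (rule bnd_words_t) (use M2 V M in simp_all)
  moreover have "bnd Z (tex (app words_t [TV 2, TV 4]) (app (guess_t conn) [TV 2, TV 3, TV 4, TV 5, TV 1, TV 0]))
      [E, A, V, k, M]" if E: "E \<in> set (vlist (sem words_t [?t, M]))" for E
  proof (rule bnd_tex)
    fix U assume "U \<in> set (vlist (sem (app words_t [TV 2, TV 4]) [E, A, V, k, M]))"
    then have "set (vlist U) \<subseteq> set (vlist V)" "len U \<le> len M" by auto
    moreover have "set (vlist E) \<subseteq> triples V" "len E \<le> len M" using E unfolding set_sem_words_t ts by auto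
    ultimately show "bnd Z (app (guess_t conn) [TV 2, TV 3, TV 4, TV 5, TV 1, TV 0]) [U, E, A, V, k, M]"
      using bnd_guess_t[OF Z k M M2] by simp
  qed (use bV wV in simp_all)
  ultimately show ?thesis
    unfolding search_t_def using V wt by - (rule bnd_tex, simp_all del: set_sem_words_t)
qed

section \<open>Geometry of unit ball graphs\<close>

lemma unit_cballs_intersect_iff:
  fixes x y :: "real ^ 'd"
  shows "cball x 1 \<inter> cball y 1 \<noteq> {} \<longleftrightarrow> dist x y \<le> 2"
proof
  assume "cball x 1 \<inter> cball y 1 \<noteq> {}"
  then obtain z where z: "dist x z \<le> 1" "dist y z \<le> 1" by auto
  have "dist x y \<le> dist x z + dist y z" using dist_triangle[of x y z] by (simp add: dist_commute)
  with z show "dist x y \<le> 2" by linarith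
next
  assume "dist x y \<le> 2"
  then have "midpoint x y \<in> cball x 1 \<inter> cball y 1" by (simp add: dist_midpoint)
  then show "cball x 1 \<inter> cball y 1 \<noteq> {}" by blast
qed

lemma floor_le_floor_add: "x \<le> y + real N \<Longrightarrow> \<lfloor>x\<rfloor> \<le> \<lfloor>y\<rfloor> + int N"
  by linarith

text \<open>Cells of side length \<open>2/d\<close> have diameter at most \<open>2\<close>, so a separated set has at most one
  point in each cell.\<close>

lemma separated_in_box_card:
  fixes c :: "'a \<Rightarrow> real ^ 'd" and l :: nat
  assumes fin: "finite I" and sep: "\<And>u v. u \<in> I \<Longrightarrow> v \<in> I \<Longrightarrow> u \<noteq> v \<Longrightarrow> dist (c u) (c v) > 2"
    and box: "\<And>u i. u \<in> I \<Longrightarrow> a i \<le> c u $ i \<and> c u $ i \<le> a i + real l"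
  shows "card I \<le> (l * CARD('d) + 1) ^ CARD('d)"
proof -
  let ?d = "real CARD('d)"
  define cell where "cell u = (\<lambda>i. \<lfloor>c u $ i * ?d / 2\<rfloor>)" for u
  \<comment> \<open>A range of length \<open>l\<close> spans \<open>l * d / 2\<close> cell widths
    per axis; dropping the division by 2 keeps the bound a natural number.\<close>
  define B where "B = (\<lambda>i. {\<lfloor>a i * ?d / 2\<rfloor> .. \<lfloor>a i * ?d / 2\<rfloor> + int (l * CARD('d))})"
  have d: "?d > 0" by simp
  have "inj_on cell I"
  proof (rule inj_onI, rule ccontr)
    fix u v assume uv: "u \<in> I" "v \<in> I" "cell u = cell v" "u \<noteq> v"
    have "\<bar>(c u - c v) $ i\<bar> \<le> 2 / ?d" for i
    proof -
      have "\<lfloor>c u $ i * ?d / 2\<rfloor> = \<lfloor>c v $ i * ?d / 2\<rfloor>" using uv(3) unfolding cell_def by metis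
      then have "\<bar>c u $ i * ?d / 2 - c v $ i * ?d / 2\<bar> \<le> 1" by linarith
      then have "\<bar>c u $ i - c v $ i\<bar> * (?d / 2) \<le> 1"
        using d by (simp add: abs_mult left_diff_distrib[symmetric] diff_divide_distrib[symmetric])
      then show ?thesis using d by (simp add: field_simps)
    qed
    \<comment> \<open>The side \<open>2 / d\<close> is chosen so that the sum of the
      \<open>d\<close> coordinate differences, which dominates the distance, is at most 2.\<close>
    then have "(\<Sum>i \<in> UNIV. \<bar>(c u - c v) $ i\<bar>) \<le> (\<Sum>i \<in> (UNIV :: 'd set). 2 / ?d)"
      by (intro sum_mono)
    also have "\<dots> = 2" by simp
    finally have "dist (c u) (c v) \<le> 2"
      using norm_le_l1_cart[of "c u - c v"] unfolding dist_norm by linarith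
    with sep[OF uv(1,2,4)] show False by simp
  qed
  moreover have "cell ` I \<subseteq> PiE UNIV B"
  proof
    fix f assume "f \<in> cell ` I"
    then obtain u where u: "u \<in> I" "f = cell u" by blast
    have "f i \<in> B i" for i
    proof -
      have "a i * ?d / 2 \<le> c u $ i * ?d / 2"
        using box[OF u(1), of i] d by (simp add: divide_right_mono mult_right_mono)
      moreover have "c u $ i * ?d / 2 \<le> a i * ?d / 2 + real (l * CARD('d))"
      proof -
        have "c u $ i * ?d \<le> (a i + real l) * ?d" using box[OF u(1), of i] d by (intro mult_right_mono) auto
        moreover have "0 \<le> real l * ?d" by simp
        ultimately show ?thesis unfolding distrib_right of_nat_mult by linarith
      qed
      ultimately show ?thesis
        using floor_mono[of "a i * ?d / 2" "c u $ i * ?d / 2"]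
          floor_le_floor_add[of "c u $ i * ?d / 2" "a i * ?d / 2" "l * CARD('d)"]
        unfolding B_def u(2) cell_def atLeastAtMost_iff by blast
    qed
    then show "f \<in> PiE UNIV B" by (auto simp: PiE_def)
  qed
  moreover have "finite (PiE UNIV B)" unfolding B_def by (intro finite_PiE) auto
  ultimately have "card I \<le> card (PiE UNIV B)" by (meson card_inj_on_le)
  also have "\<dots> = (\<Prod>i \<in> (UNIV :: 'd set). l * CARD('d) + 1)"
    unfolding B_def by (simp add: card_PiE nat_add_distrib del: of_nat_mult)
  also have "\<dots> = (l * CARD('d) + 1) ^ CARD('d)" by simp
  finally show ?thesis .
qed

text \<open>Numbers with different quotients that avoid the multiples of \<open>L\<close> lie
  strictly on both sides of such a multiple, hence differ by at least 2.\<close>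

lemma div_eq_of_adjacent:
  fixes a b L :: int
  assumes "L > 0" "\<bar>a - b\<bar> \<le> 1" "a mod L \<noteq> 0" "b mod L \<noteq> 0"
  shows "a div L = b div L"
proof -
  have *: "a div L \<le> b div L" if "\<bar>a - b\<bar> \<le> 1" "a mod L \<noteq> 0" "b mod L \<noteq> 0" for a b
  proof (rule ccontr)
    assume "\<not> a div L \<le> b div L"
    then have "L * (b div L + 1) \<le> L * (a div L)" using assms(1) by (intro mult_left_mono) auto
    moreover have "a = L * (a div L) + a mod L" "b = L * (b div L) + b mod L" by auto
    moreover have "a mod L \<ge> 1" "b mod L < L"
      using that assms(1) pos_mod_sign[of L a] pos_mod_bound[of L b] by linarith+
    ultimately show False using that(1) unfolding distrib_left by linarith
  qed
  show ?thesis using *[of a b] *[of b a] assms by (simp add: abs_minus_commute)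
qed

text \<open>Averaging: the \<open>L\<close> classes together have \<open>card V\<close>
  elements.\<close>

lemma residue_class_small:
  fixes f :: "'a \<Rightarrow> int" and L :: nat
  assumes "finite V" "L \<ge> 1"
  shows "\<exists>j \<in> {0..<int L}. L * card {v \<in> V. f v mod int L = j} \<le> card V"
proof (rule ccontr)
  assume "\<not> ?thesis"
  then have gt: "card V < L * card {v \<in> V. f v mod int L = j}" if "j \<in> {0..<int L}" for j
    using that by (auto simp: not_le)
  have "(\<Sum>j \<in> {0..<int L}. card {v \<in> V. f v mod int L = j}) = card V"
    using sum.group[of V "{0..<int L}" "\<lambda>v. f v mod int L" "\<lambda>_. 1::nat"] assms
    by (force simp: image_subset_iff)
  then have "L * card V = (\<Sum>j \<in> {0..<int L}. L * card {v \<in> V. f v mod int L = j})"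
    by (simp flip: sum_distrib_left)
  also have "\<dots> > (\<Sum>j \<in> {0..<int L}. card V)"
    using gt assms by (intro sum_strict_mono) auto
  also have "(\<Sum>j \<in> {0..<int L}. card V) = L * card V" by simp
  finally show False by simp
qed

section \<open>Kernel bound and shifting\<close>

locale ball_rep =
  fixes c :: "nat \<Rightarrow> real ^ 'd" and R :: "nat rel" and V :: "nat set"
  assumes finite_V: "finite V"
    and R_iff: "\<And>u v. u \<in> V \<Longrightarrow> v \<in> V \<Longrightarrow> (u, v) \<in> R \<longleftrightarrow> u \<noteq> v \<and> dist (c u) (c v) \<le> 2"
begin

lemma independent_in_box_card:
  assumes "I \<subseteq> V" "\<forall>u \<in> I. \<forall>v \<in> I. (u, v) \<notin> R"
    and "\<And>u i. u \<in> I \<Longrightarrow> a i \<le> c u $ i \<and> c u $ i \<le> a i + real l"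
  shows "card I \<le> (l * CARD('d) + 1) ^ CARD('d)"
proof (rule separated_in_box_card[where a = a])
  show "finite I" using assms(1) finite_V finite_subset by blast
  show "dist (c u) (c v) > 2" if "u \<in> I" "v \<in> I" "u \<noteq> v" for u v
    using R_iff[of u v] assms(1,2) that by (meson not_le subsetD)
qed (use assms in auto)

lemma nth_diff_le_dist: "\<bar>c u $ i - c v $ i\<bar> \<le> dist (c u) (c v)"
  using component_le_norm_cart[of "c u - c v" i] by (simp add: dist_norm)

text \<open>Each vertex outside \<open>S\<close> is charged to a neighbour in \<open>S\<close>.
  Those charged to \<open>s\<close> are pairwise non-adjacent, as \<open>S\<close> covers all edges,
  and their centres lie in the box of side 4 around that of \<open>s\<close>.\<close>

theorem kernel_bound:
  assumes S: "covers R V S" and nonisolated: "\<And>v. v \<in> V \<Longrightarrow> \<exists>w \<in> V. (v, w) \<in> R"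
  shows "card V \<le> (1 + (4 * CARD('d) + 1) ^ CARD('d)) * card S"
proof -
  let ?q = "(4 * CARD('d) + 1) ^ CARD('d)"
  have finS: "finite S" using S finite_V finite_subset unfolding covers_def by blast
  have nb: "card {v \<in> V - S. (v, s) \<in> R} \<le> ?q" if s: "s \<in> S" for s
  proof (rule independent_in_box_card[where a = "\<lambda>i. c s $ i - 2"])
    show "\<forall>u \<in> {v \<in> V - S. (v, s) \<in> R}. \<forall>v \<in> {v \<in> V - S. (v, s) \<in> R}. (u, v) \<notin> R"
      using S unfolding covers_def by blast
    fix u i assume "u \<in> {v \<in> V - S. (v, s) \<in> R}"
    then have "dist (c u) (c s) \<le> 2" using R_iff[of u s] S s unfolding covers_def by blast
    then show "c s $ i - 2 \<le> c u $ i \<and> c u $ i \<le> c s $ i - 2 + real 4"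
      using nth_diff_le_dist[of u i s] by auto
  qed auto
  have "V \<subseteq> S \<union> (\<Union>s \<in> S. {v \<in> V - S. (v, s) \<in> R})"
  proof
    fix v assume v: "v \<in> V"
    show "v \<in> S \<union> (\<Union>s \<in> S. {v \<in> V - S. (v, s) \<in> R})"
    proof (cases "v \<in> S")
      case False
      obtain w where "w \<in> V" "(v, w) \<in> R" using nonisolated[OF v] by blast
      moreover then have "w \<in> S" using S v False unfolding covers_def by blast
      ultimately show ?thesis using v False by blast
    qed simp
  qed
  then have "card V \<le> card (S \<union> (\<Union>s \<in> S. {v \<in> V - S. (v, s) \<in> R}))"
    using finS finite_V by (intro card_mono) auto
  also have "\<dots> \<le> card S + (\<Sum>s \<in> S. card {v \<in> V - S. (v, s) \<in> R})"
    by (rule order_trans[OF card_Un_le add_left_mono[OF card_UN_le[OF finS]]])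
  also have "\<dots> \<le> card S + (\<Sum>s \<in> S. ?q)" using nb by (intro add_left_mono sum_mono)
  finally show ?thesis by (simp add: algebra_simps)
qed

text \<open>Shifting: in each coordinate the vertices are grouped into slabs of width \<open>2\<close>, and deleting one
  residue class of slabs modulo \<open>L\<close> leaves no edge between different blocks. The cheapest residue
  class contains at most the fraction \<open>1/L\<close> of all vertices.\<close>

theorem shifting:
  assumes "L \<ge> 1"
  shows "\<exists>X \<subseteq> V. L * card X \<le> CARD('d) * card V \<and>
    (\<forall>x \<in> V - X. \<forall>I. I \<subseteq> {y. (x, y) \<in> (Restr R (V - X))\<^sup>*} \<longrightarrow> (\<forall>u \<in> I. \<forall>v \<in> I. (u, v) \<notin> R) \<longrightarrow>
       card I \<le> (2 * L * CARD('d) + 1) ^ CARD('d))"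
proof -
  define f where "f v i = \<lfloor>c v $ i / 2\<rfloor>" for v i
  have "\<forall>i. \<exists>j. j \<in> {0..<int L} \<and> L * card {v \<in> V. f v i mod int L = j} \<le> card V"
    using residue_class_small[OF finite_V assms, of "\<lambda>v. f v _"] by (simp add: Bex_def)
  from choice[OF this] obtain j where j: "\<And>i. j i \<in> {0..<int L}"
    "\<And>i. L * card {v \<in> V. f v i mod int L = j i} \<le> card V" by auto
  define X where "X = (\<Union>i. {v \<in> V. f v i mod int L = j i})"
  define block where "block v i = (f v i - j i) div int L" for v i
  have X_V: "X \<subseteq> V" unfolding X_def by blast
  have "card X \<le> (\<Sum>i \<in> UNIV. card {v \<in> V. f v i mod int L = j i})"
    unfolding X_def by (rule card_UN_le) simp
  then have "L * card X \<le> (\<Sum>i \<in> UNIV. L * card {v \<in> V. f v i mod int L = j i})"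
    unfolding sum_distrib_left[symmetric] by (rule mult_le_mono2)
  also have "\<dots> \<le> (\<Sum>i \<in> (UNIV :: 'd set). card V)" by (intro sum_mono j(2))
  finally have card_X: "L * card X \<le> CARD('d) * card V" by simp
  have mod: "(f v i - j i) mod int L \<noteq> 0" if "v \<in> V - X" for v i
  proof
    assume "(f v i - j i) mod int L = 0"
    then have "f v i mod int L = j i mod int L"
      using mod_eq_dvd_iff[of "f v i" "int L" "j i"] by (simp add: dvd_eq_mod_eq_0)
    then have "f v i mod int L = j i" using j(1)[of i] by simp
    with that show False unfolding X_def by blast
  qed
  \<comment> \<open>Adjacent centres differ by at most 2 in each coordinate, hence by at most one
    slab, so an edge cannot jump over the removed class.\<close>
  have edge: "block u i = block v i" if "(u, v) \<in> Restr R (V - X)" for u v i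
    unfolding block_def
  proof (rule div_eq_of_adjacent)
    have "dist (c u) (c v) \<le> 2" using R_iff[of u v] that by blast
    then have "\<bar>c u $ i / 2 - c v $ i / 2\<bar> \<le> 1" using nth_diff_le_dist[of u i v] by auto
    then have "\<bar>f u i - f v i\<bar> \<le> 1" unfolding f_def by linarith
    then show "\<bar>f u i - j i - (f v i - j i)\<bar> \<le> 1" by simp
    show "int L > 0" using assms by simp
    show "(f u i - j i) mod int L \<noteq> 0" "(f v i - j i) mod int L \<noteq> 0"
      by (rule mod, use that in blast)+
  qed
  have indep: "card I \<le> (2 * L * CARD('d) + 1) ^ CARD('d)"
    if x: "x \<in> V - X" and I: "I \<subseteq> {y. (x, y) \<in> (Restr R (V - X))\<^sup>*}" "\<forall>u \<in> I. \<forall>v \<in> I. (u, v) \<notin> R" for x I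
  \<comment> \<open>A block spans \<open>L\<close> slabs of width 2 in each coordinate, so it is a
    box of side \<open>2 * L\<close> with this lower corner.\<close>
  proof (rule independent_in_box_card[where a = "\<lambda>i. 2 * real_of_int (int L * block x i + j i)"])
    have y: "y \<in> V - X \<and> (\<forall>i. block y i = block x i)" if "y \<in> I" for y
    proof -
      have "(x, y) \<in> (Restr R (V - X))\<^sup>*" using I(1) that by blast
      then show ?thesis
      proof (induction rule: rtrancl_induct)
        case base
        then show ?case using x by simp
      next
        case (step y z)
        then show ?case using edge[of y z] by auto
      qed
    qed
    then show "I \<subseteq> V" by blast
    fix u i assume "u \<in> I"
    then have "block x i = block u i" using y by simp
    then have "f u i - j i = int L * block x i + (f u i - j i) mod int L" by (simp add: block_def)
    moreover have "0 \<le> (f u i - j i) mod int L" "(f u i - j i) mod int L < int L" using assms by auto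
    ultimately have "int L * block x i + j i \<le> f u i \<and> f u i + 1 \<le> int L * block x i + j i + int L"
      by linarith
    then have b: "int L * block x i + j i \<le> f u i" "f u i \<le> int L * block x i + j i + int L - 1" by auto
    have r: "real_of_int (int L * block x i + j i) \<le> c u $ i / 2"
      using b(1) unfolding f_def le_floor_iff .
    have "c u $ i / 2 < real_of_int (int L * block x i + j i + int L)"
      using b(2) unfolding f_def floor_le_iff by simp
    note r = r this
    show "2 * real_of_int (int L * block x i + j i) \<le> c u $ i \<and>
        c u $ i \<le> 2 * real_of_int (int L * block x i + j i) + real (2 * L)"
      using r by simp
  qed (use I in auto)
  show ?thesis
    by (intro exI[of _ X] conjI ballI allI impI X_V card_X indep) simp_all
qed

end

section \<open>Parameters and the main program\<close>

primrec pow_t :: "nat \<Rightarrow> tm" where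
  "pow_t 0 = tt"
| "pow_t (Suc e) = app consall_t [TV 0, pow_t e]"

lemma len_sem_pow_t [simp]: "len (sem (pow_t e) [L]) = len L ^ e"
  by (induction e) simp_all

lemma bnd_pow_t: "len L \<le> Z \<Longrightarrow> (len L + 1) ^ e \<le> Z \<Longrightarrow> bnd Z (pow_t e) [L]"
proof (induction e)
  case (Suc e)
  have "(len L + 1) ^ e \<le> (len L + 1) ^ Suc e" by simp
  then have e: "(len L + 1) ^ e \<le> Z" using Suc.prems(2) by linarith
  moreover have "len L ^ e \<le> (len L + 1) ^ e" by (intro power_mono) auto
  ultimately have "len L ^ e \<le> Z" by linarith
  then show ?case using Suc e by simp
qed simp

primrec const_t :: "nat \<Rightarrow> tm" where
  "const_t 0 = TN"
| "const_t (Suc a) = TC TN (const_t a)"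

lemma len_sem_const_t [simp]: "len (sem (const_t a) env) = a"
  by (induction a) simp_all

lemma bnd_const_t [simp]: "bnd Z (const_t a) env"
  by (induction a) simp_all

section \<open>Integer roots and the size of guesses\<close>

definition root_iter :: "nat \<Rightarrow> nat \<Rightarrow> nat \<Rightarrow> nat" where
  "root_iter e k i = ((\<lambda>r. if k \<le> r ^ e then r else Suc r) ^^ i) 0"

abbreviation ceil_root :: "nat \<Rightarrow> nat \<Rightarrow> nat" where
  "ceil_root e k \<equiv> root_iter e k k"

lemma root_iter_Suc:
  "root_iter e k (Suc i) = (if k \<le> root_iter e k i ^ e then root_iter e k i else Suc (root_iter e k i))"
  by (simp add: root_iter_def)

lemma root_iter_invariant:
  "root_iter e k i \<le> i \<and> (k \<le> root_iter e k i ^ e \<or> root_iter e k i = i) \<and>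
   (root_iter e k i = 0 \<or> (root_iter e k i - 1) ^ e < k)"
proof (induction i)
  case 0
  then show ?case by (simp add: root_iter_def)
next
  case (Suc i)
  then show ?case by (auto simp: root_iter_Suc)
qed

text \<open>The iteration counts up to the first \<open>r\<close> with \<open>k \<le> r ^ e\<close>;
  \<open>k\<close> rounds are enough because \<open>k \<le> k ^ e\<close>.\<close>

lemma ceil_root_ge: "e \<ge> 1 \<Longrightarrow> k \<le> ceil_root e k ^ e"
  using root_iter_invariant[of e k k] self_le_power[of k e] by (cases "k = 0") auto

lemma ceil_root_le: "ceil_root e k \<le> k"
  using root_iter_invariant[of e k k] by simp

lemma ceil_root_minimal: "ceil_root e k = 0 \<or> (ceil_root e k - 1) ^ e < k"
  using root_iter_invariant[of e k k] by simp

definition root_t :: "nat \<Rightarrow> tm" where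
  "root_t e = TFold (TV 0) TN (TIf (app le_t [TV 2, app (pow_t e) [TV 1]]) (TV 1) (TC TN (TV 1)))"

lemma len_foldl_root:
  "len (foldl (\<lambda>acc x. if len k \<le> len acc ^ e then acc else Cons_val Nil_val acc) Nil_val xs) =
     root_iter e (len k) (length xs)"
  by (induction xs rule: rev_induct) (simp_all add: root_iter_Suc, simp add: root_iter_def)

lemma sem_root_t:
  "sem (root_t e) [k] = foldl (\<lambda>acc x. if len k \<le> len acc ^ e then acc else Cons_val Nil_val acc)
     Nil_val (vlist k)"
  unfolding root_t_def by (simp cong: if_cong)

lemma len_sem_root_t [simp]: "len (sem (root_t e) [k]) = ceil_root e (len k)"
  unfolding sem_root_t len_foldl_root ..

lemma bnd_root_t:
  assumes "len k \<le> Z" "(len k + 1) ^ e \<le> Z"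
  shows "bnd Z (root_t e) [k]"
proof -
  let ?f = "\<lambda>acc x. if len k \<le> len acc ^ e then acc else Cons_val Nil_val acc"
  have step: "sem (TIf (app le_t [TV 2, app (pow_t e) [TV 1]]) (TV 1) (TC TN (TV 1))) [x, acc, k] = ?f acc x"
    for acc x by (simp cong: if_cong)
  have "bnd Z (TIf (app le_t [TV 2, app (pow_t e) [TV 1]]) (TV 1) (TC TN (TV 1)))
      [x, foldl ?f Nil_val ys, k]" if "vlist k = ys @ x # zs" for ys x zs
  proof -
    let ?acc = "foldl ?f Nil_val ys"
    have "len ?acc \<le> length ys" using root_iter_invariant unfolding len_foldl_root by blast
    also have "\<dots> \<le> len k" using that by simp
    finally have acc: "len ?acc \<le> len k" .
    then have "(len ?acc + 1) ^ e \<le> (len k + 1) ^ e" "len ?acc ^ e \<le> (len k + 1) ^ e"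
      by (intro power_mono; simp)+
    then have "(len ?acc + 1) ^ e \<le> Z" "len ?acc ^ e \<le> Z" "len ?acc \<le> Z" using assms acc by linarith+
    then show ?thesis using bnd_pow_t[of ?acc Z e] by simp
  qed
  then show ?thesis
    unfolding root_t_def bnd.simps(7) step using assms(1) by simp
qed

text \<open>The number of vertices that may be guessed, with the exponent \<open>e\<close> to be chosen as \<open>2 d\<close>.\<close>

definition budget :: "nat \<Rightarrow> nat \<Rightarrow> nat \<Rightarrow> nat" where
  "budget a e k = a * ceil_root e k ^ (e - 1)"

definition budget_t :: "nat \<Rightarrow> nat \<Rightarrow> tm" where
  "budget_t a e = app (app consall_t [const_t a, pow_t (e - 1)]) [app (root_t e) [TV 0]]"

lemma len_sem_budget_t [simp]: "len (sem (budget_t a e) [k]) = budget a e (len k)"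
  by (simp add: budget_t_def budget_def)

lemma bnd_budget_t:
  assumes "len k \<le> Z" "(len k + 1) ^ e \<le> Z" "a \<le> Z"
  shows "bnd Z (budget_t a e) [k]"
proof -
  let ?r = "sem (root_t e) [k]"
  have r: "len ?r \<le> len k" using ceil_root_le by simp
  have "(len ?r + 1) ^ (e - 1) \<le> (len k + 1) ^ e"
  proof -
    have "(len ?r + 1) ^ (e - 1) \<le> (len k + 1) ^ (e - 1)" using r by (intro power_mono) auto
    also have "\<dots> \<le> (len k + 1) ^ e" by (intro power_increasing) auto
    finally show ?thesis .
  qed
  moreover have "len ?r ^ (e - 1) \<le> (len ?r + 1) ^ (e - 1)" by (intro power_mono) auto
  ultimately have "(len ?r + 1) ^ (e - 1) \<le> Z" "len ?r ^ (e - 1) \<le> Z" using assms(2) by linarith+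
  moreover have "len ?r \<le> Z" using r assms(1) by linarith
  ultimately show ?thesis
    unfolding budget_t_def using assms bnd_root_t[of k Z e] bnd_pow_t[of ?r Z "e - 1"]
    by (simp del: len_sem_root_t)
qed

text \<open>The environment is \<open>[A, k, all vertices, non-isolated vertices]\<close>. More than
  \<open>q * k\<close> non-isolated vertices mean "no" by the kernel bound. Without edges the empty
  cover suffices, but a connected cover must consist of at least one vertex.\<close>

definition answer_t :: "bool \<Rightarrow> nat \<Rightarrow> nat \<Rightarrow> nat \<Rightarrow> tm" where
  "answer_t conn q a e = TIf (TV 3)
     (TIf (app le_t [TV 3, app consall_t [const_t q, TV 1]])
       (TIf (app (search_t conn) [TV 0, TV 3, TV 1, app (budget_t a e) [TV 1]]) tt TN) TN)
     (if conn then TIf (TV 2) (TIf (TV 1) tt TN) TN else tt)"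

definition main_t :: "bool \<Rightarrow> nat \<Rightarrow> nat \<Rightarrow> nat \<Rightarrow> tm" where
  "main_t conn q a e =
     app (app (app (answer_t conn q a e)
           [TV 0, TV 1, TV 2, tfilter (TV 2) (tex (TV 3) (app adj_t [TV 2, TV 1, TV 0]))])
         [TV 0, TV 1, TFold (TV 0) TN (TC (TV 1) (TV 1))])
       [THd (TV 0), TTl (TV 0)]"

text \<open>Von Neumann numerals: the accumulator is the list of all smaller numbers and at the same
  time represents the next one, so it is put in front of itself.\<close>

definition all_verts :: "val \<Rightarrow> val" where
  "all_verts A = foldl (\<lambda>acc x. Cons_val acc acc) Nil_val (vlist A)"

definition nonisolated :: "val \<Rightarrow> val" where
  "nonisolated A = enc_list (rev (filter (\<lambda>x. \<exists>y \<in> lens (all_verts A). (len x, y) \<in> arel A)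
     (vlist (all_verts A))))"

lemma nonisolated_eq:
  "sem (tfilter (TV 2) (tex (TV 3) (app adj_t [TV 2, TV 1, TV 0]))) [A, k, all_verts A] = nonisolated A"
  by (intro vlist_inject[THEN iffD1]) (simp add: nonisolated_def bex_lens)

lemma sem_main_t:
  "sem (main_t conn q a e) [Cons_val A k] = sem (answer_t conn q a e) [A, k, all_verts A, nonisolated A]"
proof -
  have "foldl (\<lambda>acc x. Cons_val acc acc) Nil_val (vlist A) = all_verts A" by (simp add: all_verts_def)
  then show ?thesis unfolding main_t_def by (simp add: nonisolated_eq del: One_nat_def)
qed

lemma foldl_all_verts: "map len (vlist (foldl (\<lambda>acc x. Cons_val acc acc) Nil_val xs)) = rev [0..<length xs]"
proof (induction xs rule: rev_induct)
  case (snoc x xs)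
  moreover from snoc have "len (foldl (\<lambda>acc x. Cons_val acc acc) Nil_val xs) = length xs"
    by (metis length_map length_rev length_upt minus_nat.diff_0)
  ultimately show ?case by simp
qed simp

lemma map_len_all_verts: "map len (vlist (all_verts A)) = rev [0..<len A]"
  unfolding all_verts_def by (rule foldl_all_verts)

lemma lens_all_verts: "lens (all_verts A) = {0..<len A}"
  unfolding lens_def using arg_cong[OF map_len_all_verts, of set A] by simp

lemma distinct_lens_all_verts: "distinct_lens (all_verts A)"
  unfolding distinct_lens_def map_len_all_verts by simp

lemma len_all_verts: "len (all_verts A) = len A"
  using arg_cong[OF map_len_all_verts, of length A] by simp

lemma vlist_nonisolated:
  "vlist (nonisolated A) = rev (filter (\<lambda>x. \<exists>y \<in> lens (all_verts A). (len x, y) \<in> arel A) (vlist (all_verts A)))"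
  by (simp add: nonisolated_def)

lemma distinct_lens_nonisolated: "distinct_lens (nonisolated A)"
  by (rule distinct_lens_filter[OF distinct_lens_all_verts vlist_nonisolated])

lemma lens_nonisolated: "lens (nonisolated A) = {x \<in> {0..<len A}. \<exists>y \<in> {0..<len A}. (x, y) \<in> arel A}"
  unfolding lens_def[of "nonisolated A"] vlist_nonisolated lens_all_verts[symmetric] by (auto simp: lens_def)

lemma nonisolated_mem: "x \<in> set (vlist (nonisolated A)) \<Longrightarrow> len x < len A"
  using lens_nonisolated[of A] len_in_lens[of x "nonisolated A"] by auto

text \<open>An upper bound, up to the factor \<open>n + 1\<close>, for the length of all lists that the program
  traverses.\<close>

definition growth :: "nat \<Rightarrow> nat \<Rightarrow> nat \<Rightarrow> nat \<Rightarrow> nat" where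
  "growth q a e k = (q + a + k + 2) ^ ((e + 7) * (budget a e k + 1))"

text \<open>Everything is compared with powers of \<open>b\<close>. From
  \<open>N \<le> b ^ 2\<close> one gets \<open>N ^ 3 + 1 \<le> b ^ 7\<close>, whence the 7 and, for
  words of length \<open>M\<close>, the factor \<open>M + 1\<close> in the exponent;
  \<open>(k + 1) ^ e\<close> and \<open>M\<close> itself are at most \<open>b ^ e\<close>.\<close>

lemma growth_bounds:
  fixes q a e k N :: nat
  defines "G \<equiv> growth q a e k" and "M \<equiv> budget a e k"
  assumes e: "e \<ge> 1" and N: "N \<le> q * k"
  shows "k \<le> G" "q \<le> G" "a \<le> G" "1 \<le> G" "(k + 1) ^ e \<le> G" "M \<le> G"
    "(2 * N) * (2 * N) \<le> G" "N * (N * N) \<le> G" "(N * (N * N) + 1) ^ M \<le> G"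
proof -
  define b where "b = q + a + k + 2"
  have b: "q \<le> b" "a \<le> b" "k + 1 \<le> b" "2 \<le> b" by (auto simp: b_def)
  have pw: "b ^ i \<le> G" if "i \<le> (e + 7) * (M + 1)" for i
    unfolding G_def growth_def M_def[symmetric] b_def[symmetric]
    using that b by (intro power_increasing) auto
  have small: "b ^ i \<le> G" if "i \<le> e + 7" for i
    by (rule pw) (use that in \<open>simp add: trans_le_add1\<close>)
  have b1: "b \<le> G" using small[of 1] by simp
  with b show "k \<le> G" "q \<le> G" "a \<le> G" "1 \<le> G" by linarith+
  have "(k + 1) ^ e \<le> b ^ e" using b by (intro power_mono) auto
  then show "(k + 1) ^ e \<le> G" using small[of e] by linarith
  have "M \<le> b * b ^ (e - 1)"
    unfolding M_def budget_def using ceil_root_le[of e k] b by (intro mult_le_mono power_mono) linarith+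
  also have "\<dots> = b ^ e" using e by (metis Suc_diff_1 less_eq_Suc_le power_Suc One_nat_def)
  finally show "M \<le> G" using small[of e] by linarith
  have "q * k \<le> b * b" using b by (intro mult_le_mono) linarith+
  then have N2: "N \<le> b * b" using N by linarith
  have "(2 * N) * (2 * N) \<le> (b * (b * b)) * (b * (b * b))"
    using N2 b by (intro mult_le_mono)
  also have "\<dots> = b ^ 6" by (simp add: power_numeral_reduce)
  finally show "(2 * N) * (2 * N) \<le> G" using small[of 6] by linarith
  have "N * (N * N) \<le> (b * b) * ((b * b) * (b * b))" using N2 by (intro mult_le_mono)
  also have "\<dots> = b ^ 6" by (simp add: power_numeral_reduce)
  finally have N6: "N * (N * N) \<le> b ^ 6" .
  then show "N * (N * N) \<le> G" using small[of 6] by linarith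
  have "1 \<le> b ^ 6" using b by (intro one_le_power) linarith
  with N6 have "N * (N * N) + 1 \<le> 2 * b ^ 6" by linarith
  also have "\<dots> \<le> b * b ^ 6" using b by (intro mult_le_mono1)
  also have "\<dots> = b ^ 7" by (simp add: power_numeral_reduce)
  finally have "(N * (N * N) + 1) ^ M \<le> (b ^ 7) ^ M" by (intro power_mono) auto
  also have "\<dots> = b ^ (7 * M)" by (simp add: power_mult)
  also have "\<dots> \<le> G" by (rule pw) (simp add: algebra_simps)
  finally show "(N * (N * N) + 1) ^ M \<le> G" .
qed

text \<open>The number of guesses is bounded in terms of \<open>k\<close>, since the search runs
  only for at most \<open>q * k\<close> vertices. The factor \<open>len A + 1\<close> pays for the
  loops over the matrix and for the vertex numbers, which are list lengths up to
  \<open>len A\<close>.\<close>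

lemma bnd_main_t:
  assumes e: "e \<ge> 1"
  shows "bnd ((len A + 1) * growth q a e (len k)) (main_t conn q a e) [Cons_val A k]"
proof -
  let ?G = "growth q a e (len k)"
  define Z where "Z = (len A + 1) * ?G"
  have G1: "1 \<le> ?G" using growth_bounds(4)[OF e, of 0 q "len k" a] by simp
  have GZ: "?G \<le> Z" unfolding Z_def by simp
  have AZ: "len A + 1 \<le> Z" unfolding Z_def using mult_le_mono2[OF G1, of "len A + 1"] by simp
  have all: "len (all_verts A) \<le> Z" "x \<in> set (vlist (all_verts A)) \<Longrightarrow> len x \<le> Z" for x
    using AZ lens_all_verts[of A] len_in_lens[of x "all_verts A"] by (auto simp: len_all_verts)
  have k: "len k \<le> Z" "q \<le> Z" "a \<le> Z" "(len k + 1) ^ e \<le> Z"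
    using growth_bounds(1,2,3,5)[OF e, of 0 q "len k" a] GZ by auto
  let ?V = "nonisolated A" and ?M = "sem (budget_t a e) [k]"
  have search: "bnd Z (search_t conn) [A, ?V, k, ?M]" if "len ?V \<le> q * len k"
  proof (rule bnd_search_t)
    note g = growth_bounds[OF e that, of a]
    show "fits Z ?V" unfolding fits_def
    proof (intro conjI ballI)
      show "2 * len ?V * (2 * len ?V) \<le> Z" using g(7) GZ by linarith
      show "len y \<le> Z" if "y \<in> set (vlist ?V)" for y using nonisolated_mem[OF that] AZ by linarith
      show "1 \<le> Z" using AZ by linarith
    qed
    show "len k \<le> Z" by (rule k)
    show "len ?M \<le> Z" "(len ?V * (len ?V * len ?V) + 1) ^ len ?M \<le> Z" "len ?V * (len ?V * len ?V) \<le> Z"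
      using g(6,8,9) GZ by (simp_all only: len_sem_budget_t)
  qed
  have answer: "bnd Z (answer_t conn q a e) [A, k, all_verts A, ?V]"
  proof -
    have "q * len k \<le> (len k + q + a + 2) ^ 2"
      unfolding power2_eq_square by (intro mult_le_mono) auto
    also have "\<dots> \<le> ?G" unfolding growth_def by (auto simp: add_ac intro!: power_increasing)
    finally have "q * len k \<le> Z" using GZ by linarith
    then show ?thesis
      unfolding answer_t_def using search k bnd_budget_t[OF k(1,4,3)] by simp
  qed
  have f: "foldl (\<lambda>acc x. Cons_val acc acc) Nil_val (vlist A) = all_verts A" by (simp add: all_verts_def)
  have "bnd Z (tfilter (TV 2) (tex (TV 3) (app adj_t [TV 2, TV 1, TV 0]))) [A, k, all_verts A]"
    using all by (auto intro!: bnd_intros)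
  then have "bnd Z (main_t conn q a e) [Cons_val A k]"
    unfolding main_t_def using answer AZ by (simp add: f nonisolated_eq del: One_nat_def)
  then show ?thesis unfolding Z_def .
qed

section \<open>Correctness and running time\<close>

text \<open>The three summands of the coefficient pay for the removed set, for one extra vertex, and
  for independent sets. The first uses \<open>k \<le> L ^ (2 * d)\<close> divided by
  \<open>L\<close>, the last \<open>d \<le> 2 * d - 1\<close>.\<close>

lemma budget_suffices:
  fixes d q k N x :: nat
  defines "L \<equiv> ceil_root (2 * d) k" and "M \<equiv> budget (d * q + 1 + (3 * d) ^ d) (2 * d) k"
  assumes "d \<ge> 1" "k \<ge> 1" "L * x \<le> d * N" "N \<le> q * k"
  shows "L \<ge> 1" "x + 1 \<le> M" "(2 * L * d + 1) ^ d \<le> M"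
proof -
  have kL: "k \<le> L ^ (2 * d)" unfolding L_def using assms(3) by (intro ceil_root_ge) simp
  show L: "L \<ge> 1" using kL assms(3,4) by (cases "L = 0") (auto simp: power_0_left)
  have Lp: "L ^ (2 * d) = L * L ^ (2 * d - 1)" using assms(3) by (cases d) auto
  have M: "M = d * q * L ^ (2 * d - 1) + L ^ (2 * d - 1) + (3 * d) ^ d * L ^ (2 * d - 1)"
    unfolding M_def budget_def L_def by (simp add: algebra_simps)
  have one: "1 \<le> L ^ (2 * d - 1)" using L by (intro one_le_power)
  have "L * x \<le> d * (q * k)" using assms(5,6) mult_le_mono2[of N "q * k" d] by linarith
  also have "\<dots> \<le> d * (q * L ^ (2 * d))" using kL by (intro mult_le_mono2)
  also have "\<dots> = L * (d * q * L ^ (2 * d - 1))" unfolding Lp by (simp add: algebra_simps)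
  finally have "x \<le> d * q * L ^ (2 * d - 1)" using L by simp
  then show "x + 1 \<le> M" unfolding M using one by linarith
  have "1 \<le> L * d" using L assms(3) by simp
  then have "2 * (L * d) + 1 \<le> 3 * (L * d)" by linarith
  then have "2 * L * d + 1 \<le> 3 * d * L" by (simp add: mult_ac)
  then have "(2 * L * d + 1) ^ d \<le> (3 * d * L) ^ d" by (intro power_mono) auto
  also have "\<dots> = (3 * d) ^ d * L ^ d" by (simp add: power_mult_distrib)
  also have "\<dots> \<le> (3 * d) ^ d * L ^ (2 * d - 1)"
    using L assms(3) by (intro mult_le_mono2 power_increasing) auto
  finally show "(2 * L * d + 1) ^ d \<le> M" unfolding M by linarith
qed

lemma sem_answer_t:
  "sem (answer_t conn q a e) [A, k, V0, V] = enc_bool (if truthy V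
     then len V \<le> q * len k \<and> truthy (sem (search_t conn) [A, V, k, sem (budget_t a e) [k]])
     else conn \<longrightarrow> truthy V0 \<and> truthy k)"
  by (cases conn) (simp_all add: answer_t_def enc_bool_def)

lemma vlist_enc_graph:
  "vlist (enc_graph n G) = map (\<lambda>u. enc_list (map (\<lambda>v. enc_bool ((u, v) \<in> parcs G)) [0..<n])) [0..<n]"
  by (simp add: enc_graph_def)

lemma arel_enc_graph:
  assumes "parcs G \<subseteq> {0..<n} \<times> {0..<n}"
  shows "arel (enc_graph n G) = parcs G"
  using assms by (auto simp: arel_def vnth_def vlist_enc_graph enc_bool_def split: if_splits)

lemma connected_induce_iff:
  assumes "sym (parcs G)"
  shows "Digraph_Component.connected (induce_subgraph (with_proj G) S) \<longleftrightarrow> S \<noteq> {} \<and> conn_in (parcs G) S"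
proof -
  let ?H = "induce_subgraph (with_proj G) S"
  have "arcs_ends ?H = Restr (parcs G) S" by (auto simp: arcs_ends_conv)
  then have "symcl (arcs_ends ?H) = Restr (parcs G) S"
    using assms by (auto simp: symcl_def sym_def)
  moreover have "(u, v) \<in> rtrancl_on S (Restr (parcs G) S) \<longleftrightarrow> (u, v) \<in> (Restr (parcs G) S)\<^sup>*"
    if "u \<in> S" "v \<in> S" for u v
  proof
    assume "(u, v) \<in> (Restr (parcs G) S)\<^sup>*"
    then show "(u, v) \<in> rtrancl_on S (Restr (parcs G) S)"
      by (rule rtrancl_consistent_rtrancl_on) (use that in auto)
  qed (rule rtrancl_on_rtranclI)
  ultimately show ?thesis unfolding connected_conv conn_in_def by auto
qed

section \<open>From covers of the graph to covers of its non-isolated vertices\<close>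

locale ball_instance =
  fixes G :: "nat pair_pre_digraph" and n :: nat
  assumes graph: "pair_graph G" and verts: "pverts G = {0..<n}"
begin

abbreviation "R \<equiv> parcs G"

definition N :: "nat set" where
  "N = {x \<in> {0..<n}. \<exists>y \<in> {0..<n}. (x, y) \<in> R}"

interpretation pair_graph G by (rule graph)

lemma sym_R: "sym R"
  using sym_arcs by (simp add: symmetric_def)

lemma R_verts: "R \<subseteq> {0..<n} \<times> {0..<n}"
  using in_arcsD1 in_arcsD2 verts by auto

lemma R_N: "R \<subseteq> N \<times> N"
  using R_verts symD[OF sym_R] unfolding N_def by blast

lemma vertex_cover_iff: "vertex_cover G S \<longleftrightarrow> S \<subseteq> {0..<n} \<and> (\<forall>(u, v) \<in> R. u \<in> S \<or> v \<in> S)"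
  by (simp add: vertex_cover_def verts)

lemma covers_imp_vertex_cover: "covers R N S \<Longrightarrow> vertex_cover G S"
  unfolding covers_def vertex_cover_iff using R_N unfolding N_def by blast

lemma has_vertex_cover_iff: "has_vertex_cover G k \<longleftrightarrow> (\<exists>S. covers R N S \<and> card S \<le> k)"
proof
  assume "has_vertex_cover G k"
  then obtain S where S: "vertex_cover G S" "card S \<le> k" unfolding has_vertex_cover_def by blast
  have "finite S" using S(1) unfolding vertex_cover_iff by (meson finite_atLeastLessThan finite_subset)
  then have "card (S \<inter> N) \<le> k" using S(2) card_mono[of S "S \<inter> N"] by simp
  moreover have "covers R N (S \<inter> N)" using S(1) unfolding vertex_cover_iff covers_def by blast
  ultimately show "\<exists>S. covers R N S \<and> card S \<le> k" by blast
qed (use covers_imp_vertex_cover in \<open>auto simp: has_vertex_cover_def\<close>)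

text \<open>Once there is an edge, a cover contains a non-isolated vertex, and connectedness then
  keeps isolated vertices out.\<close>

lemma has_connected_vertex_cover_iff:
  assumes "N \<noteq> {}"
  shows "has_connected_vertex_cover G k \<longleftrightarrow> (\<exists>S. covers R N S \<and> conn_in R S \<and> card S \<le> k)"
proof -
  obtain x where "x \<in> N" using assms by blast
  then obtain y where xy: "(x, y) \<in> R" unfolding N_def by blast
  have "connected_vertex_cover G S \<longleftrightarrow> covers R N S \<and> conn_in R S" for S
  proof
    assume "connected_vertex_cover G S"
    then have S: "vertex_cover G S" "conn_in R S"
      unfolding connected_vertex_cover_def connected_induce_iff[OF sym_R] by blast+
    have "S \<subseteq> N"
    proof
      fix s assume s: "s \<in> S"
      obtain z where z: "z \<in> S" "z \<in> N" using S(1) xy R_N unfolding vertex_cover_iff by blast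
      then have "(s, z) \<in> (Restr R S)\<^sup>*" using S(2) s unfolding conn_in_def by blast
      then show "s \<in> N"
      proof (cases rule: converse_rtranclE)
        case base
        then show ?thesis using z by simp
      next
        case (step w)
        then show ?thesis using R_N by blast
      qed
    qed
    then show "covers R N S \<and> conn_in R S" using S unfolding vertex_cover_iff covers_def by blast
  next
    assume S: "covers R N S \<and> conn_in R S"
    then have "S \<noteq> {}" using xy R_N unfolding covers_def by blast
    with S show "connected_vertex_cover G S"
      unfolding connected_vertex_cover_def connected_induce_iff[OF sym_R]
      using covers_imp_vertex_cover by blast
  qed
  then show ?thesis unfolding has_connected_vertex_cover_def by simp
qed

lemma edgeless:
  assumes "N = {}"
  shows "has_vertex_cover G k" "has_connected_vertex_cover G k \<longleftrightarrow> n \<noteq> 0 \<and> k \<noteq> 0"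
proof -
  have R: "R = {}" using R_N assms by blast
  have "vertex_cover G {}" unfolding vertex_cover_iff R by simp
  then show "has_vertex_cover G k" unfolding has_vertex_cover_def by (intro exI[of _ "{}"]) simp
  show "has_connected_vertex_cover G k \<longleftrightarrow> n \<noteq> 0 \<and> k \<noteq> 0"
  proof
    assume "has_connected_vertex_cover G k"
    then obtain S where S: "S \<subseteq> {0..<n}" "S \<noteq> {}" "card S \<le> k"
      unfolding has_connected_vertex_cover_def connected_vertex_cover_def
        connected_induce_iff[OF sym_R] vertex_cover_iff by blast
    then have "card S \<noteq> 0" by (meson card_0_eq finite_atLeastLessThan finite_subset)
    with S show "n \<noteq> 0 \<and> k \<noteq> 0" by auto
  next
    assume "n \<noteq> 0 \<and> k \<noteq> 0"
    then have "connected_vertex_cover G {0}" "card {0::nat} \<le> k"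
      unfolding connected_vertex_cover_def connected_induce_iff[OF sym_R] vertex_cover_iff R conn_in_def
      by auto
    then show "has_connected_vertex_cover G k" unfolding has_connected_vertex_cover_def by blast
  qed
qed

lemma lens_nonisolated_enc_graph: "lens (nonisolated (enc_graph n G)) = N"
  unfolding lens_nonisolated arel_enc_graph[OF R_verts] N_def by (simp add: vlist_enc_graph)

lemma sem_main_t_correct:
  fixes c :: "nat \<Rightarrow> real ^ 'd"
  defines "q \<equiv> 1 + (4 * CARD('d) + 1) ^ CARD('d)"
  assumes c: "\<And>u v. u < n \<Longrightarrow> v < n \<Longrightarrow> (u, v) \<in> R \<longleftrightarrow> u \<noteq> v \<and> cball (c u) 1 \<inter> cball (c v) 1 \<noteq> {}"
  shows "sem (main_t conn q (CARD('d) * q + 1 + (3 * CARD('d)) ^ CARD('d)) (2 * CARD('d))) [enc_instance n G k] =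
    enc_bool (if conn then has_connected_vertex_cover G k else has_vertex_cover G k)"
proof -
  let ?A = "enc_graph n G" and ?k = "enc_nat k" and ?d = "CARD('d)"
  let ?a = "?d * q + 1 + (3 * ?d) ^ ?d"
  let ?V = "nonisolated ?A" and ?M = "sem (budget_t ?a (2 * ?d)) [?k]"
  have A: "arel ?A = R" by (rule arel_enc_graph[OF R_verts])
  have V: "lens ?V = N" by (rule lens_nonisolated_enc_graph)
  have lenV: "len ?V = card N" using distinct_lens_card[OF distinct_lens_nonisolated[of ?A]] V by simp
  have k: "len ?k = k" by (simp add: enc_nat_def)
  have M: "len ?M = budget ?a (2 * ?d) k" by (simp add: k)
  interpret B: ball_rep c R N
    by unfold_locales (use c[unfolded unit_cballs_intersect_iff] in \<open>auto simp: N_def\<close>)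
  let ?Q = "\<exists>S. covers R N S \<and> (conn \<longrightarrow> conn_in R S) \<and> card S \<le> k"
  have search: "card N \<le> q * k \<and> truthy (sem (search_t conn) [?A, ?V, ?k, ?M]) \<longleftrightarrow> ?Q" if ne: "N \<noteq> {}"
  proof
    assume "card N \<le> q * k \<and> truthy (sem (search_t conn) [?A, ?V, ?k, ?M])"
    then show ?Q using search_t_sound[of conn ?A ?V ?k ?M] unfolding A V k by simp
  next
    assume ?Q
    then obtain S where S: "covers R N S" "conn \<longrightarrow> conn_in R S" "card S \<le> k" by blast
    have S_N: "S \<subseteq> N" using S(1) by (simp add: covers_def)
    have finN: "finite N" by (simp add: N_def)
    then have finS: "finite S" using S_N finite_subset by blast
    obtain s where s: "s \<in> S"
    proof -
      obtain x where "x \<in> N" using ne by blast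
      then obtain y where "(x, y) \<in> R" unfolding N_def by blast
      then show ?thesis using S(1) R_N that unfolding covers_def by blast
    qed
    have k1: "k \<ge> 1" using s S(3) finS by (metis One_nat_def Suc_leI card_gt_0_iff empty_iff le_trans)
    have "card N \<le> q * card S" unfolding q_def
      by (rule B.kernel_bound[OF S(1)]) (use R_N in \<open>auto simp: N_def\<close>)
    then have Nq: "card N \<le> q * k" using S(3) mult_le_mono2[of "card S" k q] by linarith
    define L where "L = ceil_root (2 * ?d) k"
    have L1: "L \<ge> 1"
      unfolding L_def by (rule budget_suffices(1)[of ?d k 0 0 0]) (use k1 in auto)
    from B.shifting[OF L1] obtain X where X: "X \<subseteq> N" "L * card X \<le> ?d * card N"
      "\<forall>x \<in> N - X. \<forall>I. I \<subseteq> {y. (x, y) \<in> (Restr R (N - X))\<^sup>*} \<longrightarrow>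
         (\<forall>u \<in> I. \<forall>v \<in> I. (u, v) \<notin> R) \<longrightarrow> card I \<le> (2 * L * ?d + 1) ^ ?d"
      by (elim exE conjE) (rule that)
    have b: "card X + 1 \<le> len ?M" "(2 * L * ?d + 1) ^ ?d \<le> len ?M"
      unfolding M L_def
      by (rule budget_suffices[of ?d k "card X" "card N"]; use k1 X(2) Nq in \<open>simp add: L_def\<close>)+
    have "truthy (sem (search_t conn) [?A, ?V, ?k, ?M])"
    \<comment> \<open>Adding a vertex \<open>s\<close> of the solution to \<open>X\<close>
      guarantees the anchor for connectivity; the budget has room for it.\<close>
    proof (rule search_t_complete[where S = S and X = "insert s X"])
      show "sym (arel ?A)" using sym_R A by simp
      show "distinct_lens ?V" by (rule distinct_lens_nonisolated)
      show "covers (arel ?A) (lens ?V) S" "conn \<Longrightarrow> conn_in (arel ?A) S" "card S \<le> len ?k"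
        using S unfolding A V k by auto
      show "insert s X \<subseteq> lens ?V" using X(1) s S_N V by blast
      show "S \<inter> insert s X \<noteq> {}" using s by blast
      have "card (insert s X) \<le> Suc (card X)" by (rule card_insert_le_m1) auto
      then show "card (insert s X) \<le> len ?M" using b(1) by linarith
      fix x I
      assume x: "x \<in> lens ?V - insert s X"
        and I: "I \<subseteq> {y. (x, y) \<in> (Restr (arel ?A) (lens ?V - insert s X))\<^sup>*}"
          "\<forall>u \<in> I. \<forall>v \<in> I. (u, v) \<notin> arel ?A"
      \<comment> \<open>Removing \<open>s\<close> as well only shrinks the components, so the bound
        obtained for \<open>X\<close> carries over.\<close>
      have "I \<subseteq> {y. (x, y) \<in> (Restr R (N - X))\<^sup>*}"
      proof
        fix y assume "y \<in> I"
        then have "(x, y) \<in> (Restr R (N - insert s X))\<^sup>*" using I(1) unfolding A V by blast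
        then show "y \<in> {y. (x, y) \<in> (Restr R (N - X))\<^sup>*}"
          using rtrancl_Restr_mono[of "N - insert s X" "N - X"] by blast
      qed
      then have "card I \<le> (2 * L * ?d + 1) ^ ?d"
        using X(3)[rule_format, of x I] x I(2) unfolding A V by simp
      then show "card I \<le> len ?M" using b(2) by linarith
    qed
    with Nq show "card N \<le> q * k \<and> truthy (sem (search_t conn) [?A, ?V, ?k, ?M])" by blast
  qed
  have N_nil: "?V = Nil_val \<longleftrightarrow> N = {}" using V by (auto simp: lens_def)
  have "len (all_verts ?A) = n" unfolding len_all_verts vlist_enc_graph by simp
  then have n_nil: "all_verts ?A = Nil_val \<longleftrightarrow> n = 0" by (cases "all_verts ?A") auto
  have k_nil: "?k = Nil_val \<longleftrightarrow> k = 0" by (cases k) (auto simp: enc_nat_def)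
  have ans: "sem (main_t conn q ?a (2 * ?d)) [enc_instance n G k] =
      enc_bool (if N \<noteq> {} then card N \<le> q * k \<and> truthy (sem (search_t conn) [?A, ?V, ?k, ?M])
       else conn \<longrightarrow> n \<noteq> 0 \<and> k \<noteq> 0)"
    unfolding enc_instance_def sem_main_t sem_answer_t lenV k N_nil n_nil k_nil ..
  show ?thesis
  proof (cases "N = {}")
    case True
    then show ?thesis unfolding ans using edgeless[OF True, of k] by simp
  next
    case False
    then show ?thesis unfolding ans
      using search[OF False] has_vertex_cover_iff[of k] has_connected_vertex_cover_iff[OF False, of k] by simp
  qed
qed

end

section \<open>Asymptotics of the running time\<close>

lemma powr_times_ln_smallo:
  fixes \<delta> c :: real
  assumes "0 < \<delta>" "\<delta> < 1" "c > 0"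
  shows "(\<lambda>k::nat. real k powr (1 - \<delta>) * ln (real k + c)) \<in> o(\<lambda>k. real k)"
  using assms by real_asymp

text \<open>\<open>ceil_root e k - 1\<close> is at most the real root, which is at least 1, so
  rounding up costs at most a factor 2; this factor is then raised to the power
  \<open>e - 1\<close>.\<close>

lemma budget_le:
  assumes "e \<ge> 1" "k \<ge> 1"
  shows "real (budget a e k) \<le> real a * 2 ^ (e - 1) * real k powr (1 - 1 / real e)"
proof -
  let ?r = "ceil_root e k" and ?p = "real k powr (1 / real e)"
  have p1: "1 \<le> ?p" using assms by (intro ge_one_powr_ge_zero) auto
  have "real (?r - 1) \<le> ?p"
  proof (cases "?r \<le> 1")
    case False
    then have "real (?r - 1) ^ e < real k"
      using ceil_root_minimal[of e k] by (metis le0 of_nat_less_iff of_nat_power le_zero_eq zero_le_one)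
    moreover have "real (?r - 1) = (real (?r - 1) ^ e) powr (1 / real e)"
      using False assms by (simp add: powr_powr flip: powr_realpow)
    ultimately show ?thesis by (metis less_imp_le of_nat_0_le_iff powr_mono2 zero_le_divide_1_iff zero_le_power)
  qed (use p1 in simp)
  then have "real ?r \<le> 2 * ?p" using p1 by linarith
  then have "real ?r ^ (e - 1) \<le> (2 * ?p) ^ (e - 1)" by (intro power_mono) auto
  also have "\<dots> = 2 ^ (e - 1) * ?p ^ (e - 1)" by (simp add: power_mult_distrib)
  also have "?p ^ (e - 1) = real k powr (1 - 1 / real e)"
    using assms by (simp add: powr_powr field_simps of_nat_diff flip: powr_realpow)
  finally have "real a * real ?r ^ (e - 1) \<le> real a * (2 ^ (e - 1) * real k powr (1 - 1 / real e))"
    by (intro mult_left_mono) auto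
  then show ?thesis by (simp add: budget_def mult.assoc)
qed

text \<open>The logarithm turns \<open>growth\<close> into its exponent,
  \<open>O(k powr (1 - 1 / e))\<close>, times the logarithm of its base; the saved power
  \<open>k powr (1 / e)\<close> beats that logarithm.\<close>

lemma log_growth_smallo:
  fixes q a e K D :: nat
  assumes "e \<ge> 2"
  shows "(\<lambda>k. log 2 (real (K + 1) * real (growth q a e k) ^ D)) \<in> o(\<lambda>k. real k)"
proof -
  let ?c = "real (q + a + 2)"
  let ?w = "real (D * (e + 7)) / ln 2"
  let ?u = "(real a + 1) * 2 ^ (e - 1)"
  have eq: "log 2 (real (K + 1) * real (growth q a e k) ^ D) =
      log 2 (real (K + 1)) + ?w * ((real (budget a e k) + 1) * ln (real k + ?c))" for k
  proof -
    have g: "real (growth q a e k) ^ D = (real k + ?c) ^ (D * ((e + 7) * (budget a e k + 1)))"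
      unfolding growth_def by (simp add: power_mult[symmetric] algebra_simps)
    have "log 2 (real (K + 1) * real (growth q a e k) ^ D) =
        log 2 (real (K + 1)) + log 2 ((real k + ?c) ^ (D * ((e + 7) * (budget a e k + 1))))"
      unfolding g by (rule log_mult_pos) auto
    also have "log 2 ((real k + ?c) ^ (D * ((e + 7) * (budget a e k + 1)))) =
        ?w * ((real (budget a e k) + 1) * ln (real k + ?c))"
      by (simp add: log_def ln_realpow algebra_simps add_divide_distrib)
    finally show ?thesis .
  qed
  let ?g = "\<lambda>k. ?u * (real k powr (1 - 1 / real e) * ln (real k + ?c)) + ln (real k + ?c)"
  have c: "?c > 0" by simp
  have "(\<lambda>k. ln (real k + ?c)) \<in> o(\<lambda>k. real k)" using c by real_asymp
  moreover have "(\<lambda>k. real k powr (1 - 1 / real e) * ln (real k + ?c)) \<in> o(\<lambda>k. real k)"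
    using assms by (intro powr_times_ln_smallo) (auto simp: field_simps)
  ultimately have g: "?g \<in> o(\<lambda>k. real k)" by (intro sum_in_smallo landau_o.small.cmult_in_iff[THEN iffD2]) simp_all
  have norm_mono: "norm x \<le> 1 * norm y" if "0 \<le> x" "x \<le> y" for x y :: real using that by simp
  have "(\<lambda>k. (real (budget a e k) + 1) * ln (real k + ?c)) \<in> O(?g)"
  proof (rule bigoI[where c = 1], rule eventually_mono[OF eventually_ge_at_top[of 1]])
    fix k :: nat assume "1 \<le> k"
    then have "real (budget a e k) \<le> real a * 2 ^ (e - 1) * real k powr (1 - 1 / real e)"
      using assms by (intro budget_le) auto
    also have "\<dots> \<le> ?u * real k powr (1 - 1 / real e)" by (intro mult_right_mono) auto
    finally have "real (budget a e k) + 1 \<le> ?u * real k powr (1 - 1 / real e) + 1" by simp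
    moreover have l: "0 \<le> ln (real k + ?c)" by (intro ln_ge_zero) simp
    ultimately have "(real (budget a e k) + 1) * ln (real k + ?c) \<le> ?g k"
      using mult_right_mono[of "real (budget a e k) + 1" "?u * real k powr (1 - 1 / real e) + 1" "ln (real k + ?c)"]
      by (simp add: algebra_simps)
    moreover have "0 \<le> (real (budget a e k) + 1) * ln (real k + ?c)" using l by simp
    ultimately show "norm ((real (budget a e k) + 1) * ln (real k + ?c)) \<le> 1 * norm (?g k)"
      by (rule norm_mono[rotated])
  qed
  then have "(\<lambda>k. (real (budget a e k) + 1) * ln (real k + ?c)) \<in> o(\<lambda>k. real k)"
    using g by (rule landau_o.big_small_trans)
  then have "(\<lambda>k. ?w * ((real (budget a e k) + 1) * ln (real k + ?c))) \<in> o(\<lambda>k. real k)"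
    by simp
  moreover have "(\<lambda>k::nat. log 2 (real (K + 1))) \<in> o(\<lambda>k. real k)" by real_asymp
  ultimately show ?thesis unfolding eq by (intro sum_in_smallo)
qed

lemma unit_ball_algorithm:
  "param_subexp_algorithm_on (unit_ball_graph TYPE('d::finite))
     (if conn then has_connected_vertex_cover else has_vertex_cover)"
proof -
  let ?d = "CARD('d)"
  define q where "q = 1 + (4 * ?d + 1) ^ ?d"
  define a where "a = ?d * q + 1 + (3 * ?d) ^ ?d"
  define e where "e = 2 * ?d"
  have e: "e \<ge> 2" unfolding e_def by simp
  obtain P K D where P: "\<And>Z x. Z \<ge> 1 \<Longrightarrow> bnd Z (main_t conn q a e) [x] \<Longrightarrow>
      \<exists>s \<le> K * Z ^ D. computes_in P x (sem (main_t conn q a e) [x]) s"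
    using tm_program[of "main_t conn q a e"] by meson
  \<comment> \<open>\<open>K + 1\<close> instead of \<open>K\<close> keeps the argument of the
    logarithm positive, so that \<open>2 powr f k\<close> recovers it exactly.\<close>
  define f where "f k = log 2 (real (K + 1) * real (growth q a e k) ^ D)" for k
  have "\<exists>t. computes_in P (enc_instance n G k)
        (enc_bool ((if conn then has_connected_vertex_cover else has_vertex_cover) G k)) t \<and>
      real t \<le> 2 powr f k * (real n + 1) ^ D"
    if G: "unit_ball_graph TYPE('d) G" "pverts G = {0..<n}" for n G k
  proof -
    interpret ball_instance G n
      by (rule ball_instance.intro) (use G in \<open>auto simp: unit_ball_graph_def\<close>)
    obtain c :: "nat \<Rightarrow> real ^ 'd" where c: "\<And>u v. u < n \<Longrightarrow> v < n \<Longrightarrow>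
        (u, v) \<in> parcs G \<longleftrightarrow> u \<noteq> v \<and> cball (c u) 1 \<inter> cball (c v) 1 \<noteq> {}"
      using G unfolding unit_ball_graph_def by auto
    have sem: "sem (main_t conn q a e) [enc_instance n G k] =
        enc_bool ((if conn then has_connected_vertex_cover else has_vertex_cover) G k)"
      using sem_main_t_correct[OF c, of conn k] unfolding q_def[symmetric] a_def[symmetric] e_def[symmetric]
      by (simp add: if_distribR)
    have "len (enc_graph n G) = n" "len (enc_nat k) = k" by (simp_all add: vlist_enc_graph enc_nat_def)
    then have b: "bnd ((n + 1) * growth q a e k) (main_t conn q a e) [enc_instance n G k]"
      using bnd_main_t[of e "enc_graph n G" q a "enc_nat k" conn] e unfolding enc_instance_def by simp
    have g: "growth q a e k \<ge> 1" unfolding growth_def by simp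
    then have "(n + 1) * growth q a e k \<ge> 1" by simp
    from P[OF this b] obtain t where t: "t \<le> K * ((n + 1) * growth q a e k) ^ D"
      "computes_in P (enc_instance n G k) (sem (main_t conn q a e) [enc_instance n G k]) t" by blast
    have "real t \<le> real (K * ((n + 1) * growth q a e k) ^ D)" using t(1) of_nat_le_iff by blast
    also have "\<dots> \<le> real ((K + 1) * ((n + 1) * growth q a e k) ^ D)"
      unfolding of_nat_le_iff by (intro mult_le_mono1) simp
    also have "\<dots> = (real (K + 1) * real (growth q a e k) ^ D) * (real n + 1) ^ D"
      by (simp only: of_nat_mult of_nat_power of_nat_add of_nat_1 power_mult_distrib mult_ac)
    also have "real (K + 1) * real (growth q a e k) ^ D = 2 powr f k"
      unfolding f_def using g by (subst powr_log_cancel) auto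
    finally show ?thesis using t(2) unfolding sem by blast
  qed
  moreover have "f \<in> o(\<lambda>k. real k)" unfolding f_def[abs_def] by (rule log_growth_smallo[OF e])
  ultimately show ?thesis unfolding param_subexp_algorithm_on_def by blast
qed

theorem theorem11:
  shows "param_subexp_algorithm_on (unit_ball_graph TYPE('d::finite)) has_connected_vertex_cover \<and>
         param_subexp_algorithm_on (unit_ball_graph TYPE('d)) has_vertex_cover"
  using unit_ball_algorithm[of True] unit_ball_algorithm[of False] by simp

end
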